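(* For every integer $k\ge 1$, the Max Weight Independent Set problem is solvable in time $\mathcal{O}(|V(G)|^{k+1}\cdot|V(T)|)$ if the input vertex-weighted graph $G$ is given with a tree decomposition $\mathcal{T}=(T,\{X_t\}_{t\in V(T)})$ with independence number at most $k$.
   Context: All graphs are finite, simple, and undirected. A tree decomposition of a graph $G$ is a pair $\mathcal{T}=(T,\{X_t\}_{t\in V(T)})$ where $T$ is a tree and each node $t$ is assigned a bag $X_t\subseteq V(G)$ such that every vertex of $G$ is in at least one bag, every edge of $G$ has both endpoints in some common bag, and for every $u\in V(G)$ the subgraph of $T$ induced by $\{t: u\in X_t\}$ is connected. The independence number of $\mathcal{T}$ is $\alpha(\mathcal{T})=\max_{t\in V(T)}\alpha(G[X_t])$, where $\alpha(H)$ is the maximum size of an independent set in $H$. Max Weight Independent Set: given a graph $G$ and a weight function $w:V(G)\to\mathbb{Q}_+$ (nonnegative rationals), find an independent set $I$ of $G$ maximizing $w(I)=\sum_{x\in I}w(x)$. The integer $k$ is fixed (not part of the input). *)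

theory Defs
  imports Complex_Main
begin

section \<open>Graphs and tree decompositions\<close>

record 'a graph =
  verts :: "'a set"
  edges :: "'a set set"

definition simple_graph :: "'a graph \<Rightarrow> bool" where
  "simple_graph G \<longleftrightarrow> finite (verts G) \<and> (\<forall>e\<in>edges G. e \<subseteq> verts G \<and> card e = 2)"

definition induced :: "'a graph \<Rightarrow> 'a set \<Rightarrow> 'a graph" where
  "induced G S = \<lparr>verts = verts G \<inter> S, edges = {e \<in> edges G. e \<subseteq> S}\<rparr>"

definition adj_rel :: "'a graph \<Rightarrow> ('a \<times> 'a) set" where
  "adj_rel G = {(u, v). {u, v} \<in> edges G}"

definition connected_graph :: "'a graph \<Rightarrow> bool" where
  "connected_graph G \<longleftrightarrow>
     verts G \<noteq> {} \<and> (\<forall>u\<in>verts G. \<forall>v\<in>verts G. (u, v) \<in> (adj_rel G)\<^sup>*)"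

definition cycle :: "'a graph \<Rightarrow> 'a list \<Rightarrow> bool" where
  "cycle G xs \<longleftrightarrow> length xs \<ge> 3 \<and> distinct xs \<and>
     (\<forall>i<length xs. {xs ! i, xs ! (Suc i mod length xs)} \<in> edges G)"

definition tree :: "'a graph \<Rightarrow> bool" where
  "tree T \<longleftrightarrow> simple_graph T \<and> connected_graph T \<and> (\<nexists>xs. cycle T xs)"

definition independent_set :: "'a graph \<Rightarrow> 'a set \<Rightarrow> bool" where
  "independent_set G I \<longleftrightarrow> I \<subseteq> verts G \<and> (\<forall>u\<in>I. \<forall>v\<in>I. {u, v} \<notin> edges G)"

definition independence_number :: "'a graph \<Rightarrow> nat" where
  "independence_number G = Max {card I |I. independent_set G I}"

definition tree_decomposition :: "'a graph \<Rightarrow> 'b graph \<Rightarrow> ('b \<Rightarrow> 'a set) \<Rightarrow> bool" where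
  "tree_decomposition G T X \<longleftrightarrow>
     tree T \<and>
     (\<forall>t\<in>verts T. X t \<subseteq> verts G) \<and>
     (\<forall>u\<in>verts G. \<exists>t\<in>verts T. u \<in> X t) \<and>
     (\<forall>e\<in>edges G. \<exists>t\<in>verts T. e \<subseteq> X t) \<and>
     (\<forall>u\<in>verts G. connected_graph (induced T {t \<in> verts T. u \<in> X t}))"

definition td_independence_number :: "'a graph \<Rightarrow> 'b graph \<Rightarrow> ('b \<Rightarrow> 'a set) \<Rightarrow> nat" where
  "td_independence_number G T X = Max ((\<lambda>t. independence_number (induced G (X t))) ` verts T)"

definition max_weight_independent_set :: "'a graph \<Rightarrow> ('a \<Rightarrow> rat) \<Rightarrow> 'a set \<Rightarrow> bool" where
  "max_weight_independent_set G w I \<longleftrightarrow>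
     independent_set G I \<and> (\<forall>J. independent_set G J \<longrightarrow> sum w J \<le> sum w I)"


section \<open>The model of computation\<close>

text \<open>
  A unit-cost random access machine, with structured control flow. The memory is organised in
  named arrays of unbounded length, some holding natural numbers, some holding rationals; a
  scalar variable is cell 0 of an array. A program mentions finitely many arrays, which can
  therefore be interleaved in a single memory at the price of a constant factor. Indices are
  natural numbers and may be read from memory (indirect addressing).

  The only arithmetic operations are addition, subtraction (truncated on the natural numbers)
  and comparison. Multiplication is left out on purpose: at unit cost it would make the
  machine unreasonably powerful.
\<close>

type_synonym vname = string

datatype iexp =
    IConst nat
  | IGet vname iexp
  | IPlus iexp iexp
  | IMinus iexp iexp

datatype qexp =
    QConst rat
  | QGet vname iexp
  | QPlus qexp qexp
  | QMinus qexp qexp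

datatype bexp =
    ILess iexp iexp
  | QLess qexp qexp
  | BNot bexp
  | BAnd bexp bexp

datatype com =
    Skip
  | IAssign vname iexp iexp
  | QAssign vname iexp qexp
  | Seq com com
  | Cond bexp com com
  | While bexp com

record state =
  iarr :: "vname \<Rightarrow> nat \<Rightarrow> nat"
  qarr :: "vname \<Rightarrow> nat \<Rightarrow> rat"

primrec ival :: "iexp \<Rightarrow> state \<Rightarrow> nat" where
  "ival (IConst c) s = c"
| "ival (IGet x i) s = iarr s x (ival i s)"
| "ival (IPlus a b) s = ival a s + ival b s"
| "ival (IMinus a b) s = ival a s - ival b s"

primrec qval :: "qexp \<Rightarrow> state \<Rightarrow> rat" where
  "qval (QConst c) s = c"
| "qval (QGet x i) s = qarr s x (ival i s)"
| "qval (QPlus a b) s = qval a s + qval b s"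
| "qval (QMinus a b) s = qval a s - qval b s"

primrec bval :: "bexp \<Rightarrow> state \<Rightarrow> bool" where
  "bval (ILess a b) s \<longleftrightarrow> ival a s < ival b s"
| "bval (QLess a b) s \<longleftrightarrow> qval a s < qval b s"
| "bval (BNot b) s \<longleftrightarrow> \<not> bval b s"
| "bval (BAnd a b) s \<longleftrightarrow> bval a s \<and> bval b s"

primrec icost :: "iexp \<Rightarrow> nat" where
  "icost (IConst c) = 1"
| "icost (IGet x i) = 1 + icost i"
| "icost (IPlus a b) = 1 + icost a + icost b"
| "icost (IMinus a b) = 1 + icost a + icost b"

primrec qcost :: "qexp \<Rightarrow> nat" where
  "qcost (QConst c) = 1"
| "qcost (QGet x i) = 1 + icost i"
| "qcost (QPlus a b) = 1 + qcost a + qcost b"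
| "qcost (QMinus a b) = 1 + qcost a + qcost b"

primrec bcost :: "bexp \<Rightarrow> nat" where
  "bcost (ILess a b) = 1 + icost a + icost b"
| "bcost (QLess a b) = 1 + qcost a + qcost b"
| "bcost (BNot b) = 1 + bcost b"
| "bcost (BAnd a b) = 1 + bcost a + bcost b"

definition iupd :: "vname \<Rightarrow> nat \<Rightarrow> nat \<Rightarrow> state \<Rightarrow> state" where
  "iupd x i a s = s\<lparr>iarr := (iarr s)(x := (iarr s x)(i := a))\<rparr>"

definition qupd :: "vname \<Rightarrow> nat \<Rightarrow> rat \<Rightarrow> state \<Rightarrow> state" where
  "qupd x i a s = s\<lparr>qarr := (qarr s)(x := (qarr s x)(i := a))\<rparr>"

text \<open>\<open>exec c s t s'\<close>: started in \<open>s\<close>, program \<open>c\<close> halts after \<open>t\<close> elementary steps in \<open>s'\<close>.\<close>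

inductive exec :: "com \<Rightarrow> state \<Rightarrow> nat \<Rightarrow> state \<Rightarrow> bool" where
  Skip: "exec Skip s 1 s"
| IAssign: "exec (IAssign x i a) s (1 + icost i + icost a) (iupd x (ival i s) (ival a s) s)"
| QAssign: "exec (QAssign x i a) s (1 + icost i + qcost a) (qupd x (ival i s) (qval a s) s)"
| Seq: "exec c s t s' \<Longrightarrow> exec d s' t' s'' \<Longrightarrow> exec (Seq c d) s (t + t') s''"
| CondTrue: "bval b s \<Longrightarrow> exec c s t s' \<Longrightarrow> exec (Cond b c d) s (1 + bcost b + t) s'"
| CondFalse: "\<not> bval b s \<Longrightarrow> exec d s t s' \<Longrightarrow> exec (Cond b c d) s (1 + bcost b + t) s'"
| WhileFalse: "\<not> bval b s \<Longrightarrow> exec (While b c) s (1 + bcost b) s"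
| WhileTrue: "bval b s \<Longrightarrow> exec c s t s' \<Longrightarrow> exec (While b c) s' t' s'' \<Longrightarrow>
    exec (While b c) s (1 + bcost b + t + t') s''"

inductive_cases SkipE: "exec Skip s t s'"
inductive_cases IAssignE: "exec (IAssign x i a) s t s'"
inductive_cases QAssignE: "exec (QAssign x i a) s t s'"
inductive_cases SeqE: "exec (Seq c d) s t s'"
inductive_cases CondE: "exec (Cond b c d) s t s'"
inductive_cases WhileE: "exec (While b c) s t s'"

lemma exec_deterministic:
  "exec c s t s' \<Longrightarrow> exec c s u s'' \<Longrightarrow> u = t \<and> s'' = s'"
proof (induction arbitrary: u s'' rule: exec.induct)
  case (Skip s)
  then show ?case by (rule SkipE) simp
next
  case (IAssign x i a s)
  then show ?case by (rule IAssignE) simp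
next
  case (QAssign x i a s)
  then show ?case by (rule QAssignE) simp
next
  case (Seq c s t s1 d t' s2)
  from Seq.prems show ?case
    by (rule SeqE) (use Seq.IH in metis)
next
  case (CondTrue b s c t s' d)
  from CondTrue.prems show ?case
    by (rule CondE) (use CondTrue.IH CondTrue.hyps in force)+
next
  case (CondFalse b s d t s' c)
  from CondFalse.prems show ?case
    by (rule CondE) (use CondFalse.IH CondFalse.hyps in force)+
next
  case (WhileFalse b s c)
  from WhileFalse.prems show ?case
    by (rule WhileE) (use WhileFalse.hyps in simp_all)
next
  case (WhileTrue b s c t s1 t' s2)
  from WhileTrue.prems show ?case
    by (rule WhileE) (use WhileTrue.IH WhileTrue.hyps in force)+
qed


section \<open>Inputs and outputs\<close>

text \<open>
  The vertices of \<open>G\<close> are numbered \<open>0, \<dots>, n - 1\<close> and the nodes of \<open>T\<close> are numbered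
  \<open>0, \<dots>, m - 1\<close>. The edges of \<open>T\<close> are listed in an arbitrary order, each exactly once and in
  an arbitrary orientation. A square adjacency matrix for \<open>T\<close> would be too large to be read
  in time linear in \<open>m\<close>.
\<close>

definition edge_listing :: "'b graph \<Rightarrow> ('b \<times> 'b) list \<Rightarrow> bool" where
  "edge_listing T es \<longleftrightarrow>
     distinct (map (\<lambda>(a, b). {a, b}) es) \<and> set (map (\<lambda>(a, b). {a, b}) es) = edges T"

definition mwis_instance ::
  "nat graph \<Rightarrow> (nat \<Rightarrow> rat) \<Rightarrow> nat graph \<Rightarrow> (nat \<Rightarrow> nat set) \<Rightarrow> (nat \<times> nat) list \<Rightarrow> bool" where
  "mwis_instance G w T X es \<longleftrightarrow>
     simple_graph G \<and> verts G = {..<card (verts G)} \<and>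
     (\<forall>v\<in>verts G. w v \<ge> 0) \<and>
     tree_decomposition G T X \<and> verts T = {..<card (verts T)} \<and>
     edge_listing T es"

text \<open>
  \<open>G\<close> is stored as its adjacency matrix and the bags as an incidence matrix, both row by row.
  All cells not used by the input are 0.
\<close>

definition input_state ::
  "nat graph \<Rightarrow> (nat \<Rightarrow> rat) \<Rightarrow> nat graph \<Rightarrow> (nat \<Rightarrow> nat set) \<Rightarrow> (nat \<times> nat) list \<Rightarrow> state" where
  "input_state G w T X es =
    (let n = card (verts G); m = card (verts T) in
     \<lparr>iarr = (\<lambda>x i. 0)
        (''n'' := (\<lambda>i. 0)(0 := n),
         ''m'' := (\<lambda>i. 0)(0 := m),
         ''num_edges'' := (\<lambda>i. 0)(0 := length es),
         ''adj'' := (\<lambda>i. if i < n * n \<and> {i div n, i mod n} \<in> edges G then 1 else 0),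
         ''bag'' := (\<lambda>i. if i < m * n \<and> i mod n \<in> X (i div n) then 1 else 0),
         ''src'' := (\<lambda>i. if i < length es then fst (es ! i) else 0),
         ''dst'' := (\<lambda>i. if i < length es then snd (es ! i) else 0)),
      qarr = (\<lambda>x i. 0)
        (''weight'' := (\<lambda>i. if i < n then w i else 0))\<rparr>)"

definition output_set :: "nat graph \<Rightarrow> state \<Rightarrow> nat set" where
  "output_set G s = {v \<in> verts G. iarr s ''out'' v = 1}"

end

theory Submission
  imports Defs
begin

text \<open>
  Leaves of \<open>T\<close> are eliminated one after the other.  If a leaf \<open>v\<close> is merged into its only remaining
  neighbour \<open>p\<close>, every vertex shared by the part represented by \<open>v\<close> and the rest lies in both bags
  \<open>X v\<close> and \<open>X p\<close>; hence an optimum containing a prescribed trace \<open>S\<close> on \<open>X p\<close> splits into two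
  independent optima that agree on \<open>S \<inter> X v\<close>.  Traces are independent subsets of bags, so they have
  at most \<open>k\<close> elements and are stored as \<open>k\<close>-tuples.  There are \<open>(n + 1) ^ k\<close> tuples, and a merge
  costs constant time per tuple.  Leaves are found in total time linear in \<open>|V(T)|\<close> by keeping only the degree
  and the sum of the neighbours of each node: for a leaf the sum is its neighbour.
\<close>

section \<open>Leaves of forests\<close>

text \<open>A bag may be much larger than \<open>k\<close>; only its independent subsets are small.
  Tuples replace sets because the machine has neither multiplication nor set operations: a
  \<open>k\<close>-tuple is one number below \<open>N\<close>, usable directly as an array index,
  and arithmetic with base \<open>n + 1\<close> becomes tables built by repeated addition. The price
  is that one set has many codes. Messages are therefore indexed by codes, not by traces, and
  correctness needs more than a code for every independent subset of the leaf's bag: one is needed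
  that restricts to exactly the given code of the trace. \<open>fill_code\<close> provides it, since
  \<open>k\<close> positions have room for the whole subset. Tables hold only the weight outside the
  bag of their node, so a message is corrected by the weight of the shared trace alone. The
  optimality argument works for arbitrary elimination lists and asks only for
  \<open>separated\<close> at each merge; the tree enters through \<open>edges_ok\<close>. For fixed
  \<open>k\<close>, each node costs a constant multiple of \<open>n + N\<close>, abbreviated by
  \<open>sz\<close>.\<close>

lemma cycle_if_all_degrees_ge_2:
  assumes fin: "finite W" and ne: "W \<noteq> {}"
    and deg: "\<And>t. t \<in> W \<Longrightarrow> 2 \<le> card {b\<in>W. {t, b} \<in> edges T}"
    and irr: "\<And>t. {t, t} \<notin> edges T"
  shows "\<exists>xs. cycle T xs"
proof -
  define path where "path xs \<longleftrightarrow> distinct xs \<and> set xs \<subseteq> W \<and>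
    (\<forall>i. Suc i < length xs \<longrightarrow> {xs ! i, xs ! Suc i} \<in> edges T)" for xs
  obtain t where t: "t \<in> W" using ne by blast
  have pt: "path [t]" using t by (simp add: path_def)
  have "length xs < Suc (card W)" if "path xs" for xs
    using that card_mono[OF fin, of "set xs"] distinct_card[of xs] by (simp add: path_def)
  \<comment> \<open>A longest path in \<open>W\<close>: by maximality every neighbour of its first
    vertex lies on it.\<close>
  then obtain xs where p: "path xs" and mx: "\<And>ys. path ys \<Longrightarrow> length ys \<le> length xs"
    using ex_has_greatest_nat[of path "[t]" length "Suc (card W)"] pt by blast
  have xs: "distinct xs" "set xs \<subseteq> W" "\<And>i. Suc i < length xs \<Longrightarrow> {xs ! i, xs ! Suc i} \<in> edges T"
    using p by (auto simp: path_def)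
  have "length xs \<ge> 1" using mx[OF pt] by simp
  then obtain x ys where x: "xs = x # ys" by (cases xs) auto
  let ?N = "{b\<in>W. {x, b} \<in> edges T}"
  have sub: "?N \<subseteq> set ys"
  proof
    fix z assume z: "z \<in> ?N"
    have "z \<in> set xs"
    proof (rule ccontr)
      assume "z \<notin> set xs"
      then have "path (z # xs)" using p z x unfolding path_def
        by (auto simp: nth_Cons insert_commute split: nat.splits)
      then show False using mx by fastforce
    qed
    moreover have "z \<noteq> x" using irr z by auto
    ultimately show "z \<in> set ys" using x by simp
  qed
  have two: "2 \<le> card ?N" using deg xs x by auto
  \<comment> \<open>The second path vertex is only one of at least two neighbours. Another one,
    \<open>z\<close>, closes the prefix ending in \<open>z\<close> to a cycle;
    \<open>q \<noteq> 0\<close> gives it length at least 3.\<close>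
  have "\<not> ?N \<subseteq> {ys ! 0}"
  proof
    assume "?N \<subseteq> {ys ! 0}"
    then have "card ?N \<le> 1" using card_mono[of "{ys ! 0}" ?N] by simp
    then show False using two by simp
  qed
  then obtain z where z: "z \<in> ?N" "z \<noteq> ys ! 0" by blast
  then obtain q where q: "q < length ys" "ys ! q = z" using sub by (metis in_set_conv_nth subsetD)
  with z have "q \<noteq> 0" by metis
  let ?c = "take (Suc (Suc q)) xs"
  have len: "length ?c = Suc (Suc q)" using q x by simp
  have "cycle T ?c" unfolding cycle_def
  proof (intro conjI allI impI)
    show "3 \<le> length ?c" using len \<open>q \<noteq> 0\<close> by simp
    show "distinct ?c" using xs by simp
    fix i assume i: "i < length ?c"
    show "{?c ! i, ?c ! (Suc i mod length ?c)} \<in> edges T"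
    proof (cases "Suc i < length ?c")
      case True
      then show ?thesis using xs by auto
    next
      case False
      then have "i = Suc q" using i len by linarith
      then show ?thesis using len z q x by (simp add: insert_commute)
    qed
  qed
  then show ?thesis by blast
qed

lemma no_singleton_edge: "simple_graph T \<Longrightarrow> {t, t} \<notin> edges T"
  by (auto simp: simple_graph_def)

text \<open>Isolated vertices are discarded first; on the rest, degree different from 1 means degree
  at least 2, which forces a cycle.\<close>

lemma no_edge_if_no_leaf:
  assumes T: "simple_graph T" "\<nexists>xs. cycle T xs" and W: "finite W"
    and deg: "\<And>t. t \<in> W \<Longrightarrow> card {b\<in>W. {t, b} \<in> edges T} \<noteq> 1"
    and "a \<in> W" "b \<in> W"
  shows "{a, b} \<notin> edges T"
proof
  assume ab: "{a, b} \<in> edges T"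
  let ?W = "{t\<in>W. \<exists>b\<in>W. {t, b} \<in> edges T}"
  have "2 \<le> card {b\<in>?W. {t, b} \<in> edges T}" if "t \<in> ?W" for t
  proof -
    have eq: "{b\<in>?W. {t, b} \<in> edges T} = {b\<in>W. {t, b} \<in> edges T}"
      using that by (auto simp: insert_commute)
    have "card {b\<in>W. {t, b} \<in> edges T} \<noteq> 0" using that W by auto
    moreover have "card {b\<in>W. {t, b} \<in> edges T} \<noteq> 1" using deg that by blast
    ultimately show ?thesis unfolding eq by linarith
  qed
  moreover have "finite ?W" "?W \<noteq> {}" using W assms(5,6) ab by auto
  ultimately show False
    using cycle_if_all_degrees_ge_2[of ?W T] no_singleton_edge[OF T(1)] T(2) by blast
qed

text \<open>Deleting a leaf removes one edge, and without a leaf there is no edge at all. The bound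
  serves to read the edge list in time linear in \<open>m\<close>.\<close>

lemma card_edges_within_le:
  assumes T: "simple_graph T" "\<nexists>xs. cycle T xs" and W: "finite W"
  shows "card {e\<in>edges T. e \<subseteq> W} \<le> card W"
  using W
proof (induction "card W" arbitrary: W)
  case 0
  then have "{e\<in>edges T. e \<subseteq> W} = {}" using T(1) by (auto simp: simple_graph_def)
  then show ?case by (metis card.empty le0)
next
  case (Suc c)
  show ?case
  proof (cases "\<exists>t\<in>W. card {b\<in>W. {t, b} \<in> edges T} = 1")
    case False
    have "{e\<in>edges T. e \<subseteq> W} = {}"
    proof (rule ccontr)
      assume "{e\<in>edges T. e \<subseteq> W} \<noteq> {}"
      then obtain e where e: "e \<in> edges T" "e \<subseteq> W" by blast
      then have "card e = 2" using T by (auto simp: simple_graph_def)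
      then obtain a b where "e = {a, b}" by (auto simp: card_2_iff)
      then show False using no_edge_if_no_leaf[OF T Suc.prems, of a b] False e by auto
    qed
    then show ?thesis by (metis card.empty le0)
  next
    case True
    then obtain t b where t: "t \<in> W" "{b\<in>W. {t, b} \<in> edges T} = {b}"
      by (metis (no_types, lifting) card_1_singletonE mem_Collect_eq singletonI)
    have sub: "{e\<in>edges T. e \<subseteq> W} \<subseteq> insert {t, b} {e\<in>edges T. e \<subseteq> W - {t}}"
    proof
      fix e assume e: "e \<in> {e\<in>edges T. e \<subseteq> W}"
      then have "card e = 2" using T by (auto simp: simple_graph_def)
      then obtain x y where xy: "e = {x, y}" by (auto simp: card_2_iff)
      show "e \<in> insert {t, b} {e\<in>edges T. e \<subseteq> W - {t}}"
      proof (cases "t \<in> e")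
        case True
        then obtain z where "e = {t, z}" using xy by auto
        then show ?thesis using t e by auto
      qed (use e in auto)
    qed
    have "finite {e\<in>edges T. e \<subseteq> W - {t}}"
      using Suc.prems by (auto intro: finite_subset[of _ "Pow W"])
    then have "card {e\<in>edges T. e \<subseteq> W} \<le> Suc (card {e\<in>edges T. e \<subseteq> W - {t}})"
      using card_mono[OF _ sub] by (auto simp: card_insert_if split: if_splits)
    moreover have "card {e\<in>edges T. e \<subseteq> W - {t}} \<le> card (W - {t})"
      using Suc t by (intro Suc.hyps(1)) auto
    moreover have "Suc (card (W - {t})) = card W" using t Suc.prems
      by (metis card_Suc_Diff1)
    ultimately show ?thesis by linarith
  qed
qed

lemma tree_card_edges_le:
  assumes "tree T"
  shows "card (edges T) \<le> card (verts T)"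
proof -
  have "{e\<in>edges T. e \<subseteq> verts T} = edges T"
    using assms by (auto simp: tree_def simple_graph_def)
  then show ?thesis using card_edges_within_le[of T "verts T"] assms
    by (auto simp: tree_def simple_graph_def)
qed


section \<open>Dynamic programming over elimination sequences\<close>

locale bounded_td =
  fixes G :: "nat graph" and w :: "nat \<Rightarrow> rat" and T :: "nat graph" and X :: "nat \<Rightarrow> nat set"
    and es :: "(nat \<times> nat) list" and k :: nat
  assumes inst: "mwis_instance G w T X es" and td_le: "td_independence_number G T X \<le> k"
begin

definition "n = card (verts G)"
definition "m = card (verts T)"
definition "B = Suc n"
definition "N = B ^ k"
text \<open>Totalises \<open>X\<close>: indices from \<open>m\<close> on get the empty bag, in
  particular the additional node \<open>m\<close> that ends the elimination.\<close>

definition "bag t = (if t < m then X t else {})"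

abbreviation "indep \<equiv> independent_set G"

lemma simple_G: "simple_graph G" and verts_G: "verts G = {..<n}"
  and td: "tree_decomposition G T X" and tree_T: "tree T" and verts_T: "verts T = {..<m}"
  and listing: "edge_listing T es"
  using inst unfolding mwis_instance_def n_def m_def tree_decomposition_def by auto

lemma simple_T: "simple_graph T" and acyclic_T: "\<nexists>xs. cycle T xs" and connected_T: "connected_graph T"
  using tree_T by (auto simp: tree_def)

lemma m_pos: "0 < m"
  using connected_T verts_T by (cases m) (auto simp: connected_graph_def)

lemma bag_subset: "bag t \<subseteq> {..<n}"
  using td verts_T verts_G by (auto simp: bag_def tree_decomposition_def)

lemma indep_subset: "indep J \<Longrightarrow> J' \<subseteq> J \<Longrightarrow> indep J'"
  unfolding independent_set_def by blast

lemma indep_finite: "indep J \<Longrightarrow> finite J"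
  by (auto simp: independent_set_def verts_G intro: finite_subset)

lemma edges_T_less: "{a, b} \<in> edges T \<Longrightarrow> a < m \<and> b < m \<and> a \<noteq> b"
  using simple_T verts_T by (force simp: simple_graph_def)

text \<open>Any independent subset of a bag thus fits into \<open>k\<close> digits; this is where
  \<open>td_le\<close> enters.\<close>

lemma indep_bag_card:
  assumes "indep S" "S \<subseteq> bag t"
  shows "card S \<le> k"
proof (cases "t < m")
  case False
  then show ?thesis using assms by (simp add: bag_def)
next
  case True
  let ?H = "induced G (X t)"
  have "S \<subseteq> X t" using assms True by (simp add: bag_def)
  then have S: "independent_set ?H S"
    using assms by (auto simp: independent_set_def induced_def)
  have "finite {I. independent_set ?H I}"
    by (rule finite_subset[of _ "Pow {..<n}"]) (auto simp: independent_set_def induced_def verts_G)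
  then have "card S \<le> independence_number ?H"
    unfolding independence_number_def using S by (intro Max_ge) auto
  also have "\<dots> \<le> td_independence_number G T X"
    unfolding td_independence_number_def using True verts_T by (intro Max_ge) auto
  finally show ?thesis using td_le by simp
qed


subsection \<open>Codes of tuples\<close>

text \<open>A code \<open>i < N\<close> stands for the \<open>k\<close>-tuple of its base-\<open>B\<close> digits, where digit \<open>0\<close> is a blank
  and digit \<open>d + 1\<close> is the vertex \<open>d\<close>.  Blanking the vertices outside a bag keeps the positions
  of the others, so no sorting is needed to compare the traces of two tuples on a separator.\<close>

definition dset :: "nat \<Rightarrow> nat set" where "dset d = (if d = 0 then {} else {d - 1})"

function st :: "nat \<Rightarrow> nat set" where
  "st i = (if i = 0 \<or> n = 0 then {} else dset (i mod B) \<union> st (i div B))"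
  by auto
termination by (relation "measure id") (auto simp: B_def)

function wts :: "nat \<Rightarrow> rat" where
  "wts i = (if i = 0 \<or> n = 0 then 0 else wts (i div B) + (if i mod B = 0 then 0 else w (i mod B - 1)))"
  by auto
termination by (relation "measure id") (auto simp: B_def)

function rst :: "nat set \<Rightarrow> nat \<Rightarrow> nat" where
  "rst Y i = (if i = 0 \<or> n = 0 then 0 else rst Y (i div B) * B + (if dset (i mod B) \<subseteq> Y then i mod B else 0))"
  by auto
termination by (relation "measure snd") (auto simp: B_def)

function vld :: "nat \<Rightarrow> bool" where
  "vld i = (if i = 0 \<or> n = 0 then True else vld (i div B) \<and>
     (\<forall>x\<in>dset (i mod B). \<forall>y\<in>st (i div B). x \<noteq> y \<and> {x, y} \<notin> edges G))"
  by auto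
termination by (relation "measure id") (auto simp: B_def)

declare st.simps [simp del] wts.simps [simp del] rst.simps [simp del] vld.simps [simp del]

lemma code_0 [simp]: "st 0 = {}" "wts 0 = 0" "rst Y 0 = 0" "vld 0"
  by (simp_all add: st.simps wts.simps rst.simps vld.simps)

lemma B_pos: "0 < B" and N_pos: "0 < N"
  by (simp_all add: B_def N_def)

lemma mod_B_le: "i mod B \<le> n"
  using mod_less_divisor[OF B_pos, of i] by (simp add: B_def)

text \<open>For \<open>n = 0\<close> the base is 1 and division by it does not decrease, hence the
  guards in the recursive functions. This fact makes the digit recursions below hold for every
  \<open>i\<close> without guards.\<close>

lemma B_trivial: "n = 0 \<Longrightarrow> i mod B = 0 \<and> i div B = i"
  by (simp add: B_def)

lemma st_rec: "st i = dset (i mod B) \<union> st (i div B)"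
  by (cases "i = 0 \<or> n = 0") (auto simp: st.simps[of i] dset_def B_trivial)

lemma wts_rec: "wts i = wts (i div B) + (if i mod B = 0 then 0 else w (i mod B - 1))"
  by (cases "i = 0 \<or> n = 0") (auto simp: wts.simps[of i] B_trivial)

lemma rst_rec: "rst Y i = rst Y (i div B) * B + (if dset (i mod B) \<subseteq> Y then i mod B else 0)"
  by (cases "i = 0 \<or> n = 0") (auto simp: rst.simps[of Y i] B_trivial)

lemma vld_rec: "vld i \<longleftrightarrow> vld (i div B) \<and>
     (\<forall>x\<in>dset (i mod B). \<forall>y\<in>st (i div B). x \<noteq> y \<and> {x, y} \<notin> edges G)"
  by (cases "i = 0 \<or> n = 0") (auto simp: vld.simps[of i] B_trivial dset_def)

lemma vld_rec0: "i mod B = 0 \<Longrightarrow> vld i \<longleftrightarrow> vld (i div B)"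
  and vld_rec1: "i mod B = Suc d \<Longrightarrow> vld i \<longleftrightarrow> vld (i div B) \<and> d \<notin> st (i div B) \<and>
     (\<forall>y\<in>st (i div B). {d, y} \<notin> edges G)"
  by (subst vld_rec, force simp: dset_def)+

lemma st_rec0: "i mod B = 0 \<Longrightarrow> st i = st (i div B)"
  and st_rec1: "i mod B = Suc d \<Longrightarrow> st i = insert d (st (i div B))"
  by (subst st_rec, simp add: dset_def)+

lemma code_split: assumes "d < B" shows "(i * B + d) mod B = d" "(i * B + d) div B = i"
  using assms by simp_all

text \<open>Induction on digits. For \<open>n = 0\<close> the bound \<open>N\<close> is 1 and leaves
  only code 0, so in the step case the quotient is strictly smaller.\<close>

lemma code_induct [consumes 1, case_names zero step]:
  assumes "i < N" "P 0"
    and "\<And>i. 0 < i \<Longrightarrow> i < N \<Longrightarrow> i div B < i \<Longrightarrow> P (i div B) \<Longrightarrow> P i"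
  shows "P i"
  using assms(1)
proof (induction i rule: less_induct)
  case (less i)
  show ?case
  proof (cases "i = 0")
    case False
    have "n \<noteq> 0" using False less.prems by (cases "n = 0") (auto simp: N_def B_def)
    then have "i div B < i" using False by (simp add: B_def)
    then show ?thesis using assms(3) less False by simp
  qed (use assms in simp)
qed

lemma dset_subset: "dset (i mod B) \<subseteq> {..<n}"
  using mod_B_le[of i] by (auto simp: dset_def)

lemma st_subset: "i < N \<Longrightarrow> st i \<subseteq> {..<n}"
proof (induction i rule: code_induct)
  case (step i)
  then show ?case using dset_subset[of i] st_rec[of i] by simp
qed simp

lemma finite_st: "i < N \<Longrightarrow> finite (st i)"
  using st_subset finite_subset by blast

text \<open>Validity excludes repeated vertices, so no weight is added twice.\<close>

lemma wts_eq: "i < N \<Longrightarrow> vld i \<longrightarrow> wts i = sum w (st i)"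
proof (induction i rule: code_induct)
  case (step i)
  have fin: "finite (st (i div B))" using step finite_st by simp
  show ?case
  proof (cases "i mod B")
    case 0
    then show ?thesis using step.IH by (simp add: wts_rec[of i] st_rec0 vld_rec0)
  next
    case (Suc d)
    then show ?thesis using step.IH fin by (simp add: wts_rec[of i] st_rec1 vld_rec1)
  qed
qed simp

lemma indep_st: "i < N \<Longrightarrow> vld i \<longrightarrow> indep (st i)"
proof (induction i rule: code_induct)
  case zero
  then show ?case by (simp add: independent_set_def)
next
  case (step i)
  show ?case
  proof (cases "i mod B")
    case 0
    then show ?thesis using step.IH by (simp add: st_rec0 vld_rec0)
  next
    case (Suc d)
    then show ?thesis using step.IH mod_B_le[of i] no_singleton_edge[OF simple_G, of d]
      by (simp add: st_rec1 vld_rec1 independent_set_def verts_G) (metis insert_commute)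
  qed
qed

text \<open>Blanking digits never increases a number; hence restricted codes stay inside tables of
  size \<open>N\<close>.\<close>

lemma rst_le: "i < N \<Longrightarrow> rst Y i \<le> i"
proof (induction i rule: code_induct)
  case (step i)
  have "rst Y i \<le> i div B * B + i mod B"
    unfolding rst_rec[of Y i] using step.IH by (intro add_mono mult_le_mono1) auto
  then show ?case by simp
qed simp

lemma rst_less: "i < N \<Longrightarrow> rst Y i < N"
  using rst_le le_less_trans by blast

lemma rst_mod_div:
  "rst Y i mod B = (if dset (i mod B) \<subseteq> Y then i mod B else 0)" "rst Y i div B = rst Y (i div B)"
  using code_split[of "if dset (i mod B) \<subseteq> Y then i mod B else 0" "rst Y (i div B)"] B_pos
  by (simp_all add: rst_rec[of Y i])

lemma st_rst: "i < N \<Longrightarrow> st (rst Y i) = st i \<inter> Y"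
proof (induction i rule: code_induct)
  case (step i)
  moreover obtain d q where dq: "i mod B = d" "i div B = q" by blast
  ultimately show ?case
    unfolding st_rec[of i] st_rec[of "rst Y i"] rst_mod_div dq by (auto simp: dset_def)
qed simp

lemma vld_rst: "i < N \<Longrightarrow> vld i \<longrightarrow> vld (rst Y i)"
proof (induction i rule: code_induct)
  case (step i)
  have eq: "st (rst Y (i div B)) = st (i div B) \<inter> Y" using step by (intro st_rst) simp
  show ?case
  proof (cases "i mod B")
    case 0
    then have "rst Y i mod B = 0" by (simp add: rst_mod_div)
    then show ?thesis using step.IH 0 by (simp add: vld_rec0 rst_mod_div)
  next
    case (Suc d)
    then have "rst Y i mod B = (if d \<in> Y then Suc d else 0)" by (simp add: rst_mod_div dset_def)
    then show ?thesis using step.IH eq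
      by (cases "d \<in> Y") (simp_all add: vld_rec0 vld_rec1[OF Suc] vld_rec1[of "rst Y i"] rst_mod_div)
  qed
qed simp

text \<open>Turns inclusion of a tuple in a bag into a single comparison of numbers, the test made
  by \<open>max_message\<close>.\<close>

lemma rst_eq_iff: "i < N \<Longrightarrow> rst Y i = i \<longleftrightarrow> st i \<subseteq> Y"
proof (induction i rule: code_induct)
  case (step i)
  have "rst Y i = i \<longleftrightarrow> rst Y i div B = i div B \<and> rst Y i mod B = i mod B"
    by (metis div_mult_mod_eq)
  moreover obtain d q where dq: "i mod B = d" "i div B = q" by blast
  ultimately show ?case using step.IH unfolding st_rec[of i] rst_mod_div dq by (auto simp: dset_def)
qed simp

text \<open>The elements of \<open>S - Y\<close> are put into the blanks of \<open>r\<close>.\<close>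

lemma fill_code:
  assumes "r < B ^ l" "l \<le> k" "vld r" "indep S" "S \<inter> Y = st r" "card S \<le> l"
  shows "\<exists>i < B ^ l. vld i \<and> st i = S \<and> rst Y i = r"
  using assms
proof (induction l arbitrary: r S)
  case 0
  then have "S = {}" using indep_finite by auto
  then show ?case using 0 by auto
next
  case (Suc l)
  have le: "B ^ Suc l \<le> N" unfolding N_def using Suc.prems(2) B_pos by (intro power_increasing) auto
  have rN: "r < N" using Suc.prems(1) le by simp
  have finS: "finite S" using Suc.prems indep_finite by simp
  have r': "r div B < B ^ l" using Suc.prems(1) by (metis B_pos less_mult_imp_div_less mult.commute power_Suc)
  have vr: "vld (r div B)" using Suc.prems(3) vld_rec[of r] by simp
  \<comment> \<open>One digit at a time: \<open>x\<close> becomes the lowest digit and the rest of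
    \<open>S\<close> is coded by induction. Either \<open>x\<close> is the lowest digit of
    \<open>r\<close> itself, or that digit is blank and \<open>x\<close> lies outside
    \<open>Y\<close>.\<close>
  have ext: "\<exists>i < B ^ Suc l. vld i \<and> st i = S \<and> rst Y i = r"
    if x: "x \<in> S" and xd: "r mod B = (if x \<in> Y then Suc x else 0)" and sx: "(S - {x}) \<inter> Y = st (r div B)" for x
  proof -
    have xn: "Suc x < B" using x Suc.prems(4) by (auto simp: B_def independent_set_def verts_G)
    have "indep (S - {x})" using Suc.prems(4) indep_subset by blast
    moreover have "card (S - {x}) \<le> l" using x finS Suc.prems(6) by simp
    ultimately obtain i where i: "i < B ^ l" "vld i" "st i = S - {x}" "rst Y i = r div B"
      using Suc.IH[OF r' _ vr _ sx] Suc.prems(2) by auto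
    define j where "j = i * B + Suc x"
    have dm: "j mod B = Suc x" "j div B = i" using code_split[OF xn] by (auto simp: j_def)
    have "j < Suc i * B" using xn by (simp add: j_def)
    also have "\<dots> \<le> B ^ l * B" using i by (intro mult_le_mono1) simp
    finally have "j < B ^ Suc l" by (simp add: mult.commute)
    moreover have "vld j" using i Suc.prems(4) x
      by (subst vld_rec) (auto simp: dm dset_def independent_set_def)
    moreover have "st j = S" using i x by (subst st_rec) (auto simp: dm dset_def)
    moreover have "rst Y j = r"
    proof -
      have "rst Y j = r div B * B + r mod B" using i xd by (subst rst_rec) (auto simp: dm dset_def)
      then show ?thesis by simp
    qed
    ultimately show ?thesis by blast
  qed
  show ?case
  proof (cases "r mod B = 0")
    case False
    let ?x = "r mod B - 1"
    have str: "st r = insert ?x (st (r div B))" using False st_rec[of r] by (simp add: dset_def)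
    have "?x \<notin> st (r div B)" using Suc.prems(3) vld_rec[of r] False by (auto simp: dset_def)
    then have "(S - {?x}) \<inter> Y = st (r div B)" "?x \<in> S" "?x \<in> Y" using Suc.prems(5) str by auto
    then show ?thesis using ext[of ?x] False by simp
  next
    case True
    have str: "st r = st (r div B)" using True st_rec[of r] by (simp add: dset_def)
    show ?thesis
    proof (cases "S \<subseteq> Y")
      case True
      then have "st r = S" using Suc.prems(5) by auto
      then show ?thesis using Suc.prems rN rst_eq_iff[of r Y] True by auto
    next
      case False
      then obtain x where "x \<in> S" "x \<notin> Y" by blast
      then show ?thesis using ext[of x] True str Suc.prems(5) by auto
    qed
  qed
qed


subsection \<open>Elimination sequences\<close>

text \<open>A sequence lists pairs (eliminated node, node it is merged into), the latest first.  The
  nodes are \<open>0, \<dots>, m - 1\<close> and an additional node \<open>m\<close> with empty bag, into which the last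
  remaining node is merged.\<close>

definition remaining :: "(nat \<times> nat) list \<Rightarrow> nat set" where
  "remaining evs = {..m} - fst ` set evs"

primrec rep :: "(nat \<times> nat) list \<Rightarrow> nat \<Rightarrow> nat" where
  "rep [] s = s"
| "rep (e # evs) s = (if rep evs s = fst e then snd e else rep evs s)"

text \<open>\<open>rep evs s\<close> is the remaining node into which \<open>s\<close> has been merged, and \<open>U evs t\<close> is the union of
  the bags merged into \<open>t\<close>.  With \<open>tab t i\<close> the weight gained outside the bag of \<open>t\<close>, the invariant
  \<open>opt\<close> says that \<open>sol evs arg t i\<close> is an optimal independent subset of \<open>U evs t\<close> with trace \<open>st i\<close>
  on the bag of \<open>t\<close>; \<open>arg v r\<close> is the code chosen for the eliminated node \<open>v\<close> when the trace
  on the separator has code \<open>r\<close>.\<close>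

definition U :: "(nat \<times> nat) list \<Rightarrow> nat \<Rightarrow> nat set" where
  "U evs t = (\<Union>s\<in>{s. s \<le> m \<and> rep evs s = t}. bag s)"

primrec sol :: "(nat \<times> nat) list \<Rightarrow> (nat \<Rightarrow> nat \<Rightarrow> nat) \<Rightarrow> nat \<Rightarrow> nat \<Rightarrow> nat set" where
  "sol [] arg t i = st i"
| "sol (e # evs) arg t i = (if t = snd e
     then sol evs arg t i \<union> sol evs arg (fst e) (arg (fst e) (rst (bag (fst e)) i))
     else sol evs arg t i)"

definition ok :: "nat \<Rightarrow> nat \<Rightarrow> bool" where
  "ok t i \<longleftrightarrow> i < N \<and> vld i \<and> st i \<subseteq> bag t"

definition opt :: "(nat \<times> nat) list \<Rightarrow> (nat \<Rightarrow> nat \<Rightarrow> rat) \<Rightarrow> (nat \<Rightarrow> nat \<Rightarrow> nat) \<Rightarrow> bool" where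
  "opt evs tab arg \<longleftrightarrow> (\<forall>t\<in>remaining evs. \<forall>i. ok t i \<longrightarrow>
     sol evs arg t i \<subseteq> U evs t \<and> indep (sol evs arg t i) \<and> sol evs arg t i \<inter> bag t = st i \<and>
     sum w (sol evs arg t i) = tab t i + wts i \<and>
     (\<forall>J. J \<subseteq> U evs t \<longrightarrow> indep J \<longrightarrow> J \<inter> bag t = st i \<longrightarrow> sum w J \<le> tab t i + wts i))"

definition best :: "(nat \<Rightarrow> rat) \<Rightarrow> nat \<Rightarrow> nat \<Rightarrow> nat \<Rightarrow> nat \<Rightarrow> rat \<Rightarrow> bool" where
  "best row v p r i M \<longleftrightarrow> ok v i \<and> rst (bag p) i = r \<and> M = row i + wts i \<and>
     (\<forall>i'. ok v i' \<longrightarrow> rst (bag p) i' = r \<longrightarrow> row i' + wts i' \<le> M)"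

text \<open>All that a merge needs from the tree. It holds for a leaf and its neighbour, and
  trivially when \<open>U evs p\<close> is empty, as in the final merge into
  \<open>m\<close>.\<close>

definition separated :: "(nat \<times> nat) list \<Rightarrow> nat \<Rightarrow> nat \<Rightarrow> bool" where
  "separated evs v p \<longleftrightarrow> U evs p \<inter> U evs v \<subseteq> bag p \<inter> bag v \<and>
     (\<forall>e\<in>edges G. e \<subseteq> U evs p \<union> U evs v \<longrightarrow> e \<subseteq> U evs p \<or> e \<subseteq> U evs v)"

text \<open>Being a leaf is not demanded here; it enters through \<open>separated\<close> and
  \<open>edges_ok\<close>. The condition \<open>v < m\<close> keeps the additional node to the
  end.\<close>

inductive elimination :: "(nat \<times> nat) list \<Rightarrow> bool" where
  Nil: "elimination []"
| Cons: "elimination evs \<Longrightarrow> v \<in> remaining evs \<Longrightarrow> p \<in> remaining evs \<Longrightarrow> v \<noteq> p \<Longrightarrow> v < m \<Longrightarrow>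
    elimination ((v, p) # evs)"

inductive_cases elimination_ConsE: "elimination ((v, p) # evs)"

lemma remaining_Cons: "remaining ((v, p) # evs) = remaining evs - {v}"
  by (auto simp: remaining_def)

lemma rep_id: "elimination evs \<Longrightarrow> t \<in> remaining evs \<Longrightarrow> rep evs t = t"
  by (induction rule: elimination.induct) (auto simp: remaining_def)

lemma bag_subset_U: "elimination evs \<Longrightarrow> t \<in> remaining evs \<Longrightarrow> bag t \<subseteq> U evs t"
  using rep_id[of evs t] by (auto simp: U_def remaining_def)

lemma U_Cons:
  assumes "elimination ((v, p) # evs)"
  shows "U ((v, p) # evs) p = U evs p \<union> U evs v" "t \<noteq> p \<Longrightarrow> t \<noteq> v \<Longrightarrow> U ((v, p) # evs) t = U evs t"
  using assms by (auto simp: U_def)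

text \<open>\<open>sol\<close> reads \<open>arg\<close> only at eliminated nodes, so filling the row
  of the node now being eliminated leaves earlier solutions unchanged.\<close>

lemma sol_cong: "(\<And>v x. v \<in> fst ` set evs \<Longrightarrow> arg v x = arg' v x) \<Longrightarrow> sol evs arg t i = sol evs arg' t i"
  by (induction evs arbitrary: t i) auto

lemma opt_Nil: "opt [] (\<lambda>_ _. 0) arg"
  unfolding opt_def
proof (intro ballI allI impI)
  fix t i assume t: "t \<in> remaining []" and i: "ok t i"
  have U: "U [] t = bag t" using t by (auto simp: U_def remaining_def)
  have "\<And>J. J \<subseteq> bag t \<Longrightarrow> J \<inter> bag t = st i \<Longrightarrow> J = st i" by auto
  then show "sol [] arg t i \<subseteq> U [] t \<and> indep (sol [] arg t i) \<and> sol [] arg t i \<inter> bag t = st i \<and>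
     sum w (sol [] arg t i) = 0 + wts i \<and>
     (\<forall>J. J \<subseteq> U [] t \<longrightarrow> indep J \<longrightarrow> J \<inter> bag t = st i \<longrightarrow> sum w J \<le> 0 + wts i)"
    using i U indep_st[of i] wts_eq[of i] by (auto simp: ok_def)
qed

text \<open>Attained: the stored solutions for \<open>p\<close> and \<open>v\<close> overlap exactly
  in \<open>st r\<close>, so their union loses only that weight, and \<open>separated\<close>
  excludes edges between them. Optimal: a competitor \<open>K\<close> splits into its parts in
  \<open>U evs p\<close> and \<open>U evs v\<close>, which again overlap in \<open>st r\<close>, and
  each part is bounded by its own table.\<close>

lemma opt_Cons:
  assumes opt: "opt evs tab arg" and elim: "elimination ((v, p) # evs)" and sep: "separated evs v p"
    and best: "\<And>r. ok v r \<Longrightarrow> ok p r \<Longrightarrow> best (tab v) v p r (arg' v r) (M r)"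
    and arg': "\<And>u. u \<noteq> v \<Longrightarrow> arg' u = arg u"
    and tab': "\<And>j. ok p j \<Longrightarrow> tab' p j = tab p j + (M (rst (bag v) j) - wts (rst (bag v) j))"
    "\<And>t j. t \<in> remaining evs \<Longrightarrow> t \<noteq> p \<Longrightarrow> t \<noteq> v \<Longrightarrow> ok t j \<Longrightarrow> tab' t j = tab t j"
  shows "opt ((v, p) # evs) tab' arg'"
  unfolding opt_def
proof (intro ballI allI impI)
  fix t j assume t: "t \<in> remaining ((v, p) # evs)" and j: "ok t j"
  from elim have E: "elimination evs" and v: "v \<in> remaining evs" and p: "p \<in> remaining evs" and vp: "v \<noteq> p"
    by (auto elim: elimination_ConsE)
  have sol: "sol evs arg' = sol evs arg"
  proof (intro ext sol_cong)
    fix u x assume "u \<in> fst ` set evs"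
    then have "u \<noteq> v" using v by (auto simp: remaining_def)
    then show "arg' u x = arg u x" using arg' by simp
  qed
  let ?J = "sol ((v, p) # evs) arg' t j" and ?U = "U ((v, p) # evs) t"
  show "?J \<subseteq> ?U \<and> indep ?J \<and> ?J \<inter> bag t = st j \<and> sum w ?J = tab' t j + wts j \<and>
     (\<forall>J. J \<subseteq> ?U \<longrightarrow> indep J \<longrightarrow> J \<inter> bag t = st j \<longrightarrow> sum w J \<le> tab' t j + wts j)"
  proof (cases "t = p")
    case False
    have t': "t \<in> remaining evs" "t \<noteq> v" using t by (auto simp: remaining_Cons)
    then show ?thesis using opt False j tab'(2)[OF t'(1) False t'(2) j] U_Cons(2)[OF elim False t'(2)]
      unfolding opt_def by (simp add: sol)
  next
    case True
    note tp = True
    have U: "?U = U evs p \<union> U evs v" using U_Cons(1)[OF elim] True by simp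
    have bp: "bag p \<subseteq> U evs p" and bv: "bag v \<subseteq> U evs v" using bag_subset_U E p v by auto
    have UU: "U evs p \<inter> U evs v = bag p \<inter> bag v"
      using sep bp bv by (auto simp: separated_def)
    define r where "r = rst (bag v) j"
    have jp: "j < N" "vld j" "st j \<subseteq> bag p" using j True by (auto simp: ok_def)
    have str: "st r = st j \<inter> bag v" unfolding r_def using st_rst jp by simp
    have okr: "ok v r" "ok p r"
      using rst_less[OF jp(1)] vld_rst jp str unfolding ok_def r_def by auto
    define i where "i = arg' v r"
    have i: "ok v i" "rst (bag p) i = r" "M r = tab v i + wts i"
      "\<And>i'. ok v i' \<Longrightarrow> rst (bag p) i' = r \<Longrightarrow> tab v i' + wts i' \<le> M r"
      using best[OF okr] unfolding best_def i_def by auto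
    have sti: "st i \<inter> bag p = st r" using i st_rst[of i "bag p"] by (simp add: ok_def)
    have tb: "tab' t j = tab p j + (M r - wts r)" using tab'(1) j True by (simp add: r_def)
    have wr: "wts r = sum w (st r)" using wts_eq okr by (simp add: ok_def)
    let ?P = "sol evs arg p j" and ?V = "sol evs arg v i"
    have J: "?J = ?P \<union> ?V" using True by (simp add: sol r_def i_def)
    have P: "?P \<subseteq> U evs p" "indep ?P" "?P \<inter> bag p = st j" "sum w ?P = tab p j + wts j"
      "\<And>J. J \<subseteq> U evs p \<Longrightarrow> indep J \<Longrightarrow> J \<inter> bag p = st j \<Longrightarrow> sum w J \<le> tab p j + wts j"
      using opt p j True unfolding opt_def by blast+
    have V: "?V \<subseteq> U evs v" "indep ?V" "?V \<inter> bag v = st i" "sum w ?V = tab v i + wts i"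
      using opt v i(1) unfolding opt_def by blast+
    have V': "\<And>J i. ok v i \<Longrightarrow> J \<subseteq> U evs v \<Longrightarrow> indep J \<Longrightarrow> J \<inter> bag v = st i \<Longrightarrow> sum w J \<le> tab v i + wts i"
      using opt v unfolding opt_def by blast
    have Vp: "?V \<inter> U evs p = st r" using V UU sti str jp bp bv by blast
    have Pv: "?P \<inter> U evs v = st r" using P UU str bp bv by blast
    have PV: "?P \<inter> ?V = st r" using Vp Pv P V by blast
    have 1: "?J \<subseteq> ?U" using J U P V by auto
    have 2: "indep ?J" unfolding independent_set_def
    proof (intro conjI ballI)
      show "?J \<subseteq> verts G" using P V J by (auto simp: independent_set_def)
      fix x y assume xy: "x \<in> ?J" "y \<in> ?J"
      show "{x, y} \<notin> edges G"
      proof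
        assume e: "{x, y} \<in> edges G"
        have "{x, y} \<subseteq> U evs p \<union> U evs v" using xy 1 U by auto
        then have "{x, y} \<subseteq> U evs p \<or> {x, y} \<subseteq> U evs v" using e sep by (auto simp: separated_def)
        then have "{x, y} \<subseteq> ?P \<or> {x, y} \<subseteq> ?V" using xy J Vp Pv PV by blast
        then show False using e P(2) V(2) by (auto simp: independent_set_def)
      qed
    qed
    have 3: "?J \<inter> bag t = st j" using J P(3) Vp bp str True by blast
    have 4: "sum w ?J = tab' t j + wts j"
    proof -
      have "sum w (?P \<union> ?V) + sum w (st r) = sum w ?P + sum w ?V"
        using sum.union_inter[of ?P ?V w] P(2) V(2) indep_finite by (simp add: PV)
      then show ?thesis unfolding J tb P(4) V(4) i(3) wr by simp
    qed
    have "sum w K \<le> tab' t j + wts j" if K: "K \<subseteq> ?U" "indep K" "K \<inter> bag t = st j" for K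
    proof -
      let ?Kp = "K \<inter> U evs p" and ?Kv = "K \<inter> U evs v"
      have ind: "indep ?Kp" "indep ?Kv" "indep (K \<inter> bag v)" using K(2) indep_subset by blast+
      have "?Kp \<inter> bag p = st j" using K bp tp by blast
      then have kp: "sum w ?Kp \<le> tab p j + wts j" using P(5) ind by blast
      \<comment> \<open>The part of \<open>K\<close> in \<open>bag v\<close> must compete for the
        very entry \<open>r\<close>, not for another code of the same trace;
        \<open>fill_code\<close> finds a code of it that restricts to \<open>r\<close>.\<close>
      have "(K \<inter> bag v) \<inter> bag p = st r" using K str tp by blast
      then obtain i' where i': "i' < N" "vld i'" "st i' = K \<inter> bag v" "rst (bag p) i' = r"
        using fill_code[of r k "K \<inter> bag v" "bag p"] ind indep_bag_card[of "K \<inter> bag v" v] okr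
        unfolding N_def ok_def by auto
      then have ok': "ok v i'" by (auto simp: ok_def)
      have "?Kv \<inter> bag v = st i'" using i' bv by blast
      then have kv: "sum w ?Kv \<le> M r" using V'[OF ok', of ?Kv] ind i(4)[OF ok' i'(4)] by fastforce
      have "?Kp \<union> ?Kv = K" using K U by blast
      moreover have "?Kp \<inter> ?Kv = st r" using UU K str tp by blast
      ultimately have "sum w K + sum w (st r) = sum w ?Kp + sum w ?Kv"
        using sum.union_inter[of ?Kp ?Kv w] ind indep_finite by simp
      then show ?thesis using kp kv by (simp add: tb wr)
    qed
    then show ?thesis using 1 2 3 4 by blast
  qed
qed

section \<open>Tree structure: separation at leaves and the last remaining node\<close>

lemma rtrancl_crossing:
  assumes "(a, b) \<in> r\<^sup>*" "P a" "\<not> P b"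
  shows "\<exists>x y. (x, y) \<in> r \<and> P x \<and> \<not> P y"
  using assms by (induction rule: rtrancl_induct) auto

definition nbs :: "(nat \<times> nat) list \<Rightarrow> nat \<Rightarrow> nat set" where
  "nbs evs t = {b \<in> remaining evs. {t, b} \<in> edges T}"

text \<open>Merging creates no new adjacencies: the contracted tree is the subgraph of
  \<open>T\<close> induced on the remaining nodes.\<close>

definition edges_ok :: "(nat \<times> nat) list \<Rightarrow> bool" where
  "edges_ok evs \<longleftrightarrow> (\<forall>a b. {a, b} \<in> edges T \<longrightarrow>
     rep evs a = rep evs b \<or> a \<in> remaining evs \<and> b \<in> remaining evs)"

lemma edges_ok_Nil: "edges_ok []"
  using edges_T_less by (auto simp: edges_ok_def remaining_def intro: less_imp_le)

lemma edges_ok_Cons: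
  assumes "elimination ((v, p) # evs)" "edges_ok evs" "nbs evs v = {p}"
  shows "edges_ok ((v, p) # evs)"
  unfolding edges_ok_def
proof (intro allI impI)
  fix a b assume ab: "{a, b} \<in> edges T"
  have E: "elimination evs" "v \<in> remaining evs" "p \<in> remaining evs" "v \<noteq> p"
    using assms(1) by (auto elim: elimination_ConsE)
  note ids = rep_id[OF E(1)]
  consider "rep evs a = rep evs b" | "a \<in> remaining evs" "b \<in> remaining evs"
    using ab assms(2) unfolding edges_ok_def by blast
  then show "rep ((v, p) # evs) a = rep ((v, p) # evs) b \<or>
    a \<in> remaining ((v, p) # evs) \<and> b \<in> remaining ((v, p) # evs)"
  proof cases
    case 2
    have "a = v \<Longrightarrow> b = p" "b = v \<Longrightarrow> a = p"
      using ab 2 assms(3) by (auto simp: nbs_def insert_commute)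
    then show ?thesis using 2 ids E by (auto simp: remaining_Cons)
  qed simp
qed

text \<open>The nodes whose bags contain \<open>x\<close> are connected, so some tree edge among
  them leaves the class of \<open>v\<close>. By \<open>edges_ok\<close> its ends are remaining
  nodes, hence \<open>v\<close> and its only neighbour \<open>p\<close>.\<close>

lemma crossing_bag:
  assumes E: "elimination evs" "edges_ok evs" and v: "nbs evs v = {p}"
    and x: "x \<in> bag s" "x \<in> bag s'" and s: "rep evs s = v" "rep evs s' \<noteq> v"
  shows "x \<in> bag v" "x \<in> bag p"
proof -
  have sm: "s < m" "s' < m" using x by (auto simp: bag_def split: if_splits)
  have xn: "x < n" using x bag_subset by blast
  let ?H = "induced T {t \<in> verts T. x \<in> X t}"
  have "connected_graph ?H" using td xn verts_G by (auto simp: tree_decomposition_def)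
  moreover have "s \<in> verts ?H" "s' \<in> verts ?H"
    using sm x by (auto simp: induced_def verts_T bag_def)
  ultimately have "(s, s') \<in> (adj_rel ?H)\<^sup>*" by (auto simp: connected_graph_def)
  from rtrancl_crossing[OF this, of "\<lambda>t. rep evs t = v"] s
  obtain a b where ab: "(a, b) \<in> adj_rel ?H" "rep evs a = v" "rep evs b \<noteq> v" by auto
  then have e: "{a, b} \<in> edges T" "x \<in> X a" "x \<in> X b" by (auto simp: adj_rel_def induced_def)
  then have r: "a \<in> remaining evs" "b \<in> remaining evs" using E(2) ab unfolding edges_ok_def by metis+
  then have "a = v" using rep_id[OF E(1)] ab by auto
  moreover from this have "b = p" using v e r by (auto simp: nbs_def)
  ultimately show "x \<in> bag v" "x \<in> bag p" using e edges_T_less[OF e(1)] by (auto simp: bag_def)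
qed

text \<open>An edge of \<open>G\<close> lies in one bag. If that bag was merged into
  \<open>v\<close>, the edge lies in \<open>U evs v\<close>; otherwise an end outside
  \<open>U evs p\<close> would occur on both sides of the cut and hence in \<open>bag p\<close>,
  which is part of \<open>U evs p\<close>.\<close>

lemma separated_leaf:
  assumes E: "elimination evs" "edges_ok evs" and v: "nbs evs v = {p}" "v \<noteq> p"
  shows "separated evs v p"
  unfolding separated_def
proof (intro conjI ballI impI)
  show "U evs p \<inter> U evs v \<subseteq> bag p \<inter> bag v"
  proof
    fix x assume "x \<in> U evs p \<inter> U evs v"
    then obtain s s' where "x \<in> bag s" "x \<in> bag s'" "rep evs s = v" "rep evs s' = p"
      by (auto simp: U_def)
    then show "x \<in> bag p \<inter> bag v" using crossing_bag[OF E v(1), of x s s'] v(2) by auto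
  qed
next
  fix e assume e: "e \<in> edges G" "e \<subseteq> U evs p \<union> U evs v"
  obtain s where s: "s < m" "e \<subseteq> bag s"
    using td e(1) verts_T by (auto simp: tree_decomposition_def bag_def)
  show "e \<subseteq> U evs p \<or> e \<subseteq> U evs v"
  proof (cases "rep evs s = v")
    case True
    then show ?thesis using s by (auto simp: U_def intro: less_imp_le)
  next
    case False
    have "x \<in> U evs p" if "x \<in> e" for x
    proof (rule ccontr)
      assume x: "x \<notin> U evs p"
      then have "x \<in> U evs v" using e that by auto
      then obtain s' where "x \<in> bag s'" "rep evs s' = v" by (auto simp: U_def)
      then have "x \<in> bag p" using crossing_bag[OF E v(1), of x s' s] s False that by auto
      moreover have "p \<in> remaining evs" using v(1) by (auto simp: nbs_def)
      ultimately show False using x bag_subset_U[OF E(1)] by blast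
    qed
    then show ?thesis by blast
  qed
qed

lemma rep_less: "elimination evs \<Longrightarrow> m \<notin> snd ` set evs \<Longrightarrow> s < m \<Longrightarrow> rep evs s < m"
proof (induction rule: elimination.induct)
  case (Cons evs v p)
  then have "p < m" by (auto simp: remaining_def)
  then show ?case using Cons by auto
qed simp

text \<open>Without leaves the remaining nodes span no edge, so by \<open>edges_ok\<close> every
  tree edge stays inside a class; connectedness of \<open>T\<close> leaves one class, that of
  \<open>r\<close>.\<close>

lemma remaining_final:
  assumes E: "elimination evs" "edges_ok evs" "m \<notin> snd ` set evs"
    and leaf: "\<And>t. t < m \<Longrightarrow> t \<in> remaining evs \<Longrightarrow> card (nbs evs t) \<noteq> 1"
    and r: "r \<in> remaining evs" "r < m"
  shows "remaining evs = {r, m}" "s < m \<Longrightarrow> rep evs s = r"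
proof -
  have nbs: "{b \<in> remaining evs \<inter> {..<m}. {t, b} \<in> edges T} = nbs evs t" for t
    using edges_T_less by (auto simp: nbs_def)
  have "{a, b} \<notin> edges T" if "a \<in> remaining evs" "b \<in> remaining evs" for a b
  proof
    assume "{a, b} \<in> edges T"
    moreover from edges_T_less[OF this] have "a < m" "b < m" by auto
    ultimately show False
      using no_edge_if_no_leaf[OF simple_T acyclic_T, of "remaining evs \<inter> {..<m}" a b, unfolded nbs] leaf that
      by auto
  qed
  then have eq: "rep evs a = rep evs b" if "{a, b} \<in> edges T" for a b
    using E(2) that unfolding edges_ok_def by blast
  have rep: "rep evs s = r" if "s < m" for s
  proof (rule ccontr)
    assume ns: "rep evs s \<noteq> r"
    have "(r, s) \<in> (adj_rel T)\<^sup>*" using connected_T verts_T that r by (auto simp: connected_graph_def)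
    from rtrancl_crossing[OF this, of "\<lambda>t. rep evs t = r"] ns rep_id[OF E(1) r(1)]
    show False using eq by (auto simp: adj_rel_def)
  qed
  then show "s < m \<Longrightarrow> rep evs s = r" .
  have "m \<in> remaining evs" using E(1)
    by (induction rule: elimination.induct) (auto simp: remaining_def)
  moreover have "t \<in> {r, m}" if "t \<in> remaining evs" for t
  proof (cases "t < m")
    case True
    then show ?thesis using rep[OF True] rep_id[OF E(1) that] by simp
  next
    case False
    then show ?thesis using that by (simp add: remaining_def)
  qed
  ultimately show "remaining evs = {r, m}" using r by blast
qed

text \<open>Only its own empty bag has gone into \<open>m\<close>, so one of the two sides is
  empty.\<close>

lemma separated_final:
  assumes "elimination evs" "m \<notin> snd ` set evs"
  shows "separated evs v m"
proof -
  have "U evs m = {}" using rep_less[OF assms] by (force simp: U_def bag_def)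
  then show ?thesis by (simp add: separated_def)
qed

text \<open>Every set has empty trace on the empty bag of \<open>m\<close>, so the constrained
  optimum for code 0 is a global one.\<close>

lemma opt_final:
  assumes opt: "opt ((r, m) # evs) tab arg" and E: "elimination ((r, m) # evs)"
    and rep: "\<And>s. s < m \<Longrightarrow> rep evs s = r"
  shows "max_weight_independent_set G w (sol ((r, m) # evs) arg m 0)"
proof -
  have U: "U ((r, m) # evs) m = {..<n}"
  proof
    show "U ((r, m) # evs) m \<subseteq> {..<n}" using bag_subset by (auto simp: U_def)
    show "{..<n} \<subseteq> U ((r, m) # evs) m"
    proof
      fix x assume "x \<in> {..<n}"
      then obtain t where "t < m" "x \<in> X t" using td verts_G verts_T
        unfolding tree_decomposition_def by blast
      then show "x \<in> U ((r, m) # evs) m" using rep[of t] by (auto simp: U_def bag_def intro!: exI[of _ t])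
    qed
  qed
  have "m \<in> remaining ((r, m) # evs)" using E by (auto elim!: elimination_ConsE simp: remaining_Cons)
  moreover have "ok m 0" using N_pos by (simp add: ok_def)
  moreover have "bag m = {}" by (simp add: bag_def)
  ultimately have "indep (sol ((r, m) # evs) arg m 0) \<and>
    sum w (sol ((r, m) # evs) arg m 0) = tab m 0 + wts 0 \<and>
    (\<forall>J. J \<subseteq> {..<n} \<longrightarrow> indep J \<longrightarrow> J \<inter> {} = st 0 \<longrightarrow> sum w J \<le> tab m 0 + wts 0)"
    using opt unfolding opt_def by (metis U)
  moreover have "J \<subseteq> {..<n}" if "indep J" for J using that by (simp add: independent_set_def verts_G)
  ultimately show ?thesis unfolding max_weight_independent_set_def by simp
qed

text \<open>Undoing the latest elimination gives \<open>v\<close> the code that \<open>sol\<close>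
  would use for it, so the represented set does not change. Repeated down to the empty list, where
  \<open>sol\<close> is \<open>st\<close>, this makes all chosen codes explicit.\<close>

lemma traceback_step:
  assumes E: "elimination ((v, p) # evs)" and a': "a' = a(v := arg v (rst (bag v) (a p)))"
  shows "(\<Union>t\<in>remaining evs. sol evs arg t (a' t)) =
    (\<Union>t\<in>remaining ((v, p) # evs). sol ((v, p) # evs) arg t (a t))"
proof -
  have v: "v \<in> remaining evs" "p \<in> remaining evs" "v \<noteq> p" using E by (auto elim: elimination_ConsE)
  let ?R = "remaining evs - {v, p}"
  have 1: "remaining evs = insert v (insert p ?R)" using v by auto
  have 2: "remaining ((v, p) # evs) = insert p ?R" using v by (auto simp: remaining_Cons)
  show ?thesis using v(3) unfolding 2 a' by (subst 1) auto
qed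

end


section \<open>Timed weakest preconditions\<close>

text \<open>Total correctness with an upper bound on the running time; a bound instead of the exact
  time allows costs to be rounded up.\<close>

definition wp :: "com \<Rightarrow> nat \<Rightarrow> (state \<Rightarrow> bool) \<Rightarrow> state \<Rightarrow> bool" where
  "wp c t Q s \<longleftrightarrow> (\<exists>t' s'. exec c s t' s' \<and> t' \<le> t \<and> Q s')"

lemma wp_mono: "wp c t Q s \<Longrightarrow> t \<le> t' \<Longrightarrow> (\<And>s'. Q s' \<Longrightarrow> Q' s') \<Longrightarrow> wp c t' Q' s"
  unfolding wp_def using le_trans by blast

lemma wp_Seq: "wp c t (wp d t' Q) s \<Longrightarrow> wp (Seq c d) (t + t') Q s"
  unfolding wp_def by (meson add_mono exec.Seq)

lemma wp_Cond:
  assumes "bval b s \<Longrightarrow> wp c t Q s" "\<not> bval b s \<Longrightarrow> wp d t Q s"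
  shows "wp (Cond b c d) (1 + bcost b + t) Q s"
proof (cases "bval b s")
  case True
  with assms(1) obtain t' s' where "exec c s t' s'" "t' \<le> t" "Q s'" by (auto simp: wp_def)
  then show ?thesis using exec.CondTrue[OF True, of c t' s' d]
    unfolding wp_def by (intro exI[of _ "1 + bcost b + t'"] exI[of _ s']) auto
next
  case False
  with assms(2) obtain t' s' where "exec d s t' s'" "t' \<le> t" "Q s'" by (auto simp: wp_def)
  then show ?thesis using exec.CondFalse[OF False, of d t' s' c]
    unfolding wp_def by (intro exI[of _ "1 + bcost b + t'"] exI[of _ s']) auto
qed

primrec iw :: "com \<Rightarrow> vname set" where
  "iw Skip = {}"
| "iw (IAssign x i a) = {x}"
| "iw (QAssign x i a) = {}"
| "iw (Seq c d) = iw c \<union> iw d"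
| "iw (Cond b c d) = iw c \<union> iw d"
| "iw (While b c) = iw c"

primrec qw :: "com \<Rightarrow> vname set" where
  "qw Skip = {}"
| "qw (IAssign x i a) = {}"
| "qw (QAssign x i a) = {x}"
| "qw (Seq c d) = qw c \<union> qw d"
| "qw (Cond b c d) = qw c \<union> qw d"
| "qw (While b c) = qw c"

definition same :: "vname set \<Rightarrow> vname set \<Rightarrow> state \<Rightarrow> state \<Rightarrow> bool" where
  "same A Q s s' \<longleftrightarrow> (\<forall>x. x \<notin> A \<longrightarrow> iarr s' x = iarr s x) \<and> (\<forall>x. x \<notin> Q \<longrightarrow> qarr s' x = qarr s x)"

lemma sameD:
  "same A Q s s' \<Longrightarrow> x \<notin> A \<Longrightarrow> iarr s' x = iarr s x"
  "same A Q s s' \<Longrightarrow> x \<notin> Q \<Longrightarrow> qarr s' x = qarr s x"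
  by (simp_all add: same_def)

lemma upd_simps [simp]:
  "iarr (iupd x i a s) y = (if y = x then (iarr s x)(i := a) else iarr s y)"
  "qarr (iupd x i a s) = qarr s"
  "qarr (qupd x i b s) y = (if y = x then (qarr s x)(i := b) else qarr s y)"
  "iarr (qupd x i b s) = iarr s"
  by (simp_all add: iupd_def qupd_def)

lemma exec_same: "exec c s t s' \<Longrightarrow> same (iw c) (qw c) s s'"
  by (induction rule: exec.induct) (auto simp: same_def)

text \<open>Arrays that a program does not assign are unchanged, so specifications and invariants
  need to mention only what a fragment produces.\<close>

lemma wp_frame: "wp c t Q s \<Longrightarrow> wp c t (\<lambda>s'. Q s' \<and> same (iw c) (qw c) s s') s"
  unfolding wp_def using exec_same by blast

lemma wp_Seq_frame:
  assumes "wp c t Q s" and "\<And>s'. Q s' \<Longrightarrow> same (iw c) (qw c) s s' \<Longrightarrow> wp d t' Q' s'"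
  shows "wp (Seq c d) (t + t') Q' s"
  using assms by (intro wp_Seq) (auto intro: wp_mono[OF wp_frame])

primrec loopfree :: "com \<Rightarrow> bool" where
  "loopfree Skip \<longleftrightarrow> True"
| "loopfree (IAssign x i a) \<longleftrightarrow> True"
| "loopfree (QAssign x i a) \<longleftrightarrow> True"
| "loopfree (Seq c d) \<longleftrightarrow> loopfree c \<and> loopfree d"
| "loopfree (Cond b c d) \<longleftrightarrow> loopfree c \<and> loopfree d"
| "loopfree (While b c) \<longleftrightarrow> False"

primrec sem :: "com \<Rightarrow> state \<Rightarrow> state" where
  "sem Skip s = s"
| "sem (IAssign x i a) s = iupd x (ival i s) (ival a s) s"
| "sem (QAssign x i a) s = qupd x (ival i s) (qval a s) s"
| "sem (Seq c d) s = sem d (sem c s)"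
| "sem (Cond b c d) s = (if bval b s then sem c s else sem d s)"
| "sem (While b c) s = s"

text \<open>Adding both branches of a conditional overestimates by a constant, but keeps costs plain
  sums without maxima.\<close>

primrec cost :: "com \<Rightarrow> nat" where
  "cost Skip = 1"
| "cost (IAssign x i a) = 1 + icost i + icost a"
| "cost (QAssign x i a) = 1 + icost i + qcost a"
| "cost (Seq c d) = cost c + cost d"
| "cost (Cond b c d) = 1 + bcost b + (cost c + cost d)"
| "cost (While b c) = 0"

lemma wp_loopfree: "loopfree c \<Longrightarrow> Q (sem c s) \<Longrightarrow> wp c (cost c) Q s"
proof (induction c arbitrary: s Q)
  case (Seq c d)
  then show ?case by (auto intro!: wp_Seq)
next
  case (Cond b c d)
  have "wp (Cond b c d) (1 + bcost b + (cost c + cost d)) Q s"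
  proof (rule wp_Cond)
    assume "bval b s"
    then have "wp c (cost c) Q s" using Cond by simp
    then show "wp c (cost c + cost d) Q s" by (rule wp_mono) simp_all
  next
    assume "\<not> bval b s"
    then have "wp d (cost d) Q s" using Cond by simp
    then show "wp d (cost c + cost d) Q s" by (rule wp_mono) simp_all
  qed
  then show ?case by simp
next
  case Skip
  then show ?case unfolding wp_def using exec.Skip[of s] by auto
next
  case (IAssign x i a)
  then show ?case unfolding wp_def using exec.IAssign[of x i a s] by auto
next
  case (QAssign x i a)
  then show ?case unfolding wp_def using exec.QAssign[of x i a s] by auto
qed simp

lemma wp_While:
  assumes "I s"
    and "\<And>s. I s \<Longrightarrow> bval b s \<Longrightarrow> wp c t (\<lambda>s'. I s' \<and> f s' < f s) s"
    and "\<And>s. I s \<Longrightarrow> \<not> bval b s \<Longrightarrow> Q s"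
  shows "wp (While b c) (1 + bcost b + f s * (1 + bcost b + t)) Q s"
  using assms(1)
proof (induction "f s" arbitrary: s rule: less_induct)
  case less
  show ?case
  proof (cases "bval b s")
    case False
    then show ?thesis unfolding wp_def
      using exec.WhileFalse[OF False, of c] assms(3)[OF less.prems False] by fastforce
  next
    case True
    obtain t1 s1 where 1: "exec c s t1 s1" "t1 \<le> t" "I s1" "f s1 < f s"
      using assms(2)[OF less.prems True] by (auto simp: wp_def)
    obtain t2 s2 where 2: "exec (While b c) s1 t2 s2" "t2 \<le> 1 + bcost b + f s1 * (1 + bcost b + t)" "Q s2"
      using less.hyps[OF 1(4) 1(3)] by (auto simp: wp_def)
    have "Suc (f s1) * (1 + bcost b + t) \<le> f s * (1 + bcost b + t)"
      using 1(4) by (intro mult_le_mono1) simp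
    then have "1 + bcost b + t1 + t2 \<le> 1 + bcost b + f s * (1 + bcost b + t)"
      using 1(2) 2(2) by simp
    then show ?thesis unfolding wp_def
      using exec.WhileTrue[OF True 1(1) 2(1)] 2(3) by blast
  qed
qed

abbreviation Var :: "vname \<Rightarrow> iexp" where "Var x \<equiv> IGet x (IConst 0)"
abbreviation Assign :: "vname \<Rightarrow> iexp \<Rightarrow> com" where "Assign x e \<equiv> IAssign x (IConst 0) e"
abbreviation Inc :: "iexp \<Rightarrow> iexp" where "Inc e \<equiv> IPlus e (IConst 1)"
abbreviation Pos :: "iexp \<Rightarrow> bexp" where "Pos e \<equiv> ILess (IConst 0) e"
abbreviation BOr :: "bexp \<Rightarrow> bexp \<Rightarrow> bexp" where "BOr a b \<equiv> BNot (BAnd (BNot a) (BNot b))"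
abbreviation IEq :: "iexp \<Rightarrow> iexp \<Rightarrow> bexp" where
  "IEq a b \<equiv> BAnd (BNot (ILess a b)) (BNot (ILess b a))"

definition For :: "vname \<Rightarrow> iexp \<Rightarrow> com \<Rightarrow> com" where
  "For x hi c = Seq (Assign x (IConst 0)) (While (ILess (Var x) hi) (Seq c (Assign x (Inc (Var x)))))"

lemma iw_For [simp]: "iw (For x hi c) = insert x (iw c)"
  and qw_For [simp]: "qw (For x hi c) = qw c"
  by (auto simp: For_def)

text \<open>Origin of the numbers: a limit \<open>hi\<close> of cost at most 5 (that of
  \<open>n + m\<close>, the dearest one used) makes a loop test cost at most 9; the increment costs
  6, so each round adds 15 to \<open>t\<close>. The initial assignment, 3, and the last test, 9,
  give 12.\<close>

lemma wp_For:
  assumes x: "x \<notin> iw c" and hi: "icost hi \<le> 5"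
    and bound: "\<And>s'. same (insert x (iw c)) (qw c) s s' \<Longrightarrow> ival hi s' = l"
    and init: "I 0 (iupd x 0 0 s)"
    and step: "\<And>i s'. i < l \<Longrightarrow> same (insert x (iw c)) (qw c) s s' \<Longrightarrow> iarr s' x 0 = i \<Longrightarrow> I i s' \<Longrightarrow>
      wp c t (\<lambda>s''. I (Suc i) (iupd x 0 (Suc i) s'')) s'"
    and post: "\<And>s'. same (insert x (iw c)) (qw c) s s' \<Longrightarrow> I l s' \<Longrightarrow> Q s'"
  shows "wp (For x hi c) (12 + l * (t + 15)) Q s"
proof -
  let ?same = "same (insert x (iw c)) (qw c) s"
  let ?b = "ILess (Var x) hi" and ?c = "Seq c (Assign x (Inc (Var x)))"
  let ?J = "\<lambda>s'. ?same s' \<and> iarr s' x 0 \<le> l \<and> I (iarr s' x 0) s'"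
  let ?f = "\<lambda>s'. l - iarr s' x 0"
  have "wp (While ?b ?c) (1 + bcost ?b + ?f (iupd x 0 0 s) * (1 + bcost ?b + (t + 6))) Q (iupd x 0 0 s)"
  proof (rule wp_While[where I = ?J])
    show "?J (iupd x 0 0 s)" using init by (auto simp: same_def)
  next
    fix s' assume J: "?J s'" and "bval ?b s'"
    then have lt: "iarr s' x 0 < l" using bound by simp
    show "wp ?c (t + 6) (\<lambda>s''. ?J s'' \<and> ?f s'' < ?f s') s'"
    proof (rule wp_Seq_frame)
      show "wp c t (\<lambda>s''. I (Suc (iarr s' x 0)) (iupd x 0 (Suc (iarr s' x 0)) s'')) s'"
        using step[OF lt] J by blast
      fix s'' assume I: "I (Suc (iarr s' x 0)) (iupd x 0 (Suc (iarr s' x 0)) s'')"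
        and same: "same (iw c) (qw c) s' s''"
      have eq: "iarr s'' x = iarr s' x" using same x by (simp add: same_def)
      have "wp (Assign x (Inc (Var x))) (cost (Assign x (Inc (Var x))))
        (\<lambda>s''. ?J s'' \<and> ?f s'' < ?f s') s''"
        using I J same lt by (intro wp_loopfree) (auto simp: eq same_def)
      then show "wp (Assign x (Inc (Var x))) 6 (\<lambda>s''. ?J s'' \<and> ?f s'' < ?f s') s''"
        by (rule wp_mono) simp_all
    qed
  next
    fix s' assume J: "?J s'" and "\<not> bval ?b s'"
    then have "iarr s' x 0 = l" using bound by simp
    then show "Q s'" using J post by auto
  qed
  then have W: "wp (While ?b ?c) (9 + l * (t + 15)) Q (iupd x 0 0 s)"
  proof (rule wp_mono)
    have "l * (1 + bcost ?b + (t + 6)) \<le> l * (t + 15)"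
      using hi by (intro mult_le_mono2) simp
    moreover have "1 + bcost ?b \<le> 9" using hi by simp
    moreover have "?f (iupd x 0 0 s) = l" by simp
    ultimately show "1 + bcost ?b + ?f (iupd x 0 0 s) * (1 + bcost ?b + (t + 6)) \<le> 9 + l * (t + 15)"
      by (metis add_mono)
  qed
  have "wp (Assign x (IConst 0)) (cost (Assign x (IConst 0))) (wp (While ?b ?c) (9 + l * (t + 15)) Q) s"
    using W by (intro wp_loopfree) auto
  then have "wp (For x hi c) (cost (Assign x (IConst 0)) + (9 + l * (t + 15))) Q s"
    unfolding For_def by (rule wp_Seq)
  then show ?thesis by (rule wp_mono) simp_all
qed

lemma wp_For_loopfree:
  assumes "loopfree c" "x \<notin> iw c" "icost hi \<le> 5"
    and "\<And>s'. same (insert x (iw c)) (qw c) s s' \<Longrightarrow> ival hi s' = l"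
    and "I 0 (iupd x 0 0 s)"
    and "\<And>i s'. i < l \<Longrightarrow> same (insert x (iw c)) (qw c) s s' \<Longrightarrow> iarr s' x 0 = i \<Longrightarrow> I i s' \<Longrightarrow>
      I (Suc i) (iupd x 0 (Suc i) (sem c s'))"
    and "\<And>s'. same (insert x (iw c)) (qw c) s s' \<Longrightarrow> I l s' \<Longrightarrow> Q s'"
  shows "wp (For x hi c) (12 + l * (cost c + 15)) Q s"
  using assms by (intro wp_For[where I = I]) (auto intro!: wp_loopfree)


section \<open>Merging a leaf into its neighbour\<close>

text \<open>
  Natural number arrays: \<open>B\<close>, \<open>N\<close> hold \<open>n + 1\<close> and the number of codes; \<open>M\<close>, \<open>D\<close>, \<open>R\<close> tabulate
  multiplication, division and remainder by \<open>n + 1\<close>; \<open>W\<close> and \<open>O\<close> the multiples of \<open>n\<close> and of the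
  number of codes (row offsets); \<open>I\<close> flags codes of tuples that repeat a vertex or are not
  independent; \<open>K\<close>, \<open>V\<close> (and \<open>L\<close>, \<open>P\<close>) the restriction of digits and codes to the bag of node \<open>v\<close> (and \<open>p\<close>);
  \<open>A\<close> the maximisers; \<open>S\<close>, \<open>Q\<close> the stack of eliminated nodes and their neighbours, of height \<open>c\<close>;
  \<open>d\<close>, \<open>s\<close> degrees and sums of neighbours; \<open>a\<close> the codes chosen by the traceback.
  Rational arrays: \<open>T\<close> the tables, \<open>W\<close> the weights of codes, \<open>M\<close> the message of the current leaf.
\<close>

definition restrict_code :: "vname \<Rightarrow> vname \<Rightarrow> vname \<Rightarrow> com" where
  "restrict_code v K V =
    Seq (Seq (IAssign K (IConst 0) (IConst 0)) (IAssign V (IConst 0) (IConst 0)))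
    (Seq (For ''x'' (Var ''n'')
      (Cond (Pos (IGet ''bag'' (IPlus (IGet ''W'' (Var v)) (Var ''x''))))
        (IAssign K (Inc (Var ''x'')) (Inc (Var ''x'')))
        (IAssign K (Inc (Var ''x'')) (IConst 0))))
    (For ''x'' (Var ''N'')
      (IAssign V (Var ''x'') (IPlus (IGet ''M'' (IGet V (IGet ''D'' (Var ''x'')))) (IGet K (IGet ''R'' (Var ''x'')))))))"

definition init_message :: com where
  "init_message = For ''x'' (Var ''N'')
    (Seq (QAssign ''M'' (Var ''x'') (QPlus (QGet ''T'' (IPlus (IGet ''O'' (Var ''v'')) (Var ''x''))) (QGet ''W'' (Var ''x''))))
      (IAssign ''A'' (IPlus (IGet ''O'' (Var ''v'')) (Var ''x'')) (Var ''x'')))"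

definition max_message :: com where
  "max_message = For ''x'' (Var ''N'')
    (Cond (BAnd (IEq (IGet ''I'' (Var ''x'')) (IConst 0)) (BAnd (IEq (IGet ''V'' (Var ''x'')) (Var ''x''))
        (QLess (QGet ''M'' (IGet ''P'' (Var ''x'')))
          (QPlus (QGet ''T'' (IPlus (IGet ''O'' (Var ''v'')) (Var ''x''))) (QGet ''W'' (Var ''x''))))))
      (Seq (QAssign ''M'' (IGet ''P'' (Var ''x''))
          (QPlus (QGet ''T'' (IPlus (IGet ''O'' (Var ''v'')) (Var ''x''))) (QGet ''W'' (Var ''x''))))
        (IAssign ''A'' (IPlus (IGet ''O'' (Var ''v'')) (IGet ''P'' (Var ''x''))) (Var ''x'')))
      Skip)"

definition add_message :: com where
  "add_message = For ''x'' (Var ''N'')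
    (QAssign ''T'' (IPlus (IGet ''O'' (Var ''p'')) (Var ''x''))
      (QPlus (QGet ''T'' (IPlus (IGet ''O'' (Var ''p'')) (Var ''x'')))
        (QMinus (QGet ''M'' (IGet ''V'' (Var ''x''))) (QGet ''W'' (IGet ''V'' (Var ''x''))))))"

definition merge :: com where
  "merge = Seq (restrict_code ''v'' ''K'' ''V'') (Seq (restrict_code ''p'' ''L'' ''P'')
    (Seq init_message (Seq max_message add_message)))"

lemma iw_merge_parts [simp]:
  "iw (restrict_code v K V) = {K, V, ''x''}" "qw (restrict_code v K V) = {}"
  "iw init_message = {''x'', ''A''}" "qw init_message = {''M''}"
  "iw max_message = {''x'', ''A''}" "qw max_message = {''M''}"
  "iw add_message = {''x''}" "qw add_message = {''T''}"
  by (auto simp: restrict_code_def init_message_def max_message_def add_message_def)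

lemma iw_merge [simp]:
  "iw merge = {''x'', ''A'', ''K'', ''V'', ''L'', ''P''}" "qw merge = {''M'', ''T''}"
  by (auto simp: merge_def)

definition table_names :: "vname set" where
  "table_names = {''n'', ''m'', ''N'', ''M'', ''D'', ''R'', ''W'', ''O'', ''I'', ''bag''}"

context bounded_td
begin

text \<open>Unit of time per node: a pass over the vertices, a pass over the codes, and 1 to absorb
  constants.\<close>

definition "sz = n + N + 1"

definition tables_ok :: "state \<Rightarrow> bool" where
  "tables_ok s \<longleftrightarrow> iarr s ''n'' 0 = n \<and> iarr s ''m'' 0 = m \<and> iarr s ''N'' 0 = N \<and>
    (\<forall>i\<le>N. iarr s ''M'' i = i * B) \<and>
    (\<forall>i<N. iarr s ''D'' i = i div B \<and> iarr s ''R'' i = i mod B) \<and>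
    (\<forall>i\<le>m. iarr s ''W'' i = i * n \<and> iarr s ''O'' i = i * N) \<and>
    (\<forall>i<N. iarr s ''I'' i = (if vld i then 0 else 1)) \<and> (\<forall>i<N. qarr s ''W'' i = wts i) \<and>
    (\<forall>t\<le>m. \<forall>x<n. iarr s ''bag'' (t * n + x) = (if x \<in> bag t then 1 else 0))"

lemma tables_ok_same:
  assumes "tables_ok s" "same A Q s s'" "A \<inter> table_names = {}" "''W'' \<notin> Q"
  shows "tables_ok s'"
proof -
  have "iarr s' x = iarr s x" if "x \<in> table_names" for x
    using that assms(2,3) unfolding same_def by (metis disjoint_iff)
  moreover have "qarr s' ''W'' = qarr s ''W''" using assms(2,4) unfolding same_def by metis
  ultimately show ?thesis using assms(1) unfolding tables_ok_def by (simp add: table_names_def)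
qed

lemma div_B_less: "0 < i \<Longrightarrow> i < N \<Longrightarrow> i div B < i"
  by (rule code_induct[of i "\<lambda>i. 0 < i \<longrightarrow> i div B < i", rule_format]) auto

lemma div_B_less_N: "i < N \<Longrightarrow> i div B < N"
  using div_le_dividend le_less_trans by blast

lemma idx_eq: "r < N \<Longrightarrow> j < N \<Longrightarrow> u * N + r = v * N + j \<longleftrightarrow> u = v \<and> r = j"
proof -
  assume "r < N" "j < N"
  then have "(u * N + r) div N = u" "(v * N + j) div N = v" by simp_all
  then show ?thesis by auto
qed

lemma wp_restrict_code:
  assumes tables_ok: "tables_ok s" and t: "iarr s v 0 = t" "t \<le> m"
    and dist: "distinct [K, V, v, ''x'', ''n'', ''m'', ''N'', ''M'', ''D'', ''R'', ''W'', ''O'', ''I'', ''bag'']"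
  shows "wp (restrict_code v K V) (40 * sz) (\<lambda>s'. \<forall>i<N. iarr s' V i = rst (bag t) i) s"
proof -
  have "K \<noteq> v" "K \<noteq> V" "V \<noteq> v" "K \<noteq> ''x''" "V \<noteq> ''x''" "v \<noteq> ''x''" using dist by simp_all
  note neq = this this[symmetric]
  let ?b1 = "Cond (Pos (IGet ''bag'' (IPlus (IGet ''W'' (Var v)) (Var ''x''))))
        (IAssign K (Inc (Var ''x'')) (Inc (Var ''x'')))
        (IAssign K (Inc (Var ''x'')) (IConst 0))"
  let ?b2 = "IAssign V (Var ''x'') (IPlus (IGet ''M'' (IGet V (IGet ''D'' (Var ''x'')))) (IGet K (IGet ''R'' (Var ''x''))))"
  \<comment> \<open>Base cases: the digit loop writes only from index 1 on, and at code 0 the code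
    loop reads the very entry that it is about to write.\<close>
  let ?b0 = "Seq (IAssign K (IConst 0) (IConst 0)) (IAssign V (IConst 0) (IConst 0))"
  have 1: "wp ?b0 (cost ?b0) (\<lambda>s'. iarr s' K 0 = 0 \<and> iarr s' V 0 = 0) s"
    using neq by (intro wp_loopfree) auto
  have 2: "wp (For ''x'' (Var ''n'') ?b1) (12 + n * (cost ?b1 + 15))
      (\<lambda>s'. \<forall>d\<le>n. iarr s' K d = (if dset d \<subseteq> bag t then d else 0)) s1"
    if s1: "iarr s1 K 0 = 0" "tables_ok s1" "iarr s1 v 0 = t" for s1
  proof (rule wp_For_loopfree[where I = "\<lambda>i s'. \<forall>d\<le>i. iarr s' K d = (if dset d \<subseteq> bag t then d else 0)"])
    fix s' assume same: "same (insert ''x'' (iw ?b1)) (qw ?b1) s1 s'"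
    have "tables_ok s'" by (rule tables_ok_same[OF s1(2) same]) (use dist in \<open>simp_all add: table_names_def\<close>)
    then show "ival (Var ''n'') s' = n" by (simp add: tables_ok_def)
  next
    fix i s' assume i: "i < n" and same: "same (insert ''x'' (iw ?b1)) (qw ?b1) s1 s'"
      and x: "iarr s' ''x'' 0 = i" and I: "\<forall>d\<le>i. iarr s' K d = (if dset d \<subseteq> bag t then d else 0)"
    have tables_ok: "tables_ok s'" by (rule tables_ok_same[OF s1(2) same]) (use dist in \<open>simp_all add: table_names_def\<close>)
    have v: "iarr s' v 0 = t" using same s1(3) neq by (simp add: same_def)
    have "bval (Pos (IGet ''bag'' (IPlus (IGet ''W'' (Var v)) (Var ''x'')))) s' \<longleftrightarrow> i \<in> bag t"
      using tables_ok v x t(2) i by (simp add: tables_ok_def)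
    then show "\<forall>d\<le>Suc i. iarr (iupd ''x'' 0 (Suc i) (sem ?b1 s')) K d = (if dset d \<subseteq> bag t then d else 0)"
      using I x neq by (auto simp: le_Suc_eq dset_def)
  qed (use s1 neq in \<open>auto simp: dset_def\<close>)
  have 3: "wp (For ''x'' (Var ''N'') ?b2) (12 + N * (cost ?b2 + 15)) (\<lambda>s'. \<forall>i<N. iarr s' V i = rst (bag t) i) s2"
    if s2: "\<forall>d\<le>n. iarr s2 K d = (if dset d \<subseteq> bag t then d else 0)" "iarr s2 V 0 = 0" "tables_ok s2" for s2
  proof (rule wp_For_loopfree[where I = "\<lambda>i s'. iarr s' V 0 = 0 \<and> (\<forall>j<i. iarr s' V j = rst (bag t) j)"])
    fix s' assume same: "same (insert ''x'' (iw ?b2)) (qw ?b2) s2 s'"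
    have "tables_ok s'" by (rule tables_ok_same[OF s2(3) same]) (use dist in \<open>simp_all add: table_names_def\<close>)
    then show "ival (Var ''N'') s' = N" by (simp add: tables_ok_def)
  next
    fix i s' assume i: "i < N" and same: "same (insert ''x'' (iw ?b2)) (qw ?b2) s2 s'"
      and x: "iarr s' ''x'' 0 = i" and I: "iarr s' V 0 = 0 \<and> (\<forall>j<i. iarr s' V j = rst (bag t) j)"
    have tables_ok: "tables_ok s'" by (rule tables_ok_same[OF s2(3) same]) (use dist in \<open>simp_all add: table_names_def\<close>)
    have K: "iarr s' K (i mod B) = (if dset (i mod B) \<subseteq> bag t then i mod B else 0)"
      using same s2(1) neq mod_B_le by (simp add: same_def)
    have V: "iarr s' V (i div B) = rst (bag t) (i div B)"
      using I div_B_less[of i] i by (cases "i = 0") auto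
    have "rst (bag t) (i div B) \<le> N" using rst_less[OF div_B_less_N[OF i], of "bag t"] by simp
    then have "ival (IPlus (IGet ''M'' (IGet V (IGet ''D'' (Var ''x'')))) (IGet K (IGet ''R'' (Var ''x'')))) s' = rst (bag t) i"
      using tables_ok x i V K by (simp add: tables_ok_def rst_rec[of "bag t" i])
    then show "iarr (iupd ''x'' 0 (Suc i) (sem ?b2 s')) V 0 = 0 \<and>
      (\<forall>j<Suc i. iarr (iupd ''x'' 0 (Suc i) (sem ?b2 s')) V j = rst (bag t) j)"
      using I x neq by (auto simp: less_Suc_eq)
  qed (use s2 neq in auto)
  have "wp (restrict_code v K V) (cost ?b0 + ((12 + n * (cost ?b1 + 15)) + (12 + N * (cost ?b2 + 15))))
    (\<lambda>s'. \<forall>i<N. iarr s' V i = rst (bag t) i) s"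
    unfolding restrict_code_def
  proof (rule wp_Seq_frame[OF 1], rule wp_Seq_frame[OF 2])
    fix s1 assume s1: "iarr s1 K 0 = 0 \<and> iarr s1 V 0 = 0" "same (iw ?b0) (qw ?b0) s s1"
    then show "iarr s1 K 0 = 0" "iarr s1 v 0 = t" using t neq by (auto simp: same_def)
    show st1: "tables_ok s1" by (rule tables_ok_same[OF tables_ok s1(2)]) (use dist in \<open>simp_all add: table_names_def\<close>)
    fix s2 assume s2: "\<forall>d\<le>n. iarr s2 K d = (if dset d \<subseteq> bag t then d else 0)"
      "same (iw (For ''x'' (Var ''n'') ?b1)) (qw (For ''x'' (Var ''n'') ?b1)) s1 s2"
    have "tables_ok s2" by (rule tables_ok_same[OF st1 s2(2)]) (use dist in \<open>simp_all add: table_names_def\<close>)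
    moreover have "iarr s2 V 0 = 0" using s1 s2(2) neq by (simp add: same_def)
    ultimately show "wp (For ''x'' (Var ''N'') ?b2) (12 + N * (cost ?b2 + 15)) (\<lambda>s'. \<forall>i<N. iarr s' V i = rst (bag t) i) s2"
      using 3 s2(1) by blast
  qed
  then show ?thesis by (rule wp_mono) (auto simp: sz_def)
qed

definition tabm :: "state \<Rightarrow> nat \<Rightarrow> nat \<Rightarrow> rat" where
  "tabm s t i = qarr s ''T'' (t * N + i)"

text \<open>Cut off at \<open>N\<close> because larger offsets would reach into later rows.
  Unchanged rows can then be expressed by plain equality of functions.\<close>

definition argm :: "state \<Rightarrow> nat \<Rightarrow> nat \<Rightarrow> nat" where
  "argm s t r = (if r < N then iarr s ''A'' (t * N + r) else 0)"

lemma wp_init_message: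
  assumes tables_ok: "tables_ok s" and v: "iarr s ''v'' 0 = v" "v \<le> m"
  shows "wp init_message (40 * sz) (\<lambda>s'. (\<forall>j<N. qarr s' ''M'' j = tabm s v j + wts j \<and> argm s' v j = j) \<and>
    (\<forall>u. u \<noteq> v \<longrightarrow> argm s' u = argm s u)) s"
proof -
  let ?b = "Seq (QAssign ''M'' (Var ''x'') (QPlus (QGet ''T'' (IPlus (IGet ''O'' (Var ''v'')) (Var ''x''))) (QGet ''W'' (Var ''x''))))
      (IAssign ''A'' (IPlus (IGet ''O'' (Var ''v'')) (Var ''x'')) (Var ''x''))"
  have "wp init_message (12 + N * (cost ?b + 15)) (\<lambda>s'. (\<forall>j<N. qarr s' ''M'' j = tabm s v j + wts j \<and> argm s' v j = j) \<and>
    (\<forall>u. u \<noteq> v \<longrightarrow> argm s' u = argm s u)) s"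
    unfolding init_message_def
  proof (rule wp_For_loopfree[where I = "\<lambda>i s'. (\<forall>j<i. qarr s' ''M'' j = tabm s v j + wts j \<and> argm s' v j = j) \<and>
    (\<forall>u. u \<noteq> v \<longrightarrow> argm s' u = argm s u)"])
    fix s' assume same: "same (insert ''x'' (iw ?b)) (qw ?b) s s'"
    have "tables_ok s'" by (rule tables_ok_same[OF tables_ok same]) (auto simp: table_names_def)
    then show "ival (Var ''N'') s' = N" by (simp add: tables_ok_def)
  next
    fix i s' assume i: "i < N" and same: "same (insert ''x'' (iw ?b)) (qw ?b) s s'"
      and x: "iarr s' ''x'' 0 = i"
      and I: "(\<forall>j<i. qarr s' ''M'' j = tabm s v j + wts j \<and> argm s' v j = j) \<and> (\<forall>u. u \<noteq> v \<longrightarrow> argm s' u = argm s u)"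
    have tables_ok: "tables_ok s'" by (rule tables_ok_same[OF tables_ok same]) (auto simp: table_names_def)
    have v': "iarr s' ''v'' 0 = v" and T: "qarr s' ''T'' = qarr s ''T''" using same v by (auto simp: same_def)
    have O: "iarr s' ''O'' v = v * N" "qarr s' ''W'' i = wts i" using tables_ok v(2) i by (auto simp: tables_ok_def)
    have "argm (iupd ''x'' 0 (Suc i) (sem ?b s')) u = argm s' u" if "u \<noteq> v" for u
      using that i by (auto simp: x v' O argm_def idx_eq fun_eq_iff)
    then show "(\<forall>j<Suc i. qarr (iupd ''x'' 0 (Suc i) (sem ?b s')) ''M'' j = tabm s v j + wts j \<and>
        argm (iupd ''x'' 0 (Suc i) (sem ?b s')) v j = j) \<and>
      (\<forall>u. u \<noteq> v \<longrightarrow> argm (iupd ''x'' 0 (Suc i) (sem ?b s')) u = argm s u)"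
      using I i by (simp add: x v' T O tabm_def less_Suc_eq) (auto simp: x v' O argm_def idx_eq)
  qed (auto simp: argm_def)
  then show ?thesis by (rule wp_mono) (auto simp: sz_def)
qed

text \<open>For \<open>r\<close> in both bags the code \<open>r\<close> is itself a candidate, so it serves as initial maximiser
  and no sentinel value is needed; for other \<open>r\<close> the entries are junk that is never read.\<close>

definition msg_inv :: "(nat \<Rightarrow> rat) \<Rightarrow> nat \<Rightarrow> nat \<Rightarrow> nat \<Rightarrow> (nat \<Rightarrow> rat) \<Rightarrow> (nat \<Rightarrow> nat) \<Rightarrow> bool" where
  "msg_inv row v p l M arg \<longleftrightarrow> (\<forall>r<N. arg r < N \<and> M r = row (arg r) + wts (arg r) \<and>
     (arg r = r \<or> ok v (arg r) \<and> rst (bag p) (arg r) = r) \<and>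
     (\<forall>i<l. ok v i \<longrightarrow> rst (bag p) i = r \<longrightarrow> row i + wts i \<le> M r))"

lemma msg_inv_Suc:
  assumes "msg_inv row v p l M arg" "ok v l" "rst (bag p) l = r0" "M r0 < row l + wts l"
  shows "msg_inv row v p (Suc l) (M(r0 := row l + wts l)) (arg(r0 := l))"
  unfolding msg_inv_def
proof (intro allI impI)
  fix r assume r: "r < N"
  have "l < N" using assms(2) by (simp add: ok_def)
  then show "(arg(r0 := l)) r < N \<and> (M(r0 := row l + wts l)) r = row ((arg(r0 := l)) r) + wts ((arg(r0 := l)) r) \<and>
     ((arg(r0 := l)) r = r \<or> ok v ((arg(r0 := l)) r) \<and> rst (bag p) ((arg(r0 := l)) r) = r) \<and>
     (\<forall>i<Suc l. ok v i \<longrightarrow> rst (bag p) i = r \<longrightarrow> row i + wts i \<le> (M(r0 := row l + wts l)) r)"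
    using assms r unfolding msg_inv_def by (auto simp: less_Suc_eq) (metis order.strict_implies_order order_trans)
qed

lemma msg_inv_skip:
  assumes "msg_inv row v p l M arg" "ok v l \<Longrightarrow> row l + wts l \<le> M (rst (bag p) l)"
  shows "msg_inv row v p (Suc l) M arg"
  using assms unfolding msg_inv_def by (auto simp: less_Suc_eq)

lemma msg_inv_cong:
  assumes "msg_inv row v p l M arg" "\<And>r. r < N \<Longrightarrow> M' r = M r" "\<And>r. r < N \<Longrightarrow> arg' r = arg r"
  shows "msg_inv row v p l M' arg'"
  unfolding msg_inv_def
proof (intro allI impI)
  fix r assume "r < N"
  then show "arg' r < N \<and> M' r = row (arg' r) + wts (arg' r) \<and>
     (arg' r = r \<or> ok v (arg' r) \<and> rst (bag p) (arg' r) = r) \<and>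
     (\<forall>i<l. ok v i \<longrightarrow> rst (bag p) i = r \<longrightarrow> row i + wts i \<le> M' r)"
    using assms(1) unfolding msg_inv_def assms(2)[OF \<open>r < N\<close>] assms(3)[OF \<open>r < N\<close>] by blast
qed

text \<open>\<open>ok p r\<close> makes \<open>r\<close> its own restriction, so together with
  \<open>ok v r\<close> the initial choice \<open>arg r = r\<close> is a genuine candidate.\<close>

lemma msg_inv_best:
  assumes "msg_inv row v p N M arg" "ok v r" "ok p r"
  shows "best row v p r (arg r) (M r)"
proof -
  have r: "r < N" "rst (bag p) r = r" using assms(3) rst_eq_iff[of r "bag p"] by (auto simp: ok_def)
  then have a: "M r = row (arg r) + wts (arg r)" "arg r = r \<or> ok v (arg r) \<and> rst (bag p) (arg r) = r"
    and "\<forall>i<N. ok v i \<longrightarrow> rst (bag p) i = r \<longrightarrow> row i + wts i \<le> M r"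
    using assms(1) unfolding msg_inv_def by blast+
  then have "\<forall>i. ok v i \<longrightarrow> rst (bag p) i = r \<longrightarrow> row i + wts i \<le> M r"
    by (simp add: ok_def)
  moreover have "ok v (arg r) \<and> rst (bag p) (arg r) = r" using a(2) assms(2) r(2) by metis
  ultimately show ?thesis using a(1) unfolding best_def by blast
qed

lemma wp_max_message:
  assumes tables_ok: "tables_ok s" and v: "iarr s ''v'' 0 = v" "v \<le> m"
    and V: "\<forall>i<N. iarr s ''V'' i = rst (bag v) i" and P: "\<forall>i<N. iarr s ''P'' i = rst (bag p) i"
    and init: "\<forall>j<N. qarr s ''M'' j = tabm s v j + wts j \<and> argm s v j = j"
  shows "wp max_message (100 * sz) (\<lambda>s'. msg_inv (tabm s v) v p N (qarr s' ''M'') (argm s' v) \<and>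
    (\<forall>u. u \<noteq> v \<longrightarrow> argm s' u = argm s u)) s"
proof -
  let ?t = "BAnd (IEq (IGet ''I'' (Var ''x'')) (IConst 0)) (BAnd (IEq (IGet ''V'' (Var ''x'')) (Var ''x''))
        (QLess (QGet ''M'' (IGet ''P'' (Var ''x'')))
          (QPlus (QGet ''T'' (IPlus (IGet ''O'' (Var ''v'')) (Var ''x''))) (QGet ''W'' (Var ''x'')))))"
  let ?u = "Seq (QAssign ''M'' (IGet ''P'' (Var ''x''))
          (QPlus (QGet ''T'' (IPlus (IGet ''O'' (Var ''v'')) (Var ''x''))) (QGet ''W'' (Var ''x''))))
        (IAssign ''A'' (IPlus (IGet ''O'' (Var ''v'')) (IGet ''P'' (Var ''x''))) (Var ''x''))"
  let ?b = "Cond ?t ?u Skip"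
  let ?I = "\<lambda>i s'. msg_inv (tabm s v) v p i (qarr s' ''M'') (argm s' v) \<and>
    (\<forall>u. u \<noteq> v \<longrightarrow> argm s' u = argm s u)"
  have "wp max_message (12 + N * (cost ?b + 15)) (?I N) s"
    unfolding max_message_def
  proof (rule wp_For_loopfree[where I = ?I])
    fix s' assume same: "same (insert ''x'' (iw ?b)) (qw ?b) s s'"
    have "tables_ok s'" by (rule tables_ok_same[OF tables_ok same]) (auto simp: table_names_def)
    then show "ival (Var ''N'') s' = N" by (simp add: tables_ok_def)
  next
    fix i s' assume i: "i < N" and same: "same (insert ''x'' (iw ?b)) (qw ?b) s s'"
      and x: "iarr s' ''x'' 0 = i" and I: "?I i s'"
    have tables_ok: "tables_ok s'" by (rule tables_ok_same[OF tables_ok same]) (auto simp: table_names_def)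
    have eqs: "iarr s' ''v'' 0 = v" "qarr s' ''T'' = qarr s ''T''" "iarr s' ''V'' i = rst (bag v) i"
      "iarr s' ''P'' i = rst (bag p) i" "iarr s' ''O'' v = v * N" "qarr s' ''W'' i = wts i"
      "iarr s' ''I'' i = (if vld i then 0 else 1)"
      using same v V P i tables_ok by (auto simp: same_def tables_ok_def)
    have rN: "rst (bag p) i < N" using rst_less i by simp
    \<comment> \<open>By \<open>rst_eq_iff\<close> the comparison of \<open>V\<close> at
      \<open>x\<close> with \<open>x\<close> tests that the tuple lies in \<open>bag v\<close>; the
      table \<open>I\<close> supplies validity.\<close>
    have t: "bval ?t s' \<longleftrightarrow> ok v i \<and> qarr s' ''M'' (rst (bag p) i) < tabm s v i + wts i"
      using i rst_eq_iff[OF i, of "bag v"] by (auto simp: eqs x ok_def tabm_def split: if_splits)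
    define s2 where "s2 = iupd ''x'' 0 (Suc i) (sem ?b s')"
    have "?I (Suc i) s2"
    proof (cases "bval ?t s'")
      case True
      then have M: "qarr s2 ''M'' = (qarr s' ''M'')(rst (bag p) i := tabm s v i + wts i)"
        by (simp add: s2_def eqs x tabm_def del: bval.simps)
      have A: "iarr s2 ''A'' = (iarr s' ''A'')(v * N + rst (bag p) i := i)"
        using True by (simp add: s2_def eqs x tabm_def del: bval.simps)
      have "msg_inv (tabm s v) v p (Suc i) (qarr s2 ''M'') ((argm s' v)(rst (bag p) i := i))"
        unfolding M using I True t by (intro msg_inv_Suc) auto
      then have "msg_inv (tabm s v) v p (Suc i) (qarr s2 ''M'') (argm s2 v)"
        by (rule msg_inv_cong) (auto simp: argm_def A)
      moreover have "argm s2 u = argm s' u" if "u \<noteq> v" for u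
        unfolding argm_def A using that rN by (auto simp: idx_eq fun_eq_iff)
      ultimately show ?thesis using I by metis
    next
      case False
      then have "sem ?b s' = s'" by (simp del: bval.simps)
      then have "qarr s2 ''M'' = qarr s' ''M''" "argm s2 = argm s'"
        by (simp_all add: s2_def argm_def fun_eq_iff del: sem.simps)
      moreover have "msg_inv (tabm s v) v p (Suc i) (qarr s' ''M'') (argm s' v)"
        using I False t by (intro msg_inv_skip) auto
      ultimately show ?thesis using I by simp
    qed
    then show "?I (Suc i) (iupd ''x'' 0 (Suc i) (sem ?b s'))" unfolding s2_def .
  next
    show "?I 0 (iupd ''x'' 0 0 s)"
      using init by (auto simp: msg_inv_def argm_def)
  qed auto
  then show ?thesis by (rule wp_mono) (auto simp: sz_def)
qed

lemma wp_add_message: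
  assumes tables_ok: "tables_ok s" and p: "iarr s ''p'' 0 = p" "p \<le> m"
    and V: "\<forall>i<N. iarr s ''V'' i = rst (bag v) i"
  shows "wp add_message (80 * sz) (\<lambda>s'.
    (\<forall>j<N. tabm s' p j = tabm s p j + (qarr s ''M'' (rst (bag v) j) - wts (rst (bag v) j))) \<and>
    (\<forall>u j. u \<noteq> p \<longrightarrow> j < N \<longrightarrow> tabm s' u j = tabm s u j)) s"
proof -
  let ?b = "QAssign ''T'' (IPlus (IGet ''O'' (Var ''p'')) (Var ''x''))
      (QPlus (QGet ''T'' (IPlus (IGet ''O'' (Var ''p'')) (Var ''x'')))
        (QMinus (QGet ''M'' (IGet ''V'' (Var ''x''))) (QGet ''W'' (IGet ''V'' (Var ''x'')))))"
  let ?new = "\<lambda>j. tabm s p j + (qarr s ''M'' (rst (bag v) j) - wts (rst (bag v) j))"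
  \<comment> \<open>The row of \<open>p\<close> is updated in place, so the entries not yet reached
    must be known to be the old ones.\<close>
  let ?I = "\<lambda>i s'. (\<forall>j<N. tabm s' p j = (if j < i then ?new j else tabm s p j)) \<and>
    (\<forall>u j. u \<noteq> p \<longrightarrow> j < N \<longrightarrow> tabm s' u j = tabm s u j)"
  have "wp add_message (12 + N * (cost ?b + 15)) (?I N) s"
    unfolding add_message_def
  proof (rule wp_For_loopfree[where I = ?I])
    fix s' assume same: "same (insert ''x'' (iw ?b)) (qw ?b) s s'"
    have "tables_ok s'" by (rule tables_ok_same[OF tables_ok same]) (auto simp: table_names_def)
    then show "ival (Var ''N'') s' = N" by (simp add: tables_ok_def)
  next
    fix i s' assume i: "i < N" and same: "same (insert ''x'' (iw ?b)) (qw ?b) s s'"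
      and x: "iarr s' ''x'' 0 = i" and I: "?I i s'"
    have tables_ok: "tables_ok s'" by (rule tables_ok_same[OF tables_ok same]) (auto simp: table_names_def)
    have eqs: "iarr s' ''p'' 0 = p" "qarr s' ''M'' = qarr s ''M''" "iarr s' ''V'' i = rst (bag v) i"
      "iarr s' ''O'' p = p * N" "qarr s' ''W'' (rst (bag v) i) = wts (rst (bag v) i)"
      using same p V i tables_ok rst_less[OF i] by (auto simp: same_def tables_ok_def)
    have T: "qarr s' ''T'' (p * N + i) = tabm s p i" using I i by (auto simp: tabm_def)
    show "?I (Suc i) (iupd ''x'' 0 (Suc i) (sem ?b s'))"
      using I i by (auto simp: x eqs T idx_eq less_Suc_eq tabm_def)
  qed (auto simp: tabm_def)
  then show ?thesis by (rule wp_mono) (auto simp: sz_def)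
qed

text \<open>The message is existential since the next merge overwrites its array; what must survive
  is the row of \<open>v\<close> in \<open>A\<close> and the row of \<open>p\<close> in
  \<open>T\<close>.\<close>

lemma wp_merge:
  assumes tables_ok: "tables_ok s" and v: "iarr s ''v'' 0 = v" "v \<le> m" and p: "iarr s ''p'' 0 = p" "p \<le> m"
  shows "wp merge (300 * sz) (\<lambda>s'. \<exists>M.
    (\<forall>r. ok v r \<longrightarrow> ok p r \<longrightarrow> best (tabm s v) v p r (argm s' v r) (M r)) \<and>
    (\<forall>r. argm s' v r < N) \<and> (\<forall>u. u \<noteq> v \<longrightarrow> argm s' u = argm s u) \<and>
    (\<forall>j<N. tabm s' p j = tabm s p j + (M (rst (bag v) j) - wts (rst (bag v) j))) \<and>
    (\<forall>u j. u \<noteq> p \<longrightarrow> j < N \<longrightarrow> tabm s' u j = tabm s u j)) s" (is "wp _ _ ?Q s")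
proof -
  have "wp merge (40 * sz + (40 * sz + (40 * sz + (100 * sz + 80 * sz)))) ?Q s"
    unfolding merge_def
  proof (rule wp_Seq_frame[OF wp_restrict_code], rule tables_ok, rule v(1), rule v(2))
    fix s1 assume s1: "\<forall>i<N. iarr s1 ''V'' i = rst (bag v) i"
      "same (iw (restrict_code ''v'' ''K'' ''V'')) (qw (restrict_code ''v'' ''K'' ''V'')) s s1"
    have sta1: "tables_ok s1" by (rule tables_ok_same[OF tables_ok s1(2)]) (auto simp: table_names_def)
    have p1: "iarr s1 ''p'' 0 = p" using s1(2) p by (simp add: same_def)
    show "wp (Seq (restrict_code ''p'' ''L'' ''P'') (Seq init_message (Seq max_message add_message)))
      (40 * sz + (40 * sz + (100 * sz + 80 * sz))) ?Q s1"
    proof (rule wp_Seq_frame[OF wp_restrict_code], rule sta1, rule p1, rule p(2))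
      fix s2 assume s2: "\<forall>i<N. iarr s2 ''P'' i = rst (bag p) i"
        "same (iw (restrict_code ''p'' ''L'' ''P'')) (qw (restrict_code ''p'' ''L'' ''P'')) s1 s2"
      have sta2: "tables_ok s2" by (rule tables_ok_same[OF sta1 s2(2)]) (auto simp: table_names_def)
      have v2: "iarr s2 ''v'' 0 = v" "iarr s2 ''V'' = iarr s1 ''V''" "iarr s2 ''A'' = iarr s ''A''"
        "qarr s2 ''T'' = qarr s ''T''" "iarr s2 ''p'' 0 = p"
        using s1(2) s2(2) v p by (auto simp: same_def)
      show "wp (Seq init_message (Seq max_message add_message)) (40 * sz + (100 * sz + 80 * sz)) ?Q s2"
      proof (rule wp_Seq_frame[OF wp_init_message], rule sta2, rule v2(1), rule v(2))
        fix s3 assume s3: "(\<forall>j<N. qarr s3 ''M'' j = tabm s2 v j + wts j \<and> argm s3 v j = j) \<and>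
          (\<forall>u. u \<noteq> v \<longrightarrow> argm s3 u = argm s2 u)" "same (iw init_message) (qw init_message) s2 s3"
        have sta3: "tables_ok s3" by (rule tables_ok_same[OF sta2 s3(2)]) (auto simp: table_names_def)
        have v3: "iarr s3 ''v'' 0 = v" "iarr s3 ''V'' = iarr s1 ''V''" "iarr s3 ''P'' = iarr s2 ''P''"
          "qarr s3 ''T'' = qarr s ''T''" "iarr s3 ''p'' 0 = p"
          using s3(2) v2 by (auto simp: same_def)
        have init: "\<forall>j<N. qarr s3 ''M'' j = tabm s3 v j + wts j \<and> argm s3 v j = j"
          using s3(1) v2 v3 by (simp add: tabm_def)
        show "wp (Seq max_message add_message) (100 * sz + 80 * sz) ?Q s3"
        proof (rule wp_Seq_frame[OF wp_max_message[where p = p]], rule sta3, rule v3(1), rule v(2))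
          show "\<forall>i<N. iarr s3 ''V'' i = rst (bag v) i" "\<forall>i<N. iarr s3 ''P'' i = rst (bag p) i"
            using s1 s2 v3 by simp_all
          show "\<forall>j<N. qarr s3 ''M'' j = tabm s3 v j + wts j \<and> argm s3 v j = j" by (fact init)
          fix s4 assume s4: "msg_inv (tabm s3 v) v p N (qarr s4 ''M'') (argm s4 v) \<and>
            (\<forall>u. u \<noteq> v \<longrightarrow> argm s4 u = argm s3 u)" "same (iw max_message) (qw max_message) s3 s4"
          have sta4: "tables_ok s4" by (rule tables_ok_same[OF sta3 s4(2)]) (auto simp: table_names_def)
          have v4: "iarr s4 ''V'' = iarr s1 ''V''" "qarr s4 ''T'' = qarr s ''T''" "iarr s4 ''p'' 0 = p"
            using s4(2) v3 by (auto simp: same_def)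
          have V4: "\<forall>i<N. iarr s4 ''V'' i = rst (bag v) i" using v4 s1 by simp
          have tab: "tabm s3 = tabm s" "tabm s4 = tabm s" using v3 v4 by (auto simp: tabm_def fun_eq_iff)
          have arg: "argm s4 u = argm s u" if "u \<noteq> v" for u
            using that s4(1) s3(1) v2(3) by (simp add: argm_def fun_eq_iff)
          have lt: "argm s4 v r < N" for r
            using s4(1) N_pos by (cases "r < N") (auto simp: msg_inv_def argm_def)
          show "wp add_message (80 * sz) ?Q s4"
          proof (rule wp_mono[OF wp_frame[OF wp_add_message[OF sta4 v4(3) p(2) V4]] order_refl])
            fix s5 assume s5: "((\<forall>j<N. tabm s5 p j = tabm s4 p j + (qarr s4 ''M'' (rst (bag v) j) - wts (rst (bag v) j))) \<and>
              (\<forall>u j. u \<noteq> p \<longrightarrow> j < N \<longrightarrow> tabm s5 u j = tabm s4 u j)) \<and> same (iw add_message) (qw add_message) s4 s5"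
            have "iarr s5 ''A'' = iarr s4 ''A''" using s5 by (simp add: same_def)
            then have a5: "argm s5 = argm s4" by (simp add: argm_def fun_eq_iff)
            show "?Q s5"
              using s5 msg_inv_best[of "tabm s v" v p "qarr s4 ''M''" "argm s4 v"] s4(1) lt arg
              unfolding a5 tab by (intro exI[of _ "qarr s4 ''M''"]) auto
          qed
        qed
      qed
    qed simp_all
  qed simp_all
  then show ?thesis by (rule wp_mono) auto
qed

end


section \<open>Elimination and traceback\<close>

definition push :: com where
  "push = Seq (IAssign ''S'' (Var ''c'') (Var ''v'')) (Seq (IAssign ''Q'' (Var ''c'') (Var ''p''))
    (Assign ''c'' (Inc (Var ''c''))))"

definition eliminate :: com where
  "eliminate = Seq push merge"

definition unlink :: com where
  "unlink = Seq (Assign ''p'' (IGet ''s'' (Var ''v''))) (Seq (IAssign ''d'' (Var ''v'') (IConst 0))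
    (Seq (IAssign ''d'' (Var ''p'') (IMinus (IGet ''d'' (Var ''p'')) (IConst 1)))
    (Seq (IAssign ''s'' (Var ''p'') (IMinus (IGet ''s'' (Var ''p'')) (Var ''v'')))
      (Assign ''r'' (Var ''p'')))))"

definition advance :: com where
  "advance = Seq (Assign ''i'' (Inc (Var ''i''))) (Assign ''v'' (Var ''i''))"

text \<open>Each iteration either advances \<open>i\<close> or eliminates a node, so there are at most \<open>2 * m\<close>
  iterations.  After an elimination only the neighbour \<open>p\<close> can have become a leaf below \<open>i\<close>.\<close>

definition eliminate_all :: com where
  "eliminate_all = While (ILess (Var ''i'') (Var ''m''))
    (Cond (IEq (IGet ''d'' (Var ''v'')) (IConst 1))
      (Seq unlink (Seq eliminate (Assign ''v'' (Var ''p''))))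
      advance)"

definition eliminate_root :: com where
  "eliminate_root = Seq (Seq (Assign ''v'' (Var ''r'')) (Assign ''p'' (Var ''m''))) eliminate"

definition emit :: "nat \<Rightarrow> com" where
  "emit k = For ''y'' (IConst k)
    (Seq (Cond (Pos (IGet ''R'' (Var ''j''))) (IAssign ''out'' (IMinus (IGet ''R'' (Var ''j'')) (IConst 1)) (IConst 1)) Skip)
      (Assign ''j'' (IGet ''D'' (Var ''j''))))"

definition pop :: com where
  "pop = Seq (Assign ''c'' (IMinus (Var ''c'') (IConst 1)))
    (Seq (Assign ''v'' (IGet ''S'' (Var ''c''))) (Assign ''p'' (IGet ''Q'' (Var ''c''))))"

definition decide :: com where
  "decide = Seq (IAssign ''a'' (Var ''v'') (IGet ''A'' (IPlus (IGet ''O'' (Var ''v'')) (IGet ''V'' (IGet ''a'' (Var ''p''))))))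
    (Assign ''j'' (IGet ''a'' (Var ''v'')))"

definition traceback :: "nat \<Rightarrow> com" where
  "traceback k = While (Pos (Var ''c''))
    (Seq pop (Seq (restrict_code ''v'' ''K'' ''V'') (Seq decide (emit k))))"

lemma iw_elim [simp]:
  "iw push = {''S'', ''Q'', ''c''}" "qw push = {}"
  "iw eliminate = {''S'', ''Q'', ''c'', ''x'', ''A'', ''K'', ''V'', ''L'', ''P''}" "qw eliminate = {''M'', ''T''}"
  "iw unlink = {''p'', ''d'', ''s'', ''r''}" "qw unlink = {}"
  "iw advance = {''i'', ''v''}" "qw advance = {}"
  "iw (emit k) = {''y'', ''j'', ''out''}" "qw (emit k) = {}"
  "iw pop = {''c'', ''v'', ''p''}" "qw pop = {}"
  "iw decide = {''a'', ''j''}" "qw decide = {}"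
  by (auto simp: push_def eliminate_def unlink_def advance_def emit_def pop_def decide_def)

lemma iw_elim_all [simp]:
  "iw eliminate_all = {''S'', ''Q'', ''c'', ''x'', ''A'', ''K'', ''V'', ''L'', ''P'', ''p'', ''d'', ''s'', ''r'', ''i'', ''v''}"
  "qw eliminate_all = {''M'', ''T''}"
  "iw eliminate_root = {''S'', ''Q'', ''c'', ''x'', ''A'', ''K'', ''V'', ''L'', ''P'', ''p'', ''v''}"
  "qw eliminate_root = {''M'', ''T''}"
  by (auto simp: eliminate_all_def eliminate_root_def)

text \<open>Reversed so that the top of the stack is the head of the list, as in elimination
  sequences.\<close>

definition stk :: "state \<Rightarrow> (nat \<times> nat) list" where
  "stk s = map (\<lambda>q. (iarr s ''S'' q, iarr s ''Q'' q)) (rev [0..<iarr s ''c'' 0])"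

lemma stk_cong:
  "iarr s' ''S'' = iarr s ''S'' \<Longrightarrow> iarr s' ''Q'' = iarr s ''Q'' \<Longrightarrow> iarr s' ''c'' = iarr s ''c'' \<Longrightarrow> stk s' = stk s"
  by (simp add: stk_def)

lemma stk_push:
  "stk (sem push s) = (iarr s ''v'' 0, iarr s ''p'' 0) # stk s"
  by (simp add: stk_def push_def)

lemma stk_pop:
  assumes "0 < iarr s ''c'' 0"
  shows "stk s = (iarr (sem pop s) ''v'' 0, iarr (sem pop s) ''p'' 0) # stk (sem pop s)"
proof -
  obtain c where "iarr s ''c'' 0 = Suc c" using assms gr0_implies_Suc by blast
  then show ?thesis by (simp add: stk_def pop_def)
qed

context bounded_td
begin

definition dp :: "state \<Rightarrow> (nat \<times> nat) list \<Rightarrow> bool" where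
  "dp s evs \<longleftrightarrow> evs = stk s \<and> elimination evs \<and> opt evs (tabm s) (argm s) \<and>
     (\<forall>u\<in>fst ` set evs. \<forall>r. argm s u r < N)"

lemma dpD:
  assumes "dp s evs"
  shows "stk s = evs" "elimination evs" "opt evs (tabm s) (argm s)"
    "\<And>u r. u \<in> fst ` set evs \<Longrightarrow> argm s u r < N"
  using assms unfolding dp_def by blast+

lemma dp_cong:
  assumes "dp s evs" "iarr s' ''S'' = iarr s ''S''" "iarr s' ''Q'' = iarr s ''Q''"
    "iarr s' ''c'' = iarr s ''c''" "iarr s' ''A'' = iarr s ''A''" "qarr s' ''T'' = qarr s ''T''"
  shows "dp s' evs"
proof -
  have "tabm s' = tabm s" "argm s' = argm s" using assms by (auto simp: tabm_def argm_def fun_eq_iff)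
  moreover have "stk s' = stk s" using assms by (intro stk_cong)
  ultimately show ?thesis using assms(1) unfolding dp_def by metis
qed

lemma wp_eliminate:
  assumes tables_ok: "tables_ok s" and dp: "dp s evs" and v: "iarr s ''v'' 0 = v" and p: "iarr s ''p'' 0 = p"
    and elim: "elimination ((v, p) # evs)" and sep: "separated evs v p"
  shows "wp eliminate (350 * sz) (\<lambda>s'. dp s' ((v, p) # evs)) s"
proof -
  have vp: "v \<le> m" "p \<le> m" "v \<in> remaining evs"
    using elim by (auto elim!: elimination_ConsE) (auto simp: remaining_def)
  have push: "wp push (cost push) (\<lambda>s'. s' = sem push s) s"
    by (intro wp_loopfree) (auto simp: push_def)
  have "wp eliminate (cost push + 300 * sz) (\<lambda>s'. dp s' ((v, p) # evs)) s"
    unfolding eliminate_def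
  proof (rule wp_Seq_frame[OF push])
    fix s1 assume s1: "s1 = sem push s" "same (iw push) (qw push) s s1"
    have sta1: "tables_ok s1" by (rule tables_ok_same[OF tables_ok s1(2)]) (auto simp: table_names_def)
    have eqs: "iarr s1 ''v'' 0 = v" "iarr s1 ''p'' 0 = p" "tabm s1 = tabm s" "argm s1 = argm s"
      using s1(2) v p by (auto simp: same_def tabm_def argm_def fun_eq_iff)
    have stk1: "stk s1 = (v, p) # evs" using s1(1) stk_push[of s] v p dpD(1)[OF dp] by simp
    show "wp merge (300 * sz) (\<lambda>s'. dp s' ((v, p) # evs)) s1"
    proof (rule wp_mono[OF wp_frame[OF wp_merge[OF sta1 eqs(1) vp(1) eqs(2) vp(2)]] order_refl])
      fix s2
      assume A: "(\<exists>M. (\<forall>r. ok v r \<longrightarrow> ok p r \<longrightarrow> best (tabm s1 v) v p r (argm s2 v r) (M r)) \<and>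
        (\<forall>r. argm s2 v r < N) \<and> (\<forall>u. u \<noteq> v \<longrightarrow> argm s2 u = argm s1 u) \<and>
        (\<forall>j<N. tabm s2 p j = tabm s1 p j + (M (rst (bag v) j) - wts (rst (bag v) j))) \<and>
        (\<forall>u j. u \<noteq> p \<longrightarrow> j < N \<longrightarrow> tabm s2 u j = tabm s1 u j)) \<and> same (iw merge) (qw merge) s1 s2"
      then obtain M where M: "\<And>r. ok v r \<Longrightarrow> ok p r \<Longrightarrow> best (tabm s v) v p r (argm s2 v r) (M r)"
        "\<And>r. argm s2 v r < N" "\<And>u. u \<noteq> v \<Longrightarrow> argm s2 u = argm s u"
        "\<And>j. j < N \<Longrightarrow> tabm s2 p j = tabm s p j + (M (rst (bag v) j) - wts (rst (bag v) j))"
        "\<And>u j. u \<noteq> p \<Longrightarrow> j < N \<Longrightarrow> tabm s2 u j = tabm s u j"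
        unfolding eqs by blast
      have same: "same (iw merge) (qw merge) s1 s2" using A by blast
      have "stk s2 = stk s1" using same by (intro stk_cong) (auto simp: same_def)
      moreover have "opt ((v, p) # evs) (tabm s2) (argm s2)"
        using M by (intro opt_Cons[OF dpD(3)[OF dp] elim sep, where M = M]) (auto simp: ok_def)
      moreover have "argm s2 u r < N" if "u \<in> fst ` set ((v, p) # evs)" for u r
        using that M(2,3) dpD(4)[OF dp, of u r] by (cases "u = v") auto
      ultimately show "dp s2 ((v, p) # evs)" using stk1 elim unfolding dp_def by simp
    qed
  qed
  then show ?thesis by (rule wp_mono) (auto simp: sz_def push_def)
qed

section \<open>Degrees and neighbour sums during elimination\<close>

definition deg_inv :: "(nat \<Rightarrow> nat) \<Rightarrow> (nat \<Rightarrow> nat) \<Rightarrow> (nat \<times> nat) list \<Rightarrow> bool" where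
  "deg_inv d \<sigma> evs \<longleftrightarrow> (\<forall>t<m. d t = (if t \<in> remaining evs then card (nbs evs t) else 0) \<and>
     (t \<in> remaining evs \<longrightarrow> \<sigma> t = \<Sum>(nbs evs t)))"

lemma finite_nbs: "finite (nbs evs t)"
  by (simp add: nbs_def remaining_def)

text \<open>Eliminated nodes have recorded degree 0, so degree 1 alone certifies a remaining
  leaf.\<close>

lemma deg_inv_leaf:
  assumes "deg_inv d \<sigma> evs" "v < m" "d v = 1"
  shows "v \<in> remaining evs" "nbs evs v = {\<sigma> v}" "\<sigma> v \<in> remaining evs" "\<sigma> v < m" "\<sigma> v \<noteq> v"
proof -
  show v: "v \<in> remaining evs" using assms unfolding deg_inv_def by (metis zero_neq_one)
  then have "card (nbs evs v) = 1" "\<sigma> v = \<Sum>(nbs evs v)" using assms by (auto simp: deg_inv_def)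
  then show nb: "nbs evs v = {\<sigma> v}" by (metis card_1_singletonE finite.emptyI add.right_neutral empty_iff sum.empty sum.insert)
  then have "\<sigma> v \<in> remaining evs \<and> {v, \<sigma> v} \<in> edges T" by (auto simp: nbs_def)
  then show "\<sigma> v \<in> remaining evs" "\<sigma> v < m" "\<sigma> v \<noteq> v" using edges_T_less[of v "\<sigma> v"] by auto
qed

text \<open>Only \<open>p\<close> loses a neighbour, and \<open>v\<close> is a summand of its
  neighbour sum, so the truncated subtraction is exact.\<close>

lemma deg_inv_unlink:
  assumes inv: "deg_inv d \<sigma> evs" and v: "v < m" "v \<in> remaining evs" and nb: "nbs evs v = {p}" and pv: "p \<noteq> v"
  shows "deg_inv (d(v := 0, p := d p - 1)) (\<sigma>(p := \<sigma> p - v)) ((v, p) # evs)"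
  unfolding deg_inv_def
proof (intro allI impI)
  fix t assume t: "t < m"
  have nbs: "nbs ((v, p) # evs) t = nbs evs t - {v}" by (auto simp: nbs_def remaining_Cons)
  have vt: "v \<in> nbs evs t \<longleftrightarrow> t = p" if "t \<in> remaining evs"
  proof -
    have "v \<in> nbs evs t \<longleftrightarrow> t \<in> nbs evs v" using that v by (auto simp: nbs_def insert_commute)
    then show ?thesis using nb by simp
  qed
  have pr: "p \<in> remaining evs" using nb by (auto simp: nbs_def)
  have I: "d t = (if t \<in> remaining evs then card (nbs evs t) else 0)"
    "t \<in> remaining evs \<Longrightarrow> \<sigma> t = \<Sum>(nbs evs t)" using inv t by (auto simp: deg_inv_def)
  show "(d(v := 0, p := d p - 1)) t = (if t \<in> remaining ((v, p) # evs) then card (nbs ((v, p) # evs) t) else 0) \<and>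
    (t \<in> remaining ((v, p) # evs) \<longrightarrow> (\<sigma>(p := \<sigma> p - v)) t = \<Sum>(nbs ((v, p) # evs) t))"
  proof (cases "t = p")
    case True
    then have "\<Sum>(nbs evs t - {v}) = \<Sum>(nbs evs t) - v"
      using vt pr finite_nbs by (simp add: sum_diff1_nat)
    then show ?thesis using True pv pr vt I finite_nbs[of evs t] unfolding nbs by (simp add: remaining_Cons)
  next
    case False
    show ?thesis
    proof (cases "t \<in> remaining evs \<and> t \<noteq> v")
      case True
      then have "nbs evs t - {v} = nbs evs t" using vt False by auto
      then show ?thesis using True False I unfolding nbs by (simp add: remaining_Cons)
    next
      case f: False
      then show ?thesis using False I by (auto simp: remaining_Cons)
    qed
  qed
qed

lemma elimination_length: "elimination evs \<Longrightarrow> length evs \<le> m"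
proof -
  assume E: "elimination evs"
  then have "distinct (map fst evs) \<and> fst ` set evs \<subseteq> {..<m}"
    by (induction rule: elimination.induct) (auto simp: remaining_def)
  then have "length evs = card (fst ` set evs)" "card (fst ` set evs) \<le> m"
    using distinct_card[of "map fst evs"] card_mono[of "{..<m}" "fst ` set evs"] by auto
  then show ?thesis by simp
qed

text \<open>\<open>v\<close> is the only node up to \<open>i\<close> that may currently be a leaf.
  \<open>r\<close> always names a remaining real node, at first node 0 and then the latest neighbour
  \<open>p\<close>, so the last node is known when the loop ends.\<close>

definition loop_inv :: "state \<Rightarrow> (nat \<times> nat) list \<Rightarrow> bool" where
  "loop_inv s evs \<longleftrightarrow> tables_ok s \<and> dp s evs \<and> edges_ok evs \<and> m \<notin> snd ` set evs \<and>
     deg_inv (iarr s ''d'') (iarr s ''s'') evs \<and>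
     iarr s ''r'' 0 \<in> remaining evs \<and> iarr s ''r'' 0 < m \<and> iarr s ''i'' 0 \<le> m \<and>
     (iarr s ''i'' 0 < m \<longrightarrow> iarr s ''v'' 0 < m) \<and> (iarr s ''i'' 0 = m \<longrightarrow> iarr s ''v'' 0 = m) \<and>
     (\<forall>j \<le> iarr s ''i'' 0. j < m \<longrightarrow> j \<noteq> iarr s ''v'' 0 \<longrightarrow> iarr s ''d'' j \<noteq> 1)"

lemma dp_length: "dp s evs \<Longrightarrow> iarr s ''c'' 0 = length evs"
  using dpD(1)[of s evs] by (auto simp: stk_def)

lemma wp_advance:
  assumes inv: "loop_inv s evs" and lt: "iarr s ''i'' 0 < m" and d: "iarr s ''d'' (iarr s ''v'' 0) \<noteq> 1"
  shows "wp advance 20 (\<lambda>s'. loop_inv s' evs \<and> iarr s' ''i'' 0 = Suc (iarr s ''i'' 0) \<and> iarr s' ''c'' = iarr s ''c'') s"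
proof -
  have "wp advance (cost advance) (\<lambda>s'. loop_inv s' evs \<and> iarr s' ''i'' 0 = Suc (iarr s ''i'' 0) \<and> iarr s' ''c'' = iarr s ''c'') s"
  proof (rule wp_loopfree)
    let ?s = "sem advance s"
    have eqs: "iarr ?s ''i'' 0 = Suc (iarr s ''i'' 0)" "iarr ?s ''v'' 0 = Suc (iarr s ''i'' 0)"
      "\<And>x. x \<noteq> ''i'' \<Longrightarrow> x \<noteq> ''v'' \<Longrightarrow> iarr ?s x = iarr s x" "\<And>x. qarr ?s x = qarr s x"
      by (auto simp: advance_def)
    have same: "same {''i'', ''v''} {} s ?s" using eqs by (auto simp: same_def)
    have "tables_ok ?s" by (rule tables_ok_same[OF _ same]) (use inv in \<open>auto simp: loop_inv_def table_names_def\<close>)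
    moreover have "dp ?s evs" by (rule dp_cong[of s]) (use inv in \<open>auto simp: eqs loop_inv_def\<close>)
    moreover have "iarr s ''d'' j \<noteq> 1" if "j \<le> iarr s ''i'' 0" for j
      using inv that lt d unfolding loop_inv_def by (cases "j = iarr s ''v'' 0") auto
    ultimately show "loop_inv ?s evs \<and> iarr ?s ''i'' 0 = Suc (iarr s ''i'' 0) \<and> iarr ?s ''c'' = iarr s ''c''"
      using inv lt unfolding loop_inv_def by (simp add: eqs le_Suc_eq)
  qed (simp add: advance_def)
  then show ?thesis by (rule wp_mono) (auto simp: advance_def)
qed

lemma wp_eliminate_leaf:
  assumes inv: "loop_inv s evs" and lt: "iarr s ''i'' 0 < m" and d: "iarr s ''d'' (iarr s ''v'' 0) = 1"
  shows "wp (Seq unlink (Seq eliminate (Assign ''v'' (Var ''p'')))) (400 * sz)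
    (\<lambda>s'. \<exists>e. loop_inv s' (e # evs) \<and> iarr s' ''i'' = iarr s ''i'') s"
proof -
  define v where "v = iarr s ''v'' 0"
  define p where "p = iarr s ''s'' v"
  have vm: "v < m" using inv lt by (simp add: loop_inv_def v_def)
  have deg: "deg_inv (iarr s ''d'') (iarr s ''s'') evs" and E: "elimination evs" "edges_ok evs"
    and tables_ok: "tables_ok s" and dp: "dp s evs" using inv dpD(2) by (auto simp: loop_inv_def)
  note leaf = deg_inv_leaf[OF deg vm d[folded v_def], folded p_def]
  have elim: "elimination ((v, p) # evs)" using E leaf vm by (intro elimination.Cons) auto
  have sep: "separated evs v p" using separated_leaf[OF E leaf(2)] leaf(5) by simp
  let ?d = "(iarr s ''d'')(v := 0, p := iarr s ''d'' p - 1)" and ?\<sigma> = "(iarr s ''s'')(p := iarr s ''s'' p - v)"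
  have unlink: "wp unlink (cost unlink) (\<lambda>s'. iarr s' ''p'' 0 = p \<and> iarr s' ''d'' = ?d \<and>
    iarr s' ''s'' = ?\<sigma> \<and> iarr s' ''r'' 0 = p) s"
    using leaf(5) by (intro wp_loopfree) (auto simp: unlink_def v_def p_def)
  have "wp (Seq unlink (Seq eliminate (Assign ''v'' (Var ''p'')))) (cost unlink + (350 * sz + cost (Assign ''v'' (Var ''p''))))
    (\<lambda>s'. \<exists>e. loop_inv s' (e # evs) \<and> iarr s' ''i'' = iarr s ''i'') s"
  proof (rule wp_Seq_frame[OF unlink])
    fix s1 assume s1: "iarr s1 ''p'' 0 = p \<and> iarr s1 ''d'' = ?d \<and> iarr s1 ''s'' = ?\<sigma> \<and> iarr s1 ''r'' 0 = p"
      and same1: "same (iw unlink) (qw unlink) s s1"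
    have sta1: "tables_ok s1" by (rule tables_ok_same[OF tables_ok same1]) (auto simp: table_names_def)
    have dp1: "dp s1 evs" by (rule dp_cong[OF dp]) (use same1 in \<open>auto simp: same_def\<close>)
    have v1: "iarr s1 ''v'' 0 = v" "iarr s1 ''p'' 0 = p" using same1 s1 by (auto simp: same_def v_def)
    show "wp (Seq eliminate (Assign ''v'' (Var ''p''))) (350 * sz + cost (Assign ''v'' (Var ''p'')))
      (\<lambda>s'. \<exists>e. loop_inv s' (e # evs) \<and> iarr s' ''i'' = iarr s ''i'') s1"
    proof (rule wp_Seq_frame[OF wp_eliminate[OF sta1 dp1 v1 elim sep]])
      fix s2 assume dp2: "dp s2 ((v, p) # evs)" and same2: "same (iw eliminate) (qw eliminate) s1 s2"
      have sta2: "tables_ok s2" by (rule tables_ok_same[OF sta1 same2]) (auto simp: table_names_def)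
      show "wp (Assign ''v'' (Var ''p'')) (cost (Assign ''v'' (Var ''p'')))
        (\<lambda>s'. \<exists>e. loop_inv s' (e # evs) \<and> iarr s' ''i'' = iarr s ''i'') s2"
      proof (rule wp_loopfree)
        let ?s = "sem (Assign ''v'' (Var ''p'')) s2"
        have eqs: "iarr ?s ''v'' 0 = p" "iarr ?s ''d'' = ?d" "iarr ?s ''s'' = ?\<sigma>" "iarr ?s ''r'' 0 = p"
          "iarr ?s ''i'' = iarr s ''i''"
          using same1 same2 s1 by (auto simp: same_def)
        have same3: "same {''v''} {} s2 ?s" by (auto simp: same_def)
        have "tables_ok ?s" by (rule tables_ok_same[OF sta2 same3]) (auto simp: table_names_def)
        moreover have "dp ?s ((v, p) # evs)" by (rule dp_cong[OF dp2]) auto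
        moreover have "?d j \<noteq> 1" if "j \<le> iarr s ''i'' 0" "j < m" "j \<noteq> p" for j
          using that inv unfolding loop_inv_def v_def by auto
        moreover have "deg_inv ?d ?\<sigma> ((v, p) # evs)"
          using deg_inv_unlink[OF deg vm leaf(1,2,5)] .
        ultimately have "loop_inv ?s ((v, p) # evs)"
          using inv lt leaf edges_ok_Cons[OF elim E(2) leaf(2)] unfolding loop_inv_def eqs
          by (auto simp: remaining_Cons simp del: sem.simps)
        then show "\<exists>e. loop_inv ?s (e # evs) \<and> iarr ?s ''i'' = iarr s ''i''" using eqs by blast
      qed simp
    qed
  qed
  then show ?thesis by (rule wp_mono) (auto simp: unlink_def sz_def)
qed

lemma wp_eliminate_all:
  assumes "loop_inv s []" "iarr s ''i'' 0 = 0"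
  shows "wp eliminate_all (10 + 2 * m * (500 * sz)) (\<lambda>s'. \<exists>evs. loop_inv s' evs \<and> iarr s' ''i'' 0 = m) s"
proof -
  let ?b = "ILess (Var ''i'') (Var ''m'')"
  let ?t = "IEq (IGet ''d'' (Var ''v'')) (IConst 1)"
  let ?c = "Cond ?t (Seq unlink (Seq eliminate (Assign ''v'' (Var ''p'')))) advance"
  \<comment> \<open>Each round raises either \<open>i\<close> or the stack height \<open>c\<close>,
    and neither exceeds \<open>m\<close>.\<close>
  let ?f = "\<lambda>s. (m - iarr s ''i'' 0) + (m - iarr s ''c'' 0)"
  let ?Q = "\<lambda>s'. \<exists>evs. loop_inv s' evs \<and> iarr s' ''i'' 0 = m"
  have "wp eliminate_all (1 + bcost ?b + ?f s * (1 + bcost ?b + (1 + bcost ?t + 400 * sz))) ?Q s"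
    unfolding eliminate_all_def
  proof (rule wp_While[where I = "\<lambda>s. \<exists>evs. loop_inv s evs"])
    show "\<exists>evs. loop_inv s evs" using assms by blast
  next
    fix s assume "\<exists>evs. loop_inv s evs" and b: "bval ?b s"
    then obtain evs where inv: "loop_inv s evs" by blast
    have lt: "iarr s ''i'' 0 < m" using b inv by (simp add: loop_inv_def tables_ok_def)
    show "wp ?c (1 + bcost ?t + 400 * sz) (\<lambda>s'. (\<exists>evs. loop_inv s' evs) \<and> ?f s' < ?f s) s"
    proof (rule wp_Cond)
      assume "bval ?t s"
      then have d: "iarr s ''d'' (iarr s ''v'' 0) = 1" by simp
      show "wp (Seq unlink (Seq eliminate (Assign ''v'' (Var ''p'')))) (400 * sz) (\<lambda>s'. (\<exists>evs. loop_inv s' evs) \<and> ?f s' < ?f s) s"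
      proof (rule wp_mono[OF wp_eliminate_leaf[OF inv lt d] order_refl])
        fix s' assume "\<exists>e. loop_inv s' (e # evs) \<and> iarr s' ''i'' = iarr s ''i''"
        then obtain e where e: "loop_inv s' (e # evs)" "iarr s' ''i'' = iarr s ''i''" by blast
        have "iarr s ''c'' 0 = length evs" "iarr s' ''c'' 0 = Suc (length evs)" "Suc (length evs) \<le> m"
          using inv e(1) dp_length[of s evs] dp_length[of s' "e # evs"] elimination_length[of "e # evs"]
            dpD(2)[of s' "e # evs"] by (auto simp: loop_inv_def)
        then show "(\<exists>evs. loop_inv s' evs) \<and> ?f s' < ?f s" using e by auto
      qed
    next
      assume "\<not> bval ?t s"
      then have d: "iarr s ''d'' (iarr s ''v'' 0) \<noteq> 1" by auto
      show "wp advance (400 * sz) (\<lambda>s'. (\<exists>evs. loop_inv s' evs) \<and> ?f s' < ?f s) s"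
        using lt by (intro wp_mono[OF wp_advance[OF inv lt d]]) (auto simp: sz_def)
    qed
  next
    fix s assume "\<exists>evs. loop_inv s evs" and b: "\<not> bval ?b s"
    then show "?Q s" by (auto simp: loop_inv_def tables_ok_def)
  qed
  then show ?thesis
  proof (rule wp_mono)
    have "1 + bcost ?b + (1 + bcost ?t + 400 * sz) \<le> 500 * sz" by (simp add: sz_def)
    moreover have "?f s \<le> 2 * m" by simp
    ultimately have "?f s * (1 + bcost ?b + (1 + bcost ?t + 400 * sz)) \<le> 2 * m * (500 * sz)"
      by (intro mult_le_mono)
    then show "1 + bcost ?b + ?f s * (1 + bcost ?b + (1 + bcost ?t + 400 * sz)) \<le> 10 + 2 * m * (500 * sz)"
      by simp
  qed
qed

lemma wp_eliminate_root:
  assumes inv: "loop_inv s evs" and i: "iarr s ''i'' 0 = m"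
  shows "wp eliminate_root (400 * sz) (\<lambda>s'. \<exists>evs. dp s' evs \<and> remaining evs = {m} \<and>
    max_weight_independent_set G w (sol evs (argm s') m 0)) s"
proof -
  define r where "r = iarr s ''r'' 0"
  have E: "elimination evs" "edges_ok evs" "m \<notin> snd ` set evs" and r: "r \<in> remaining evs" "r < m"
    and deg: "deg_inv (iarr s ''d'') (iarr s ''s'') evs" and tables_ok: "tables_ok s" and dp: "dp s evs"
    using inv dpD(2) by (auto simp: loop_inv_def r_def)
  \<comment> \<open>At \<open>i = m\<close> also \<open>v = m\<close>, so the exception made for
    \<open>v\<close> in \<open>loop_inv\<close> no longer concerns a real node.\<close>
  have "card (nbs evs t) \<noteq> 1" if "t < m" "t \<in> remaining evs" for t
  proof -
    have "iarr s ''d'' t \<noteq> 1" using inv i that(1) unfolding loop_inv_def by simp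
    then show ?thesis using deg that unfolding deg_inv_def by simp
  qed
  note fin = remaining_final[OF E this r]
  have elim: "elimination ((r, m) # evs)" using E r fin by (intro elimination.Cons) auto
  let ?b = "Seq (Assign ''v'' (Var ''r'')) (Assign ''p'' (Var ''m''))"
  have b: "wp ?b (cost ?b) (\<lambda>s'. iarr s' ''v'' 0 = r \<and> iarr s' ''p'' 0 = m) s"
    using tables_ok by (intro wp_loopfree) (auto simp: r_def tables_ok_def)
  have "wp eliminate_root (cost ?b + 350 * sz) (\<lambda>s'. dp s' ((r, m) # evs)) s"
    unfolding eliminate_root_def
  proof (rule wp_Seq_frame[OF b])
    fix s1 assume s1: "iarr s1 ''v'' 0 = r \<and> iarr s1 ''p'' 0 = m" and same: "same (iw ?b) (qw ?b) s s1"
    have sta1: "tables_ok s1" by (rule tables_ok_same[OF tables_ok same]) (auto simp: table_names_def)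
    have dp1: "dp s1 evs" by (rule dp_cong[OF dp]) (use same in \<open>auto simp: same_def\<close>)
    show "wp eliminate (350 * sz) (\<lambda>s'. dp s' ((r, m) # evs)) s1"
      using wp_eliminate[OF sta1 dp1 _ _ elim separated_final[OF E(1,3)]] s1 by blast
  qed
  then show ?thesis
  proof (rule wp_mono)
    show "cost ?b + 350 * sz \<le> 400 * sz" by (simp add: sz_def)
    fix s' assume dp': "dp s' ((r, m) # evs)"
    have "remaining ((r, m) # evs) = {m}" using fin(1) r by (auto simp: remaining_Cons)
    moreover have "max_weight_independent_set G w (sol ((r, m) # evs) (argm s') m 0)"
      by (rule opt_final[OF dpD(3)[OF dp'] elim fin(2)])
    ultimately show "\<exists>evs. dp s' evs \<and> remaining evs = {m} \<and>
      max_weight_independent_set G w (sol evs (argm s') m 0)" using dp' by blast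
  qed
qed

section \<open>Traceback of an optimal set\<close>

definition outset :: "state \<Rightarrow> nat set" where
  "outset s = {x. iarr s ''out'' x = 1}"

text \<open>After \<open>y\<close> rounds the quotient is below \<open>B ^ (k - y)\<close>, so
  \<open>k\<close> rounds exhaust all digits.\<close>

lemma wp_emit:
  assumes tables_ok: "tables_ok s" and j: "iarr s ''j'' 0 = i" "i < N"
  shows "wp (emit k) (12 + k * 50) (\<lambda>s'. outset s' = outset s \<union> st i) s"
proof -
  let ?b = "Seq (Cond (Pos (IGet ''R'' (Var ''j''))) (IAssign ''out'' (IMinus (IGet ''R'' (Var ''j'')) (IConst 1)) (IConst 1)) Skip)
      (Assign ''j'' (IGet ''D'' (Var ''j'')))"
  let ?I = "\<lambda>y s'. iarr s' ''j'' 0 < N \<and> iarr s' ''j'' 0 < B ^ (k - y) \<and>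
    outset s' \<union> st (iarr s' ''j'' 0) = outset s \<union> st i"
  have "wp (emit k) (12 + k * (cost ?b + 15)) (\<lambda>s'. outset s' = outset s \<union> st i) s"
    unfolding emit_def
  proof (rule wp_For_loopfree[where I = ?I])
    show "?I 0 (iupd ''y'' 0 0 s)" using j by (simp add: N_def outset_def)
  next
    fix y s' assume y: "y < k" and same: "same (insert ''y'' (iw ?b)) (qw ?b) s s'"
      and "iarr s' ''y'' 0 = y" and I: "?I y s'"
    have tables_ok': "tables_ok s'" by (rule tables_ok_same[OF tables_ok same]) (auto simp: table_names_def)
    define q where "q = iarr s' ''j'' 0"
    have q: "q < N" "q < B * B ^ (k - Suc y)" "outset s' \<union> st q = outset s \<union> st i"
      using I y by (auto simp: q_def Suc_diff_Suc simp flip: power_Suc)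
    have RD: "iarr s' ''R'' q = q mod B" "iarr s' ''D'' q = q div B"
      using tables_ok' q by (auto simp: tables_ok_def)
    let ?s = "iupd ''y'' 0 (Suc y) (sem ?b s')"
    have j': "iarr ?s ''j'' 0 = q div B" using RD by (simp flip: q_def)
    have out: "outset ?s = outset s' \<union> dset (q mod B)"
      using RD by (auto simp: outset_def dset_def simp flip: q_def)
    have "q div B < B ^ (k - Suc y)" using q(2) by (simp add: less_mult_imp_div_less mult.commute)
    moreover have "q div B < N" using div_B_less_N q by simp
    ultimately show "?I (Suc y) ?s" unfolding j' out using q(3) st_rec[of q] by auto
  next
    fix s' assume "?I k s'"
    then show "outset s' = outset s \<union> st i" by auto
  qed auto
  then show ?thesis by (rule wp_mono) auto
qed

text \<open>\<open>J\<close> is the set that the choices so far represent, while \<open>out\<close>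
  collects the vertices of their codes; once the stack is empty, \<open>sol\<close> is
  \<open>st\<close> and the two coincide. The bound on \<open>a\<close> can range over all nodes
  because untouched cells are 0.\<close>

definition tr_inv :: "(nat \<Rightarrow> nat \<Rightarrow> nat) \<Rightarrow> nat set \<Rightarrow> state \<Rightarrow> (nat \<times> nat) list \<Rightarrow> bool" where
  "tr_inv arg J s evs \<longleftrightarrow> tables_ok s \<and> evs = stk s \<and> elimination evs \<and> argm s = arg \<and>
     (\<forall>u\<in>fst ` set evs. \<forall>r. arg u r < N) \<and> (\<forall>t. iarr s ''a'' t < N) \<and>
     (\<Union>t\<in>remaining evs. sol evs arg t (iarr s ''a'' t)) = J \<and>
     outset s = (\<Union>t\<in>remaining evs. st (iarr s ''a'' t))"

lemma wp_traceback_body: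
  assumes inv: "tr_inv arg J s evs" and c: "0 < iarr s ''c'' 0"
  shows "wp (Seq pop (Seq (restrict_code ''v'' ''K'' ''V'') (Seq decide (emit k)))) (100 * sz + k * 50)
    (\<lambda>s'. (\<exists>evs. tr_inv arg J s' evs) \<and> iarr s' ''c'' 0 < iarr s ''c'' 0) s"
proof -
  define v where "v = iarr (sem pop s) ''v'' 0"
  define p where "p = iarr (sem pop s) ''p'' 0"
  define evs' where "evs' = stk (sem pop s)"
  note I = inv[unfolded tr_inv_def]
  have evs: "evs = (v, p) # evs'" using stk_pop[OF c] I unfolding v_def p_def evs'_def by simp
  have elim: "elimination ((v, p) # evs')" using I unfolding evs by blast
  then have E: "elimination evs'" "v \<le> m" "v \<in> remaining evs'" by (auto elim: elimination_ConsE)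
  have I': "\<And>r. arg v r < N" "\<And>u r. u \<in> fst ` set evs' \<Longrightarrow> arg u r < N"
    "(\<Union>t\<in>remaining ((v, p) # evs'). sol ((v, p) # evs') arg t (iarr s ''a'' t)) = J"
    "outset s = (\<Union>t\<in>remaining ((v, p) # evs'). st (iarr s ''a'' t))"
    "argm s = arg" "\<And>t. iarr s ''a'' t < N"
    using I unfolding evs by (auto simp del: sol.simps)
  have tables_ok: "tables_ok s" using inv by (simp add: tr_inv_def)
  define a where "a = iarr s ''a''"
  have pop: "wp pop (cost pop) (\<lambda>s'. s' = sem pop s) s"
    by (intro wp_loopfree) (auto simp: pop_def)
  let ?Q = "\<lambda>s'. (\<exists>evs. tr_inv arg J s' evs) \<and> iarr s' ''c'' 0 < iarr s ''c'' 0"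
  have "wp (Seq pop (Seq (restrict_code ''v'' ''K'' ''V'') (Seq decide (emit k))))
    (cost pop + (40 * sz + (cost decide + (12 + k * 50)))) ?Q s"
  proof (rule wp_Seq_frame[OF pop])
    fix s1 assume s1: "s1 = sem pop s" and same1: "same (iw pop) (qw pop) s s1"
    have sta1: "tables_ok s1" by (rule tables_ok_same[OF tables_ok same1]) (auto simp: table_names_def)
    have v1: "iarr s1 ''v'' 0 = v" "iarr s1 ''p'' 0 = p" "stk s1 = evs'" "iarr s1 ''c'' 0 < iarr s ''c'' 0"
      using s1 c by (simp_all add: v_def p_def evs'_def) (simp add: pop_def)
    \<comment> \<open>The restriction to \<open>bag v\<close> is recomputed instead of being kept
      from the elimination phase; this fits the time allowed per node.\<close>
    show "wp (Seq (restrict_code ''v'' ''K'' ''V'') (Seq decide (emit k))) (40 * sz + (cost decide + (12 + k * 50))) ?Q s1"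
    proof (rule wp_Seq_frame[OF wp_restrict_code], rule sta1, rule v1(1), rule E(2))
      fix s2 assume V: "\<forall>i<N. iarr s2 ''V'' i = rst (bag v) i"
        and same2: "same (iw (restrict_code ''v'' ''K'' ''V'')) (qw (restrict_code ''v'' ''K'' ''V'')) s1 s2"
      have sta2: "tables_ok s2" by (rule tables_ok_same[OF sta1 same2]) (auto simp: table_names_def)
      have a2: "iarr s2 ''a'' = a" "iarr s2 ''v'' 0 = v" "iarr s2 ''p'' 0 = p" "iarr s2 ''A'' = iarr s ''A''"
        using same1 same2 v1 by (auto simp: same_def a_def)
      have ap: "a p < N" using inv by (simp add: tr_inv_def a_def)
      have O: "iarr s2 ''O'' v = v * N" using sta2 E(2) by (simp add: tables_ok_def)
      have argA: "arg v (rst (bag v) (a p)) = iarr s ''A'' (v * N + rst (bag v) (a p))"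
        using I'(5) rst_less[OF ap] by (auto simp: argm_def)
      define i where "i = arg v (rst (bag v) (a p))"
      have iN: "i < N" using I' by (simp add: i_def)
      have decide: "wp decide (cost decide) (\<lambda>s'. iarr s' ''a'' = a(v := i) \<and> iarr s' ''j'' 0 = i) s2"
        using V ap by (intro wp_loopfree) (auto simp: decide_def a2 O argA i_def)
      show "wp (Seq decide (emit k)) (cost decide + (12 + k * 50)) ?Q s2"
      proof (rule wp_Seq_frame[OF decide])
        fix s3 assume s3: "iarr s3 ''a'' = a(v := i) \<and> iarr s3 ''j'' 0 = i"
          and same3: "same (iw decide) (qw decide) s2 s3"
        have sta3: "tables_ok s3" by (rule tables_ok_same[OF sta2 same3]) (auto simp: table_names_def)
        show "wp (emit k) (12 + k * 50) ?Q s3"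
        proof (rule wp_mono[OF wp_frame[OF wp_emit[OF sta3 _ iN]] order_refl])
          show "iarr s3 ''j'' 0 = i" using s3 by simp
          fix s4 assume s4: "outset s4 = outset s3 \<union> st i \<and> same (iw (emit k)) (qw (emit k)) s3 s4"
          have sta4: "tables_ok s4" by (rule tables_ok_same[OF sta3 conjunct2[OF s4]]) (auto simp: table_names_def)
          have eqs: "iarr s4 ''a'' = a(v := i)" "iarr s4 ''c'' = iarr s1 ''c''" "iarr s4 ''A'' = iarr s ''A''"
            "iarr s4 ''S'' = iarr s1 ''S''" "iarr s4 ''Q'' = iarr s1 ''Q''" "iarr s3 ''out'' = iarr s ''out''"
            using s3 s4 same1 same2 same3 by (auto simp: same_def)
          have "stk s4 = evs'" using stk_cong[of s4 s1] eqs v1 by simp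
          moreover have "argm s4 = arg"
          proof -
            have "argm s4 = argm s" by (intro ext) (simp add: argm_def eqs(3))
            then show ?thesis using I'(5) by simp
          qed
          moreover have "outset s4 = (\<Union>t\<in>remaining evs'. st ((a(v := i)) t))"
          proof -
            have "outset s3 = outset s" using eqs by (simp add: outset_def)
            then have out: "outset s4 = (\<Union>t\<in>remaining evs' - {v}. st (a t)) \<union> st i"
              using I'(4) s4 by (simp add: a_def remaining_Cons)
            have "(\<Union>t\<in>remaining evs'. st ((a(v := i)) t)) = (\<Union>t\<in>remaining evs' - {v}. st (a t)) \<union> st i"
              using E(3) by (auto split: if_splits)
            then show ?thesis using out by simp
          qed
          moreover have "(\<Union>t\<in>remaining evs'. sol evs' arg t ((a(v := i)) t)) = J"
            using traceback_step[OF elim, of "a(v := i)" a arg] I'(3) by (simp add: i_def a_def del: sol.simps)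
          ultimately have "tr_inv arg J s4 evs'"
            using sta4 E(1) I'(2,6) iN eqs(1) unfolding tr_inv_def by (simp add: a_def)
          then show "?Q s4" using eqs v1 by auto
        qed
      qed
    qed simp
  qed
  then show ?thesis by (rule wp_mono) (auto simp: sz_def pop_def decide_def)
qed

lemma wp_traceback:
  assumes dp: "dp s evs" and rem: "remaining evs = {m}" and tables_ok: "tables_ok s"
    and zero: "iarr s ''a'' = (\<lambda>_. 0)" "iarr s ''out'' = (\<lambda>_. 0)"
  shows "wp (traceback k) (10 + m * (200 * sz + k * 50)) (\<lambda>s'. outset s' = sol evs (argm s) m 0) s"
proof -
  let ?J = "sol evs (argm s) m 0"
  let ?b = "Pos (Var ''c'')"
  have "wp (traceback k) (1 + bcost ?b + iarr s ''c'' 0 * (1 + bcost ?b + (100 * sz + k * 50))) (\<lambda>s'. outset s' = ?J) s"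
    unfolding traceback_def
  proof (rule wp_While[where I = "\<lambda>s'. \<exists>evs. tr_inv (argm s) ?J s' evs" and f = "\<lambda>s. iarr s ''c'' 0"])
    have "tr_inv (argm s) ?J s evs"
      using dpD[OF dp] tables_ok N_pos unfolding tr_inv_def zero rem by (simp add: outset_def zero)
    then show "\<exists>evs. tr_inv (argm s) ?J s evs" by blast
  next
    fix s' assume "\<exists>evs. tr_inv (argm s) ?J s' evs" "bval ?b s'"
    then show "wp (Seq pop (Seq (restrict_code ''v'' ''K'' ''V'') (Seq decide (emit k)))) (100 * sz + k * 50)
      (\<lambda>s''. (\<exists>evs. tr_inv (argm s) ?J s'' evs) \<and> iarr s'' ''c'' 0 < iarr s' ''c'' 0) s'"
      using wp_traceback_body by auto
  next
    fix s' assume "\<exists>evs. tr_inv (argm s) ?J s' evs" "\<not> bval ?b s'"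
    then obtain evs' where I: "tr_inv (argm s) ?J s' evs'" and "iarr s' ''c'' 0 = 0" by auto
    then have "evs' = []" by (simp add: tr_inv_def stk_def)
    then show "outset s' = ?J" using I by (simp add: tr_inv_def)
  qed
  then show ?thesis
  proof (rule wp_mono)
    have "iarr s ''c'' 0 \<le> m" using dp_length[OF dp] elimination_length[OF dpD(2)[OF dp]] by simp
    moreover have "1 + bcost ?b + (100 * sz + k * 50) \<le> 200 * sz + k * 50" by (simp add: sz_def)
    ultimately have "iarr s ''c'' 0 * (1 + bcost ?b + (100 * sz + k * 50)) \<le> m * (200 * sz + k * 50)"
      by (rule mult_le_mono)
    then show "1 + bcost ?b + iarr s ''c'' 0 * (1 + bcost ?b + (100 * sz + k * 50)) \<le> 10 + m * (200 * sz + k * 50)"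
      by simp
  qed
qed

end


section \<open>Initial tables\<close>

definition constants :: com where
  "constants = Seq (Assign ''B'' (Inc (Var ''n''))) (Assign ''N'' (IConst 1))"

definition num_codes :: "nat \<Rightarrow> com" where
  "num_codes k = For ''y'' (IConst k) (Seq (Assign ''z'' (IConst 0))
    (Seq (For ''x'' (Var ''B'') (Assign ''z'' (IPlus (Var ''z'') (Var ''N'')))) (Assign ''N'' (Var ''z''))))"

definition mult_table :: com where
  "mult_table = For ''x'' (Var ''N'') (IAssign ''M'' (Inc (Var ''x'')) (IPlus (IGet ''M'' (Var ''x'')) (Var ''B'')))"

definition div_table :: com where
  "div_table = For ''x'' (Var ''N'') (Cond (ILess (Inc (IGet ''R'' (Var ''x''))) (Var ''B''))
    (Seq (IAssign ''R'' (Inc (Var ''x'')) (Inc (IGet ''R'' (Var ''x'')))) (IAssign ''D'' (Inc (Var ''x'')) (IGet ''D'' (Var ''x''))))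
    (Seq (IAssign ''R'' (Inc (Var ''x'')) (IConst 0)) (IAssign ''D'' (Inc (Var ''x'')) (Inc (IGet ''D'' (Var ''x''))))))"

text \<open>Multiples of \<open>n\<close> are row offsets both of the adjacency matrix (rows below
  \<open>n\<close>) and of the bag matrix (nodes up to \<open>m\<close>), hence the length
  \<open>n + m\<close>.\<close>

definition row_table :: com where
  "row_table = For ''x'' (IPlus (Var ''n'') (Var ''m''))
    (IAssign ''W'' (Inc (Var ''x'')) (IPlus (IGet ''W'' (Var ''x'')) (Var ''n'')))"

definition offset_table :: com where
  "offset_table = For ''x'' (Var ''m'')
    (IAssign ''O'' (Inc (Var ''x'')) (IPlus (IGet ''O'' (Var ''x'')) (Var ''N'')))"

definition weight_table :: com where
  "weight_table = For ''x'' (Var ''N'') (Cond (Pos (IGet ''R'' (Var ''x'')))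
    (QAssign ''W'' (Var ''x'') (QPlus (QGet ''W'' (IGet ''D'' (Var ''x''))) (QGet ''weight'' (IMinus (IGet ''R'' (Var ''x'')) (IConst 1)))))
    (QAssign ''W'' (Var ''x'') (QGet ''W'' (IGet ''D'' (Var ''x'')))))"

text \<open>A tuple with at least two digits is valid iff the two tuples obtained by dropping its first or
  its second digit are valid and the first two digits do not conflict.\<close>

definition invalid_test :: bexp where
  "invalid_test = BAnd (Pos (IGet ''D'' (Var ''x'')))
    (BOr (Pos (IPlus (IGet ''I'' (IGet ''D'' (Var ''x'')))
           (IGet ''I'' (IPlus (IGet ''M'' (IGet ''D'' (IGet ''D'' (Var ''x'')))) (IGet ''R'' (Var ''x''))))))
      (BAnd (Pos (IGet ''R'' (Var ''x''))) (BAnd (Pos (IGet ''R'' (IGet ''D'' (Var ''x''))))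
        (BOr (IEq (IGet ''R'' (Var ''x'')) (IGet ''R'' (IGet ''D'' (Var ''x''))))
          (Pos (IGet ''adj'' (IPlus (IGet ''W'' (IMinus (IGet ''R'' (Var ''x'')) (IConst 1)))
             (IMinus (IGet ''R'' (IGet ''D'' (Var ''x''))) (IConst 1)))))))))"

definition valid_table :: com where
  "valid_table = For ''x'' (Var ''N'')
    (Cond invalid_test (IAssign ''I'' (Var ''x'') (IConst 1)) (IAssign ''I'' (Var ''x'') (IConst 0)))"

definition degrees :: com where
  "degrees = For ''x'' (Var ''num_edges'')
    (Seq (Seq (IAssign ''d'' (IGet ''src'' (Var ''x'')) (Inc (IGet ''d'' (IGet ''src'' (Var ''x'')))))
      (IAssign ''d'' (IGet ''dst'' (Var ''x'')) (Inc (IGet ''d'' (IGet ''dst'' (Var ''x''))))))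
    (Seq (IAssign ''s'' (IGet ''src'' (Var ''x'')) (IPlus (IGet ''s'' (IGet ''src'' (Var ''x''))) (IGet ''dst'' (Var ''x''))))
      (IAssign ''s'' (IGet ''dst'' (Var ''x'')) (IPlus (IGet ''s'' (IGet ''dst'' (Var ''x''))) (IGet ''src'' (Var ''x''))))))"

definition setup_tables :: "nat \<Rightarrow> com" where
  "setup_tables k = Seq constants (Seq (num_codes k) (Seq mult_table (Seq div_table (Seq row_table
     (Seq offset_table (Seq weight_table valid_table))))))"

lemma iw_setup_parts [simp]:
  "iw constants = {''B'', ''N''}" "qw constants = {}"
  "iw (num_codes k) = {''y'', ''z'', ''x'', ''N''}" "qw (num_codes k) = {}"
  "iw mult_table = {''x'', ''M''}" "qw mult_table = {}"
  "iw div_table = {''x'', ''R'', ''D''}" "qw div_table = {}"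
  "iw row_table = {''x'', ''W''}" "qw row_table = {}"
  "iw offset_table = {''x'', ''O''}" "qw offset_table = {}"
  "iw weight_table = {''x''}" "qw weight_table = {''W''}"
  "iw valid_table = {''x'', ''I''}" "qw valid_table = {}"
  "iw degrees = {''x'', ''d'', ''s''}" "qw degrees = {}"
  by (auto simp: constants_def num_codes_def mult_table_def div_table_def row_table_def offset_table_def
      weight_table_def valid_table_def degrees_def)

lemma iw_setup_tables [simp]:
  "iw (setup_tables k) = {''B'', ''N'', ''y'', ''z'', ''x'', ''M'', ''R'', ''D'', ''W'', ''O'', ''I''}"
  "qw (setup_tables k) = {''W''}"
  by (auto simp: setup_tables_def)

lemma wp_arith_table:
  assumes "x \<noteq> ''x''" "y \<noteq> ''x''" "y \<noteq> x" "icost hi \<le> 5" "iarr s x 0 = 0" "iarr s y 0 = b"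
    "\<And>s'. same {''x'', x} {} s s' \<Longrightarrow> ival hi s' = l"
  shows "wp (For ''x'' hi (IAssign x (Inc (Var ''x'')) (IPlus (IGet x (Var ''x'')) (Var y)))) (12 + l * 50)
    (\<lambda>s'. \<forall>i\<le>l. iarr s' x i = i * b) s"
proof -
  let ?b = "IAssign x (Inc (Var ''x'')) (IPlus (IGet x (Var ''x'')) (Var y))"
  have "wp (For ''x'' hi ?b) (12 + l * (cost ?b + 15)) (\<lambda>s'. \<forall>i\<le>l. iarr s' x i = i * b) s"
  proof (rule wp_For_loopfree[where I = "\<lambda>i s'. \<forall>j\<le>i. iarr s' x j = j * b"])
    fix i s' assume "i < l" and same: "same (insert ''x'' (iw ?b)) (qw ?b) s s'"
      and x: "iarr s' ''x'' 0 = i" and I: "\<forall>j\<le>i. iarr s' x j = j * b"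
    have "iarr s' y 0 = b" using same assms by (simp add: same_def)
    then show "\<forall>j\<le>Suc i. iarr (iupd ''x'' 0 (Suc i) (sem ?b s')) x j = j * b"
      using I x assms(1) by (auto simp: le_Suc_eq)
  qed (use assms in auto)
  then show ?thesis by (rule wp_mono) auto
qed

context bounded_td
begin

lemma wp_constants:
  assumes "iarr s ''n'' 0 = n"
  shows "wp constants 20 (\<lambda>s'. iarr s' ''B'' 0 = B \<and> iarr s' ''N'' 0 = 1) s"
proof -
  have "wp constants (cost constants) (\<lambda>s'. iarr s' ''B'' 0 = B \<and> iarr s' ''N'' 0 = 1) s"
    using assms by (intro wp_loopfree) (auto simp: constants_def B_def)
  then show ?thesis by (rule wp_mono) (auto simp: constants_def)
qed

lemma wp_num_codes:
  assumes B: "iarr s ''B'' 0 = B" and N: "iarr s ''N'' 0 = 1"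
  shows "wp (num_codes k) (12 + k * (100 * B)) (\<lambda>s'. iarr s' ''N'' 0 = N) s"
proof -
  let ?z0 = "Assign ''z'' (IConst 0)" and ?b = "Assign ''z'' (IPlus (Var ''z'') (Var ''N''))" and ?z1 = "Assign ''N'' (Var ''z'')"
  let ?f = "For ''x'' (Var ''B'') ?b"
  let ?c = "Seq ?z0 (Seq ?f ?z1)"
  let ?t = "cost ?z0 + ((12 + B * (cost ?b + 15)) + cost ?z1)"
  have "wp (num_codes k) (12 + k * (?t + 15)) (\<lambda>s'. iarr s' ''N'' 0 = N) s"
    unfolding num_codes_def
  proof (rule wp_For[where I = "\<lambda>y s'. iarr s' ''N'' 0 = B ^ y"])
    fix y s' assume "y < k" and same: "same (insert ''y'' (iw ?c)) (qw ?c) s s'"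
      and "iarr s' ''y'' 0 = y" and I: "iarr s' ''N'' 0 = B ^ y"
    have B': "iarr s' ''B'' 0 = B" using same B by (simp add: same_def)
    let ?Q = "\<lambda>s''. iarr (iupd ''y'' 0 (Suc y) s'') ''N'' 0 = B ^ Suc y"
    have z0: "wp ?z0 (cost ?z0) (\<lambda>s1. iarr s1 ''z'' 0 = 0) s'" by (intro wp_loopfree) auto
    show "wp ?c ?t ?Q s'"
    proof (rule wp_Seq_frame[OF z0])
      fix s1 assume s1: "iarr s1 ''z'' 0 = 0" "same (iw ?z0) (qw ?z0) s' s1"
      have eqs: "iarr s1 ''B'' 0 = B" "iarr s1 ''N'' 0 = B ^ y" using s1 B' I by (auto simp: same_def)
      have f: "wp ?f (12 + B * (cost ?b + 15)) (\<lambda>s2. iarr s2 ''z'' 0 = B * B ^ y) s1"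
      proof (rule wp_For_loopfree[where I = "\<lambda>x s2. iarr s2 ''z'' 0 = x * B ^ y"])
        fix s2 assume "same (insert ''x'' (iw ?b)) (qw ?b) s1 s2"
        then show "ival (Var ''B'') s2 = B" using eqs by (simp add: same_def)
      next
        fix x s2 assume "same (insert ''x'' (iw ?b)) (qw ?b) s1 s2" "iarr s2 ''z'' 0 = x * B ^ y"
        then show "iarr (iupd ''x'' 0 (Suc x) (sem ?b s2)) ''z'' 0 = Suc x * B ^ y"
          using eqs by (simp add: same_def)
      qed (use s1 in auto)
      show "wp (Seq ?f ?z1) ((12 + B * (cost ?b + 15)) + cost ?z1) ?Q s1"
      proof (rule wp_Seq_frame[OF f])
        fix s2 :: state assume "iarr s2 ''z'' 0 = B * B ^ y"
        then show "wp ?z1 (cost ?z1) ?Q s2" by (intro wp_loopfree) simp_all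
      qed
    qed
  qed (use N in \<open>auto simp: N_def\<close>)
  then show ?thesis
  proof (rule wp_mono)
    have "?t + 15 \<le> 100 * B" using B_pos by simp
    then show "12 + k * (?t + 15) \<le> 12 + k * (100 * B)" by (intro add_left_mono mult_le_mono2)
  qed
qed

lemma wp_div_table:
  assumes N: "iarr s ''N'' 0 = N" and B: "iarr s ''B'' 0 = B" and z: "iarr s ''D'' 0 = 0" "iarr s ''R'' 0 = 0"
  shows "wp div_table (100 * sz) (\<lambda>s'. \<forall>i<N. iarr s' ''D'' i = i div B \<and> iarr s' ''R'' i = i mod B) s"
proof -
  let ?b = "Cond (ILess (Inc (IGet ''R'' (Var ''x''))) (Var ''B''))
    (Seq (IAssign ''R'' (Inc (Var ''x'')) (Inc (IGet ''R'' (Var ''x'')))) (IAssign ''D'' (Inc (Var ''x'')) (IGet ''D'' (Var ''x''))))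
    (Seq (IAssign ''R'' (Inc (Var ''x'')) (IConst 0)) (IAssign ''D'' (Inc (Var ''x'')) (Inc (IGet ''D'' (Var ''x'')))))"
  let ?I = "\<lambda>i s'. \<forall>j\<le>i. iarr s' ''D'' j = j div B \<and> iarr s' ''R'' j = j mod B"
  have "wp div_table (12 + N * (cost ?b + 15)) (\<lambda>s'. \<forall>i<N. iarr s' ''D'' i = i div B \<and> iarr s' ''R'' i = i mod B) s"
    unfolding div_table_def
  proof (rule wp_For_loopfree[where I = ?I])
    fix s' assume "same (insert ''x'' (iw ?b)) (qw ?b) s s'"
    then show "ival (Var ''N'') s' = N" using N by (simp add: same_def)
  next
    fix i s' assume same: "same (insert ''x'' (iw ?b)) (qw ?b) s s'" and x: "iarr s' ''x'' 0 = i" and I: "?I i s'"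
    have B': "iarr s' ''B'' 0 = B" using same B by (simp add: same_def)
    have "Suc i mod B = (if Suc (i mod B) < B then Suc (i mod B) else 0)"
      "Suc i div B = (if Suc (i mod B) < B then i div B else Suc (i div B))"
      using mod_Suc[of i B] div_Suc[of i B] mod_less_divisor[OF B_pos, of i] by (auto simp: mod_eq_0_iff_dvd split: if_splits)
    then show "?I (Suc i) (iupd ''x'' 0 (Suc i) (sem ?b s'))"
      using I by (simp add: x B' le_Suc_eq)
  qed (use z in auto)
  then show ?thesis by (rule wp_mono) (auto simp: sz_def)
qed

lemma wp_weight_table:
  assumes N: "iarr s ''N'' 0 = N" and z: "qarr s ''W'' 0 = 0"
    and dm: "\<forall>i<N. iarr s ''D'' i = i div B \<and> iarr s ''R'' i = i mod B"
    and wt: "\<forall>x<n. qarr s ''weight'' x = w x"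
  shows "wp weight_table (100 * sz) (\<lambda>s'. \<forall>i<N. qarr s' ''W'' i = wts i) s"
proof -
  let ?b = "Cond (Pos (IGet ''R'' (Var ''x'')))
    (QAssign ''W'' (Var ''x'') (QPlus (QGet ''W'' (IGet ''D'' (Var ''x''))) (QGet ''weight'' (IMinus (IGet ''R'' (Var ''x'')) (IConst 1)))))
    (QAssign ''W'' (Var ''x'') (QGet ''W'' (IGet ''D'' (Var ''x''))))"
  let ?I = "\<lambda>i s'. qarr s' ''W'' 0 = 0 \<and> (\<forall>j<i. qarr s' ''W'' j = wts j)"
  have "wp weight_table (12 + N * (cost ?b + 15)) (\<lambda>s'. \<forall>i<N. qarr s' ''W'' i = wts i) s"
    unfolding weight_table_def
  proof (rule wp_For_loopfree[where I = ?I])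
    fix s' assume "same (insert ''x'' (iw ?b)) (qw ?b) s s'"
    then show "ival (Var ''N'') s' = N" using N by (simp add: same_def)
  next
    fix i s' assume i: "i < N" and same: "same (insert ''x'' (iw ?b)) (qw ?b) s s'"
      and x: "iarr s' ''x'' 0 = i" and I: "?I i s'"
    have eqs: "iarr s' ''D'' i = i div B" "iarr s' ''R'' i = i mod B" "qarr s' ''weight'' = qarr s ''weight''"
      using same dm i by (auto simp: same_def)
    have W: "qarr s' ''W'' (i div B) = wts (i div B)"
      using I div_B_less[of i] i by (cases "i = 0") auto
    have wt': "qarr s ''weight'' (i mod B - Suc 0) = w (i mod B - 1)" if "0 < i mod B"
      using wt mod_B_le[of i] that by simp
    have "qarr (iupd ''x'' 0 (Suc i) (sem ?b s')) ''W'' = (qarr s' ''W'')(i := wts i)"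
      using wts_rec[of i] wt' by (auto simp: x eqs W)
    moreover have "i = 0 \<Longrightarrow> wts i = 0" by simp
    ultimately show "?I (Suc i) (iupd ''x'' 0 (Suc i) (sem ?b s'))"
      using I by (auto simp: less_Suc_eq simp del: sem.simps)
  qed (use z in auto)
  then show ?thesis by (rule wp_mono) (auto simp: sz_def)
qed

text \<open>Conflicts of the first digit are with the second digit or with the rest, and the latter
  are recorded in the validity of the tuple without its second digit. A constant number of look-ups
  thus replaces a scan of the tuple.\<close>

lemma vld_two_digits:
  assumes "0 < i div B"
  shows "\<not> vld i \<longleftrightarrow> \<not> vld (i div B) \<or> \<not> vld (i div B div B * B + i mod B) \<or>
    0 < i mod B \<and> 0 < i div B mod B \<and>
      (i mod B = i div B mod B \<or> {i mod B - 1, i div B mod B - 1} \<in> edges G)"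
proof -
  define d q e q' where "d = i mod B" and "q = i div B" and "e = q mod B" and "q' = q div B"
  let ?free = "\<lambda>d S. \<forall>x\<in>dset d. \<forall>y\<in>S. x \<noteq> y \<and> {x, y} \<notin> edges G"
  have "d < B" using B_pos by (simp add: d_def)
  then have j: "vld (q' * B + d) \<longleftrightarrow> vld q' \<and> ?free d (st q')"
    using vld_rec[of "q' * B + d"] code_split[of d q'] by simp
  have i: "vld i \<longleftrightarrow> vld q \<and> ?free d (dset e \<union> st q')"
    using vld_rec[of i] st_rec[of q] by (simp add: d_def q_def e_def q'_def)
  have q: "vld q \<longrightarrow> vld q'" using vld_rec[of q] by (simp add: q'_def)
  have p: "?free d (dset e) \<longleftrightarrow> \<not> (0 < d \<and> 0 < e \<and> (d = e \<or> {d - 1, e - 1} \<in> edges G))"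
    by (cases d; cases e) (auto simp: dset_def)
  have u: "?free d (dset e \<union> st q') \<longleftrightarrow> ?free d (dset e) \<and> ?free d (st q')" by blast
  show ?thesis unfolding i u p d_def[symmetric] q_def[symmetric] e_def[symmetric] q'_def[symmetric] j
    using q by blast
qed

lemma vld_one_digit: "i div B = 0 \<Longrightarrow> vld i"
  using vld_rec[of i] by simp

lemma wp_valid_table:
  assumes N: "iarr s ''N'' 0 = N" and M: "\<forall>i\<le>N. iarr s ''M'' i = i * B"
    and dm: "\<forall>i<N. iarr s ''D'' i = i div B \<and> iarr s ''R'' i = i mod B"
    and W: "\<forall>i<n. iarr s ''W'' i = i * n"
    and adj: "\<forall>u<n. \<forall>v<n. iarr s ''adj'' (u * n + v) = (if {u, v} \<in> edges G then 1 else 0)"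
  shows "wp valid_table (150 * sz) (\<lambda>s'. \<forall>i<N. iarr s' ''I'' i = (if vld i then 0 else 1)) s"
proof -
  let ?b = "Cond invalid_test (IAssign ''I'' (Var ''x'') (IConst 1)) (IAssign ''I'' (Var ''x'') (IConst 0))"
  let ?I = "\<lambda>i s'. \<forall>j<i. iarr s' ''I'' j = (if vld j then 0 else 1)"
  have "wp valid_table (12 + N * (cost ?b + 15)) (?I N) s"
    unfolding valid_table_def
  proof (rule wp_For_loopfree[where I = ?I])
    fix s' assume "same (insert ''x'' (iw ?b)) (qw ?b) s s'"
    then show "ival (Var ''N'') s' = N" using N by (simp add: same_def)
  next
    fix i s' assume i: "i < N" and same: "same (insert ''x'' (iw ?b)) (qw ?b) s s'"
      and x: "iarr s' ''x'' 0 = i" and I: "?I i s'"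
    define d q e q' where "d = i mod B" and "q = i div B" and "e = q mod B" and "q' = q div B"
    have qN: "q < N" "q' < N" using i div_B_less_N by (auto simp: q_def q'_def)
    have eqs: "iarr s' ''D'' i = q" "iarr s' ''R'' i = d" "iarr s' ''D'' q = q'" "iarr s' ''R'' q = e"
      "iarr s' ''M'' q' = q' * B" "iarr s' ''adj'' = iarr s ''adj''" "iarr s' ''W'' = iarr s ''W''"
      using same dm M i qN by (auto simp: same_def d_def q_def e_def q'_def)
    have test: "bval invalid_test s' \<longleftrightarrow> \<not> vld i"
    proof (cases "q = 0")
      case True
      then show ?thesis using vld_one_digit[of i] by (simp add: invalid_test_def x eqs flip: q_def)
    next
      case False
      have "i \<noteq> 0" using False unfolding q_def by (metis div_0)
      then have qi: "q < i" using i div_B_less by (simp add: q_def)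
      have "q' < q" using False qN div_B_less by (simp add: q'_def)
      then have "q' * B < q * B" using B_pos by simp
      \<comment> \<open>Dropping the second digit yields a smaller code, whose entry in
        \<open>I\<close> is already filled.\<close>
      then have ji: "q' * B + d < i" using div_mult_mod_eq[of i B] unfolding d_def q_def by linarith
      have adj': "iarr s ''adj'' (iarr s ''W'' (d - Suc 0) + (e - Suc 0)) = (if {d - 1, e - 1} \<in> edges G then 1 else 0)"
        if "0 < d" "0 < e"
      proof -
        have "d - 1 < n" "e - 1 < n" using that mod_B_le[of i] mod_B_le[of q] by (auto simp: d_def e_def)
        then show ?thesis using W adj by simp
      qed
      have "bval invalid_test s' \<longleftrightarrow> \<not> vld q \<or> \<not> vld (q' * B + d) \<or>
        0 < d \<and> 0 < e \<and> (d = e \<or> {d - 1, e - 1} \<in> edges G)"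
        using I qi ji False adj' by (auto simp: invalid_test_def x eqs split: if_splits)
      then show ?thesis using vld_two_digits[of i] False unfolding d_def q_def e_def q'_def by simp
    qed
    then have "iarr (iupd ''x'' 0 (Suc i) (sem ?b s')) ''I'' = (iarr s' ''I'')(i := if vld i then 0 else 1)"
      by (simp add: x)
    then show "?I (Suc i) (iupd ''x'' 0 (Suc i) (sem ?b s'))"
      using I by (auto simp: less_Suc_eq simp del: sem.simps)
  qed auto
  then show ?thesis by (rule wp_mono) (auto simp: sz_def invalid_test_def)
qed

section \<open>Initial degrees from the edge list\<close>

lemma es_nth:
  assumes "e < length es" "es ! e = (a, b)"
  shows "{a, b} \<in> edges T" "a \<noteq> b" "{a, b} \<notin> set (map (\<lambda>(a, b). {a, b}) (take e es))"
proof -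
  let ?f = "\<lambda>(a, b). {a, b}"
  have nth: "map ?f es ! e = {a, b}" using assms by simp
  then show ab: "{a, b} \<in> edges T" using listing assms(1) unfolding edge_listing_def
    by (metis length_map nth_mem)
  then show "a \<noteq> b" using edges_T_less by blast
  have "distinct (take (Suc e) (map ?f es))" using listing unfolding edge_listing_def by simp
  then show "{a, b} \<notin> set (map ?f (take e es))"
    using assms(1) nth by (simp add: take_Suc_conv_app_nth take_map)
qed

lemma length_es: "length es \<le> m"
proof -
  have "length es = card (edges T)"
    using listing distinct_card[of "map (\<lambda>(a, b). {a, b}) es"] unfolding edge_listing_def by simp
  then show ?thesis using tree_card_edges_le[OF tree_T] by (simp add: m_def)
qed

text \<open>Each edge is listed once, so every neighbour recorded is new and the increments of
  degree and sum are exact; \<open>a \<noteq> b\<close> keeps the updates at the two ends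
  apart.\<close>

lemma wp_degrees:
  assumes len: "iarr s ''num_edges'' 0 = length es"
    and src: "\<forall>e<length es. iarr s ''src'' e = fst (es ! e) \<and> iarr s ''dst'' e = snd (es ! e)"
    and zero: "iarr s ''d'' = (\<lambda>_. 0)" "iarr s ''s'' = (\<lambda>_. 0)"
  shows "wp degrees (12 + m * 80) (\<lambda>s'. \<forall>t. iarr s' ''d'' t = card {b. {t, b} \<in> edges T} \<and>
    iarr s' ''s'' t = \<Sum>{b. {t, b} \<in> edges T}) s"
proof -
  let ?b = "Seq (Seq (IAssign ''d'' (IGet ''src'' (Var ''x'')) (Inc (IGet ''d'' (IGet ''src'' (Var ''x'')))))
      (IAssign ''d'' (IGet ''dst'' (Var ''x'')) (Inc (IGet ''d'' (IGet ''dst'' (Var ''x''))))))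
    (Seq (IAssign ''s'' (IGet ''src'' (Var ''x'')) (IPlus (IGet ''s'' (IGet ''src'' (Var ''x''))) (IGet ''dst'' (Var ''x''))))
      (IAssign ''s'' (IGet ''dst'' (Var ''x'')) (IPlus (IGet ''s'' (IGet ''dst'' (Var ''x''))) (IGet ''src'' (Var ''x'')))))"
  define E where "E e = set (map (\<lambda>(a, b). {a, b}) (take e es))" for e
  define nb where "nb e t = {b. {t, b} \<in> E e}" for e t
  let ?I = "\<lambda>e s'. \<forall>t. iarr s' ''d'' t = card (nb e t) \<and> iarr s' ''s'' t = \<Sum>(nb e t)"
  have "wp degrees (12 + length es * (cost ?b + 15)) (?I (length es)) s"
    unfolding degrees_def
  proof (rule wp_For_loopfree[where I = ?I])
    fix s' assume "same (insert ''x'' (iw ?b)) (qw ?b) s s'"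
    then show "ival (Var ''num_edges'') s' = length es" using len by (simp add: same_def)
  next
    show "?I 0 (iupd ''x'' 0 0 s)" using zero by (simp add: nb_def E_def)
  next
    fix e s' assume e: "e < length es" and same: "same (insert ''x'' (iw ?b)) (qw ?b) s s'"
      and x: "iarr s' ''x'' 0 = e" and I: "?I e s'"
    obtain a b where ab: "es ! e = (a, b)" by fastforce
    note es = es_nth[OF e ab]
    have eqs: "iarr s' ''src'' e = a" "iarr s' ''dst'' e = b" using same src e ab by (auto simp: same_def)
    have E: "E (Suc e) = insert {a, b} (E e)" using e ab by (auto simp: E_def take_Suc_conv_app_nth)
    have "nb e t \<subseteq> {..<m}" for t
    proof
      fix c assume "c \<in> nb e t"
      moreover have "E e \<subseteq> edges T"
        using image_mono[OF set_take_subset[of e es], of "\<lambda>(a, b). {a, b}"] listing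
        by (simp add: E_def edge_listing_def)
      ultimately have "{t, c} \<in> edges T" by (auto simp: nb_def)
      then show "c \<in> {..<m}" using edges_T_less by blast
    qed
    then have fin: "finite (nb e t)" for t using finite_subset by blast
    have new: "b \<notin> nb e a" "a \<notin> nb e b" using es(3) by (auto simp: nb_def E_def insert_commute)
    have nb: "nb (Suc e) t = (if t = a then insert b (nb e a) else if t = b then insert a (nb e b) else nb e t)" for t
      using es(2) by (auto simp: nb_def E doubleton_eq_iff)
    show "?I (Suc e) (iupd ''x'' 0 (Suc e) (sem ?b s'))"
      using I es(2) fin new by (simp add: x eqs nb)
  qed auto
  then show ?thesis
  proof (rule wp_mono)
    have "length es * (cost ?b + 15) \<le> m * 80" using length_es by (intro mult_le_mono) simp_all
    then show "12 + length es * (cost ?b + 15) \<le> 12 + m * 80" by simp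
    have "nb (length es) t = {b. {t, b} \<in> edges T}" for t
      using listing by (auto simp: nb_def E_def edge_listing_def)
    then show "\<And>s'. ?I (length es) s' \<Longrightarrow> \<forall>t. iarr s' ''d'' t = card {b. {t, b} \<in> edges T} \<and>
      iarr s' ''s'' t = \<Sum>{b. {t, b} \<in> edges T}" by simp
  qed
qed

lemma wp_setup_tables:
  assumes n: "iarr s ''n'' 0 = n" and m: "iarr s ''m'' 0 = m"
    and zero: "\<And>x. x \<in> {''M'', ''D'', ''R'', ''W'', ''O''} \<Longrightarrow> iarr s x 0 = 0" and zeroW: "qarr s ''W'' 0 = 0"
    and adj: "\<forall>u<n. \<forall>v<n. iarr s ''adj'' (u * n + v) = (if {u, v} \<in> edges G then 1 else 0)"
    and bag: "\<forall>t\<le>m. \<forall>x<n. iarr s ''bag'' (t * n + x) = (if x \<in> bag t then 1 else 0)"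
    and wt: "\<forall>x<n. qarr s ''weight'' x = w x"
  shows "wp (setup_tables k) (20 + ((12 + k * (100 * B)) + ((12 + N * 50) + (100 * sz + ((12 + (n + m) * 50) +
    ((12 + m * 50) + (100 * sz + 150 * sz))))))) tables_ok s"
  unfolding setup_tables_def
proof (rule wp_Seq_frame[OF wp_constants[OF n]])
  fix s1 assume s1: "iarr s1 ''B'' 0 = B \<and> iarr s1 ''N'' 0 = 1" and S1: "same (iw constants) (qw constants) s s1"
  show "wp (Seq (num_codes k) (Seq mult_table (Seq div_table (Seq row_table
     (Seq offset_table (Seq weight_table valid_table)))))) ((12 + k * (100 * B)) + ((12 + N * 50) + (100 * sz + ((12 + (n + m) * 50) +
    ((12 + m * 50) + (100 * sz + 150 * sz)))))) tables_ok s1"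
  proof (rule wp_Seq_frame[OF wp_num_codes[OF conjunct1[OF s1] conjunct2[OF s1]]])
    fix s2 assume N2: "iarr s2 ''N'' 0 = N" and S2: "same (iw (num_codes k)) (qw (num_codes k)) s1 s2"
    have e2: "iarr s2 ''B'' 0 = B" using s1 S2 by (simp add: same_def)
    have S2': "same {''B'', ''N'', ''y'', ''z'', ''x''} {} s s2" using S1 S2 by (simp add: same_def)
    have t3: "wp mult_table (12 + N * 50) (\<lambda>s'. \<forall>i\<le>N. iarr s' ''M'' i = i * B) s2"
      unfolding mult_table_def using S2' zero e2 N2 by (intro wp_arith_table) (auto simp: same_def)
    show "wp (Seq mult_table (Seq div_table (Seq row_table (Seq offset_table (Seq weight_table valid_table)))))
      ((12 + N * 50) + (100 * sz + ((12 + (n + m) * 50) + ((12 + m * 50) + (100 * sz + 150 * sz))))) tables_ok s2"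
    proof (rule wp_Seq_frame[OF t3])
      fix s3 assume M3: "\<forall>i\<le>N. iarr s3 ''M'' i = i * B" and S3: "same (iw mult_table) (qw mult_table) s2 s3"
      have e3: "iarr s3 ''B'' 0 = B" "iarr s3 ''N'' 0 = N" "iarr s3 ''D'' 0 = 0" "iarr s3 ''R'' 0 = 0"
        using S3 S2' e2 N2 zero by (auto simp: same_def)
      have S3': "same {''B'', ''N'', ''y'', ''z'', ''x'', ''M''} {} s s3" using S2' S3 by (simp add: same_def)
      show "wp (Seq div_table (Seq row_table (Seq offset_table (Seq weight_table valid_table))))
        (100 * sz + ((12 + (n + m) * 50) + ((12 + m * 50) + (100 * sz + 150 * sz)))) tables_ok s3"
      proof (rule wp_Seq_frame[OF wp_div_table[OF e3(2,1,3,4)]])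
        fix s4 assume D4: "\<forall>i<N. iarr s4 ''D'' i = i div B \<and> iarr s4 ''R'' i = i mod B"
          and S4: "same (iw div_table) (qw div_table) s3 s4"
        have e4: "iarr s4 ''N'' 0 = N" "\<forall>i\<le>N. iarr s4 ''M'' i = i * B"
          using S4 e3 M3 by (auto simp: same_def)
        have S4': "same {''B'', ''N'', ''y'', ''z'', ''x'', ''M'', ''D'', ''R''} {} s s4" using S3' S4 by (simp add: same_def)
        have t5: "wp row_table (12 + (n + m) * 50) (\<lambda>s'. \<forall>i\<le>n + m. iarr s' ''W'' i = i * n) s4"
          unfolding row_table_def using S4' zero n m by (intro wp_arith_table) (auto simp: same_def)
        show "wp (Seq row_table (Seq offset_table (Seq weight_table valid_table)))
          ((12 + (n + m) * 50) + ((12 + m * 50) + (100 * sz + 150 * sz))) tables_ok s4"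
        proof (rule wp_Seq_frame[OF t5])
          fix s5 assume W5: "\<forall>i\<le>n + m. iarr s5 ''W'' i = i * n" and S5: "same (iw row_table) (qw row_table) s4 s5"
          have e5: "iarr s5 ''N'' 0 = N" "\<forall>i\<le>N. iarr s5 ''M'' i = i * B"
            "\<forall>i<N. iarr s5 ''D'' i = i div B \<and> iarr s5 ''R'' i = i mod B"
            using S5 e4 D4 by (auto simp: same_def)
          have S5': "same {''B'', ''N'', ''y'', ''z'', ''x'', ''M'', ''D'', ''R'', ''W''} {} s s5" using S4' S5 by (simp add: same_def)
          have t6: "wp offset_table (12 + m * 50) (\<lambda>s'. \<forall>i\<le>m. iarr s' ''O'' i = i * N) s5"
            unfolding offset_table_def using S5' zero e5 m by (intro wp_arith_table) (auto simp: same_def)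
          show "wp (Seq offset_table (Seq weight_table valid_table)) ((12 + m * 50) + (100 * sz + 150 * sz)) tables_ok s5"
          proof (rule wp_Seq_frame[OF t6])
            fix s6 assume O6: "\<forall>i\<le>m. iarr s6 ''O'' i = i * N" and S6: "same (iw offset_table) (qw offset_table) s5 s6"
            have e6: "iarr s6 ''N'' 0 = N" "\<forall>i\<le>N. iarr s6 ''M'' i = i * B"
              "\<forall>i<N. iarr s6 ''D'' i = i div B \<and> iarr s6 ''R'' i = i mod B" "\<forall>i\<le>n + m. iarr s6 ''W'' i = i * n"
              using S6 e5 W5 by (auto simp: same_def)
            have S6': "same {''B'', ''N'', ''y'', ''z'', ''x'', ''M'', ''D'', ''R'', ''W'', ''O''} {} s s6"
              using S5' S6 by (simp add: same_def)
            have q6: "qarr s6 ''W'' 0 = 0" "\<forall>x<n. qarr s6 ''weight'' x = w x"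
              using S6' zeroW wt by (auto simp: same_def)
            show "wp (Seq weight_table valid_table) (100 * sz + 150 * sz) tables_ok s6"
            proof (rule wp_Seq_frame[OF wp_weight_table[OF e6(1) q6(1) e6(3) q6(2)]])
              fix s7 assume W7: "\<forall>i<N. qarr s7 ''W'' i = wts i" and S7: "same (iw weight_table) (qw weight_table) s6 s7"
              have e7: "iarr s7 ''N'' 0 = N" "\<forall>i\<le>N. iarr s7 ''M'' i = i * B"
                "\<forall>i<N. iarr s7 ''D'' i = i div B \<and> iarr s7 ''R'' i = i mod B"
                "\<forall>i\<le>n + m. iarr s7 ''W'' i = i * n" "\<forall>i\<le>m. iarr s7 ''O'' i = i * N"
                using S7 e6 O6 by (auto simp: same_def)
              have S7': "same {''B'', ''N'', ''y'', ''z'', ''x'', ''M'', ''D'', ''R'', ''W'', ''O''} {''W''} s s7"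
                using S6' S7 by (simp add: same_def)
              have e7': "\<forall>i<n. iarr s7 ''W'' i = i * n"
                "\<forall>u<n. \<forall>v<n. iarr s7 ''adj'' (u * n + v) = (if {u, v} \<in> edges G then 1 else 0)"
                "iarr s7 ''n'' 0 = n" "iarr s7 ''m'' 0 = m" "iarr s7 ''bag'' = iarr s ''bag''"
                using e7(4) S7' adj n m by (auto simp: same_def)
              show "wp valid_table (150 * sz) tables_ok s7"
              proof (rule wp_mono[OF wp_frame[OF wp_valid_table[OF e7(1,2,3) e7'(1,2)]] order_refl])
                fix s8 assume A: "(\<forall>i<N. iarr s8 ''I'' i = (if vld i then 0 else 1)) \<and> same (iw valid_table) (qw valid_table) s7 s8"
                then have "\<And>x. x \<noteq> ''x'' \<Longrightarrow> x \<noteq> ''I'' \<Longrightarrow> iarr s8 x = iarr s7 x" "\<And>x. qarr s8 x = qarr s7 x"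
                  by (auto simp: same_def)
                then show "tables_ok s8" unfolding tables_ok_def using A e7 e7' W7 bag by simp
              qed
            qed
          qed
        qed
      qed
    qed
  qed
qed

end


section \<open>The complete program\<close>

definition mwis_program :: "nat \<Rightarrow> com" where
  "mwis_program k = Seq (setup_tables k) (Seq degrees (Seq eliminate_all (Seq eliminate_root (traceback k))))"

context bounded_td
begin

abbreviation "s0 \<equiv> input_state G w T X es"

lemma input_scalars: "iarr s0 ''n'' 0 = n" "iarr s0 ''m'' 0 = m" "iarr s0 ''num_edges'' 0 = length es"
  by (simp_all add: input_state_def Let_def n_def m_def)

lemma input_zero:
  "x \<in> {''M'', ''D'', ''R'', ''W'', ''O'', ''d'', ''s'', ''c'', ''i'', ''v'', ''r'', ''a'', ''out''} \<Longrightarrow> iarr s0 x = (\<lambda>_. 0)"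
  "x \<in> {''W'', ''T''} \<Longrightarrow> qarr s0 x = (\<lambda>_. 0)"
  by (auto simp: input_state_def Let_def)

lemma matrix_index_less: "x < n \<Longrightarrow> t * n + x < l * n \<longleftrightarrow> t < l"
proof
  assume x: "x < n" and "t < l"
  then have "Suc t * n \<le> l * n" by (intro mult_le_mono1) simp
  then show "t * n + x < l * n" using x by simp
next
  assume x: "x < n" and "t * n + x < l * n"
  then have "t * n < l * n" by linarith
  then show "t < l" by simp
qed

lemma input_adj: "\<forall>u<n. \<forall>v<n. iarr s0 ''adj'' (u * n + v) = (if {u, v} \<in> edges G then 1 else 0)"
  by (auto simp: input_state_def Let_def matrix_index_less simp flip: n_def)

text \<open>Row \<open>m\<close> lies beyond the stored matrix and reads as zeros, which is the
  empty bag of the additional node.\<close>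

lemma input_bag: "\<forall>t\<le>m. \<forall>x<n. iarr s0 ''bag'' (t * n + x) = (if x \<in> bag t then 1 else 0)"
  by (auto simp: input_state_def Let_def matrix_index_less bag_def simp flip: n_def m_def)

lemma input_weight: "\<forall>x<n. qarr s0 ''weight'' x = w x"
  by (auto simp: input_state_def Let_def simp flip: n_def)

lemma input_edges: "\<forall>e<length es. iarr s0 ''src'' e = fst (es ! e) \<and> iarr s0 ''dst'' e = snd (es ! e)"
  by (auto simp: input_state_def Let_def)

lemma loop_inv_init:
  assumes tables_ok: "tables_ok s" and deg: "\<forall>t. iarr s ''d'' t = card {b. {t, b} \<in> edges T} \<and> iarr s ''s'' t = \<Sum>{b. {t, b} \<in> edges T}"
    and zero: "iarr s ''c'' 0 = 0" "iarr s ''i'' 0 = 0" "iarr s ''v'' 0 = 0" "iarr s ''r'' 0 = 0" "qarr s ''T'' = (\<lambda>_. 0)"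
  shows "loop_inv s []"
proof -
  have "tabm s = (\<lambda>_ _. 0)" using zero by (simp add: tabm_def fun_eq_iff)
  then have "dp s []" using zero opt_Nil elimination.Nil by (simp add: dp_def stk_def)
  moreover have "nbs [] t = {b. {t, b} \<in> edges T}" for t
    using edges_T_less by (auto simp: nbs_def remaining_def intro: less_imp_le)
  then have "deg_inv (iarr s ''d'') (iarr s ''s'') []"
    using deg by (auto simp: deg_inv_def remaining_def)
  ultimately show ?thesis
    using tables_ok zero m_pos edges_ok_Nil unfolding loop_inv_def by (auto simp: remaining_def)
qed

lemma wp_mwis_program:
  "wp (mwis_program k) (5000 * (k + 1) * (sz * m)) (\<lambda>s. max_weight_independent_set G w (output_set G s)) s0"
proof -
  let ?Q = "\<lambda>s. max_weight_independent_set G w (output_set G s)"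
  let ?ts = "20 + ((12 + k * (100 * B)) + ((12 + N * 50) + (100 * sz + ((12 + (n + m) * 50) +
    ((12 + m * 50) + (100 * sz + 150 * sz))))))"
  have tables: "wp (setup_tables k) ?ts tables_ok s0"
  proof (intro wp_setup_tables input_scalars input_adj input_bag input_weight)
    show "iarr s0 x 0 = 0" if "x \<in> {''M'', ''D'', ''R'', ''W'', ''O''}" for x
      using input_zero(1)[of x] that by auto
    show "qarr s0 ''W'' 0 = 0" using input_zero(2) by simp
  qed
  have "wp (mwis_program k) (?ts + ((12 + m * 80) + ((10 + 2 * m * (500 * sz)) + (400 * sz + (10 + m * (200 * sz + k * 50)))))) ?Q s0"
    unfolding mwis_program_def
  proof (rule wp_Seq_frame[OF tables])
    fix s1 assume sta1: "tables_ok s1" and same1: "same (iw (setup_tables k)) (qw (setup_tables k)) s0 s1"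
    have deg: "wp degrees (12 + m * 80) (\<lambda>s'. \<forall>t. iarr s' ''d'' t = card {b. {t, b} \<in> edges T} \<and>
      iarr s' ''s'' t = \<Sum>{b. {t, b} \<in> edges T}) s1"
      using same1 input_scalars input_zero input_edges by (intro wp_degrees) (auto simp: same_def)
    show "wp (Seq degrees (Seq eliminate_all (Seq eliminate_root (traceback k))))
      ((12 + m * 80) + ((10 + 2 * m * (500 * sz)) + (400 * sz + (10 + m * (200 * sz + k * 50))))) ?Q s1"
    proof (rule wp_Seq_frame[OF deg])
      fix s2 assume deg2: "\<forall>t. iarr s2 ''d'' t = card {b. {t, b} \<in> edges T} \<and> iarr s2 ''s'' t = \<Sum>{b. {t, b} \<in> edges T}"
        and same2: "same (iw degrees) (qw degrees) s1 s2"
      have sta2: "tables_ok s2" by (rule tables_ok_same[OF sta1 same2]) (auto simp: table_names_def)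
      have z2: "iarr s2 x = (\<lambda>_. 0)" if "x \<in> {''c'', ''i'', ''v'', ''r'', ''a'', ''out''}" for x
      proof -
        have "x \<notin> iw degrees" "x \<notin> iw (setup_tables k)" using that by auto
        moreover have "iarr s0 x = (\<lambda>_. 0)" using that by (intro input_zero(1)) auto
        ultimately show ?thesis using sameD(1)[OF same1] sameD(1)[OF same2] by simp
      qed
      have "qarr s2 ''T'' = (\<lambda>_. 0)" using same1 same2 input_zero(2)[of "''T''"] by (simp add: same_def)
      then have inv: "loop_inv s2 []" using z2 by (intro loop_inv_init[OF sta2 deg2]) simp_all
      show "wp (Seq eliminate_all (Seq eliminate_root (traceback k)))
        ((10 + 2 * m * (500 * sz)) + (400 * sz + (10 + m * (200 * sz + k * 50)))) ?Q s2"
      proof (rule wp_Seq_frame[OF wp_eliminate_all[OF inv]])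
        show "iarr s2 ''i'' 0 = 0" using z2 by simp
        fix s3 assume "\<exists>evs. loop_inv s3 evs \<and> iarr s3 ''i'' 0 = m"
          and same3: "same (iw eliminate_all) (qw eliminate_all) s2 s3"
        then obtain evs where inv3: "loop_inv s3 evs" and i3: "iarr s3 ''i'' 0 = m" by blast
        have sta3: "tables_ok s3" using inv3 by (simp add: loop_inv_def)
        show "wp (Seq eliminate_root (traceback k)) (400 * sz + (10 + m * (200 * sz + k * 50))) ?Q s3"
        proof (rule wp_Seq_frame[OF wp_eliminate_root[OF inv3 i3]])
          fix s4 assume "\<exists>evs. dp s4 evs \<and> remaining evs = {m} \<and> max_weight_independent_set G w (sol evs (argm s4) m 0)"
            and same4: "same (iw eliminate_root) (qw eliminate_root) s3 s4"
          then obtain evs where evs: "dp s4 evs" "remaining evs = {m}"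
            and max: "max_weight_independent_set G w (sol evs (argm s4) m 0)" by blast
          have sta4: "tables_ok s4" by (rule tables_ok_same[OF sta3 same4]) (auto simp: table_names_def)
          have z4: "iarr s4 ''a'' = (\<lambda>_. 0)" "iarr s4 ''out'' = (\<lambda>_. 0)"
            using z2 same3 same4 by (auto simp: same_def)
          show "wp (traceback k) (10 + m * (200 * sz + k * 50)) ?Q s4"
          proof (rule wp_mono[OF wp_traceback[OF evs sta4 z4] order_refl])
            fix s5 assume out: "outset s5 = sol evs (argm s4) m 0"
            have "sol evs (argm s4) m 0 \<subseteq> verts G"
              using max by (simp add: max_weight_independent_set_def independent_set_def)
            then have "output_set G s5 = sol evs (argm s4) m 0"
              using out by (auto simp: output_set_def outset_def)
            then show "?Q s5" using max by simp
          qed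
        qed
      qed
    qed
  qed
  then show ?thesis
  proof (rule wp_mono)
    \<comment> \<open>As \<open>sz\<close> and \<open>m\<close> are at least 1, each summand is at
      most a constant times \<open>p\<close> or \<open>k * p\<close>; 5000 leaves room.\<close>
    define p where "p = sz * m"
    have "0 < sz" by (simp add: sz_def)
    then have p: "sz \<le> p" "m \<le> p" "1 \<le> p" using m_pos by (simp_all add: p_def Suc_leI)
    have "B \<le> sz" "N \<le> sz" "n \<le> sz" by (auto simp: sz_def B_def N_pos)
    then have le: "B \<le> p" "N \<le> p" "n \<le> p" using p by linarith+
    have kp: "k * B \<le> k * p" "k * m \<le> k * p" using mult_le_mono2[OF le(1)] mult_le_mono2[OF p(2)] by blast+
    have e: "m * (200 * sz + k * 50) = 200 * p + 50 * (k * m)" "2 * m * (500 * sz) = 1000 * p"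
      "k * (100 * B) = 100 * (k * B)" "(n + m) * 50 = 50 * n + 50 * m"
      "5000 * (k + 1) * (sz * m) = 5000 * (k * p) + 5000 * p" by (simp_all add: p_def algebra_simps)
    show "?ts + ((12 + m * 80) + ((10 + 2 * m * (500 * sz)) + (400 * sz + (10 + m * (200 * sz + k * 50)))))
      \<le> 5000 * (k + 1) * (sz * m)" unfolding e using le p kp by linarith
  qed
qed

text \<open>Rests on \<open>n + 1 \<le> 2 * max 1 n\<close>, at the price of a factor
  \<open>2 ^ k\<close>. The maximum covers the empty graph, whose decomposition tree must still be
  processed.\<close>

lemma sz_le: "sz \<le> (2 ^ k + 2) * max 1 n ^ (k + 1)"
proof -
  let ?x = "max 1 n"
  have pos: "1 \<le> ?x ^ i" for i by simp
  have "N \<le> (2 * ?x) ^ k" unfolding N_def B_def by (intro power_mono) auto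
  also have "\<dots> = 2 ^ k * ?x ^ k" by (simp add: power_mult_distrib)
  also have "\<dots> \<le> 2 ^ k * ?x ^ (k + 1)" by (intro mult_le_mono2 power_increasing) auto
  finally have "N \<le> 2 ^ k * ?x ^ (k + 1)" .
  moreover have "n \<le> ?x ^ (k + 1)" using self_le_power[of ?x "k + 1"] by simp
  moreover have "(2 ^ k + 2) * ?x ^ (k + 1) = 2 ^ k * ?x ^ (k + 1) + ?x ^ (k + 1) + ?x ^ (k + 1)"
    by (simp only: distrib_right)
  ultimately show ?thesis using pos[of "k + 1"] unfolding sz_def by linarith
qed

end

theorem corollary5p3:
  fixes k :: nat
  assumes "k \<ge> 1"
  shows "\<exists>(prog :: com) (C :: nat). \<forall>G w T X es.
    mwis_instance G w T X es \<and> td_independence_number G T X \<le> k \<longrightarrow>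
    (\<exists>t s. exec prog (input_state G w T X es) t s \<and>
       max_weight_independent_set G w (output_set G s) \<and>
       t \<le> C * (max 1 (card (verts G)) ^ (k + 1) * card (verts T)))"
\<comment> \<open>Program and constant depend on \<open>k\<close> alone; the factor
  \<open>2 ^ k + 2\<close> comes from \<open>sz_le\<close>.\<close>
proof (rule exI[of _ "mwis_program k"], rule exI[of _ "5000 * (k + 1) * (2 ^ k + 2)"], intro allI impI)
  fix G :: "nat graph" and w :: "nat \<Rightarrow> rat" and T :: "nat graph" and X :: "nat \<Rightarrow> nat set"
    and es :: "(nat \<times> nat) list"
  assume "mwis_instance G w T X es \<and> td_independence_number G T X \<le> k"
  then interpret bounded_td G w T X es k by unfold_locales auto
  obtain t s where ts: "exec (mwis_program k) (input_state G w T X es) t s"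
    "max_weight_independent_set G w (output_set G s)" "t \<le> 5000 * (k + 1) * (sz * m)"
    using wp_mwis_program unfolding wp_def by blast
  have "5000 * (k + 1) * (sz * m) \<le> 5000 * (k + 1) * ((2 ^ k + 2) * max 1 n ^ (k + 1) * m)"
    by (intro mult_le_mono sz_le) simp_all
  also have "\<dots> = 5000 * (k + 1) * (2 ^ k + 2) * (max 1 (card (verts G)) ^ (k + 1) * card (verts T))"
    by (simp only: n_def m_def mult.assoc)
  finally have "t \<le> 5000 * (k + 1) * (2 ^ k + 2) * (max 1 (card (verts G)) ^ (k + 1) * card (verts T))"
    using ts(3) by simp
  then show "\<exists>t s. exec (mwis_program k) (input_state G w T X es) t s \<and>
       max_weight_independent_set G w (output_set G s) \<and>
       t \<le> 5000 * (k + 1) * (2 ^ k + 2) * (max 1 (card (verts G)) ^ (k + 1) * card (verts T))"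
    using ts by blast
qed

end
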